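(* Let $(X,Y)$ be a norming dual pair, let $\tau$ be a consistent topology on $X$ which is sequentially complete, and let $A$ be a $\sigma$-closed operator on $X$. Let $M\ge1$ and $\alpha,\omega\in\mathbb{R}$. The following are equivalent. (1) $A$ is the generator of a $\tau$-continuous, ${}_\alpha$quasi-$\tau$-equicontinuous, integrable semigroup $\mathbf{T}$ on $(X,Y)$ of type $(M,\omega)$. (2) $A$ is a sequentially $\tau$-densely defined operator such that (a) $\{\lambda\in\mathbb{R}:\lambda>\omega\}\subset\rho_\sigma(A)$ and $\|(\lambda-\omega)^kR(\lambda,A)^k\|\le M$ for all $\lambda>\omega$, $k\in\mathbb{N}$; and (b) the set $\{(\lambda-\alpha)^kR(\lambda,A)^k:\lambda>\alpha,\ k\in\mathbb{N}\}$ is $\tau$-equicontinuous.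
   Context: A dual pair $(X,Y,\langle\cdot,\cdot\rangle)$ consists of vector spaces over $\mathbb{K}=\mathbb{R}$ or $\mathbb{C}$ and a bilinear form $X\times Y\to\mathbb{K}$ separating points. It is a norming dual pair if $X,Y$ are Banach spaces with $\|x\|=\sup\{|\langle x,y\rangle|:y\in Y,\|y\|\le1\}$ and $\|y\|=\sup\{|\langle x,y\rangle|:x\in X,\|x\|\le1\}$. $\sigma=\sigma(X,Y)$ is the weak topology on $X$. For a locally convex topology $\tau$ on $X$, $L(X,\tau)$ is the algebra of $\tau$-continuous linear operators on $X$. A locally convex topology $\tau$ on $X$ is consistent if $(X,\tau)'=Y$, i.e. the $\tau$-continuous linear functionals are exactly the maps $x\mapsto\langle x,y\rangle$, $y\in Y$. A linear operator $A$ with domain $D(A)\subset X$ is $\sigma$-closed if its graph is closed in $X\times X$ for $\sigma\times\sigma$. $\rho(A)$ is the resolvent set, $R(\lambda,A)=(\lambda-A)^{-1}$, and $\rho_\sigma(A)=\{\lambda\in\rho(A):R(\lambda,A)\in L(X,\sigma)\}$. $A$ is sequentially $\tau$-densely defined if every $x\in X$ is the $\tau$-limit of a sequence in $D(A)$. A semigroup on $(X,Y)$ is a family $\mathbf{T}=(T(t))_{t\ge0}\subset L(X,\sigma)$ with $T(0)=I$, $T(t+s)=T(t)T(s)$ for all $t,s\ge0$, which is exponentially bounded: $\|T(t)\|\le Me^{\omega t}$ for all $t\ge0$ and some $M\ge1$, $\omega\in\mathbb{R}$; then $\mathbf{T}$ is of type $(M,\omega)$. A semigroup of type $(M,\omega)$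 is integrable if for all $\lambda$ with $\mathrm{Re}\,\lambda>\omega$ there is $R(\lambda)\in L(X,\sigma)$ with $\langle R(\lambda)x,y\rangle=\int_0^\infty e^{-\lambda t}\langle T(t)x,y\rangle\,dt$ for all $x\in X,y\in Y$ (all integrals existing). $(R(\lambda))$ is its Laplace transform, a pseudoresolvent. If it is injective, the unique operator $A$ with $R(\lambda)=(\lambda-A)^{-1}$ for all $\lambda$ is the generator of $\mathbf{T}$. $\mathbf{T}$ is $\tau$-continuous if $t\mapsto T(t)x$ is $\tau$-continuous on $[0,\infty)$ for every $x\in X$. A set $\mathcal{S}\subset L(X,\tau)$ is $\tau$-equicontinuous if for every $\tau$-continuous seminorm $p$ there is a $\tau$-continuous seminorm $q$ with $p(Tx)\le q(x)$ for all $x\in X$, $T\in\mathcal{S}$. $\mathbf{T}$ is ${}_\alpha$quasi-$\tau$-equicontinuous if $\{e^{-\alpha t}T(t):t\ge0\}$ is $\tau$-equicontinuous. *)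

theory Defs
  imports "HOL-Analysis.Analysis"
begin

text \<open>
  The scalar field \<open>\<real>\<close> or \<open>\<complex>\<close> is a type of sort \<open>{real_normed_field, euclidean_space}\<close>.
  Both \<open>real\<close> and \<open>complex\<close> have this sort, and by Frobenius' theorem every type of this
  sort is isometrically isomorphic to one of them. The real part of \<open>z\<close> is \<open>z \<bullet> 1\<close>.
\<close>

definition re_part :: "'k::{real_normed_field,euclidean_space} \<Rightarrow> real" where
  "re_part z = z \<bullet> 1"

lemma re_part_real: "re_part (z::real) = z"
  by (simp add: re_part_def)

lemma re_part_complex: "re_part (z::complex) = Re z"
  by (simp add: re_part_def inner_complex_def)


text \<open>
  A Banach space over the scalar field is a type of class \<open>banach\<close>, which supplies the group
  structure, the norm and completeness, with a scalar multiplication by the field that extends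
  the real one.
\<close>

locale banach_over = vector_space scale
  for scale :: "'k::{real_normed_field,euclidean_space} \<Rightarrow> 'x::banach \<Rightarrow> 'x" +
  assumes scale_of_real: "scale (of_real r) x = r *\<^sub>R x"
    and norm_scale: "norm (scale c x) = norm c * norm x"

locale dual_pair = X: vector_space sX + Y: vector_space sY
  for sX :: "'k::field \<Rightarrow> 'x::ab_group_add \<Rightarrow> 'x"
    and sY :: "'k \<Rightarrow> 'y::ab_group_add \<Rightarrow> 'y" +
  fixes B :: "'x \<Rightarrow> 'y \<Rightarrow> 'k"
  assumes linear_left: "Vector_Spaces.linear sX (*) (\<lambda>x. B x y)"
    and linear_right: "Vector_Spaces.linear sY (*) (\<lambda>y. B x y)"
    and separating_left: "(\<forall>y. B x y = 0) \<Longrightarrow> x = 0"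
    and separating_right: "(\<forall>x. B x y = 0) \<Longrightarrow> y = 0"

text \<open>
  Boundedness of the two sets is stated because the supremum of an unbounded set of reals is an
  unspecified value.
\<close>

locale norming_dual_pair = dual_pair sX sY B + X: banach_over sX + Y: banach_over sY
  for sX :: "'k::{real_normed_field,euclidean_space} \<Rightarrow> 'x::banach \<Rightarrow> 'x"
    and sY :: "'k \<Rightarrow> 'y::banach \<Rightarrow> 'y"
    and B :: "'x \<Rightarrow> 'y \<Rightarrow> 'k" +
  assumes bdd_left: "bdd_above ((\<lambda>y. norm (B x y)) ` {y. norm y \<le> 1})"
    and norm_left: "norm x = (SUP y\<in>{y. norm y \<le> 1}. norm (B x y))"
    and bdd_right: "bdd_above ((\<lambda>x. norm (B x y)) ` {x. norm x \<le> 1})"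
    and norm_right: "norm y = (SUP x\<in>{x. norm x \<le> 1}. norm (B x y))"


definition weak_topology :: "('x \<Rightarrow> 'y \<Rightarrow> 'k::topological_space) \<Rightarrow> 'x topology" where
  "weak_topology B = topology_generated_by {{x. B x y \<in> U} | y U. open U}"

definition is_seminorm :: "('k::real_normed_field \<Rightarrow> 'x::ab_group_add \<Rightarrow> 'x) \<Rightarrow> ('x \<Rightarrow> real) \<Rightarrow> bool"
  where "is_seminorm s p \<longleftrightarrow>
    (\<forall>x y. p (x + y) \<le> p x + p y) \<and> (\<forall>c x. p (s c x) = norm c * p x)"

text \<open>
  The family of seminorms is nonempty so that the whole type is the underlying space; the
  indiscrete topology is generated by the zero seminorm.
\<close>

definition locally_convex_topology ::
  "('k::real_normed_field \<Rightarrow> 'x::ab_group_add \<Rightarrow> 'x) \<Rightarrow> 'x topology \<Rightarrow> bool" where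
  "locally_convex_topology s \<tau> \<longleftrightarrow>
    (\<exists>P. P \<noteq> {} \<and> (\<forall>p\<in>P. is_seminorm s p) \<and>
      \<tau> = topology_generated_by {{x. p (x - a) < r} | p a r. p \<in> P \<and> 0 < r})"

definition consistent_topology ::
  "('k::real_normed_field \<Rightarrow> 'x::ab_group_add \<Rightarrow> 'x) \<Rightarrow> ('x \<Rightarrow> 'y \<Rightarrow> 'k) \<Rightarrow> 'x topology \<Rightarrow> bool" where
  "consistent_topology s B \<tau> \<longleftrightarrow> locally_convex_topology s \<tau> \<and>
    {f. Vector_Spaces.linear s (*) f \<and> continuous_map \<tau> euclidean f} = range (\<lambda>y x. B x y)"

definition sequentially_complete :: "'x::ab_group_add topology \<Rightarrow> bool" where
  "sequentially_complete \<tau> \<longleftrightarrow>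
    (\<forall>u :: nat \<Rightarrow> 'x.
      (\<forall>U. openin \<tau> U \<and> 0 \<in> U \<longrightarrow> (\<exists>N. \<forall>m\<ge>N. \<forall>n\<ge>N. u m - u n \<in> U)) \<longrightarrow>
      (\<exists>l. limitin \<tau> u l sequentially))"

definition continuous_operators ::
  "('k::field \<Rightarrow> 'x::ab_group_add \<Rightarrow> 'x) \<Rightarrow> 'x topology \<Rightarrow> ('x \<Rightarrow> 'x) set" where
  "continuous_operators s \<tau> = {S. Vector_Spaces.linear s s S \<and> continuous_map \<tau> \<tau> S}"

definition equicontinuous_ops ::
  "('k::real_normed_field \<Rightarrow> 'x::ab_group_add \<Rightarrow> 'x) \<Rightarrow> 'x topology \<Rightarrow> ('x \<Rightarrow> 'x) set \<Rightarrow> bool" where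
  "equicontinuous_ops s \<tau> F \<longleftrightarrow> F \<subseteq> continuous_operators s \<tau> \<and>
    (\<forall>p. is_seminorm s p \<and> continuous_map \<tau> euclidean p \<longrightarrow>
      (\<exists>q. is_seminorm s q \<and> continuous_map \<tau> euclidean q \<and> (\<forall>S\<in>F. \<forall>x. p (S x) \<le> q x)))"


text \<open>
  An operator is given by its domain \<open>D\<close> and a function \<open>A\<close> whose values outside \<open>D\<close> are
  irrelevant.
\<close>

definition linear_operator ::
  "('k::field \<Rightarrow> 'x::ab_group_add \<Rightarrow> 'x) \<Rightarrow> 'x set \<Rightarrow> ('x \<Rightarrow> 'x) \<Rightarrow> bool" where
  "linear_operator s D A \<longleftrightarrow> module.subspace s D \<and>
    (\<forall>x\<in>D. \<forall>y\<in>D. A (x + y) = A x + A y) \<and> (\<forall>c. \<forall>x\<in>D. A (s c x) = s c (A x))"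

definition closed_operator :: "'x topology \<Rightarrow> 'x set \<Rightarrow> ('x \<Rightarrow> 'x) \<Rightarrow> bool" where
  "closed_operator \<sigma> D A \<longleftrightarrow> closedin (prod_topology \<sigma> \<sigma>) {(x, A x) | x. x \<in> D}"

definition sequentially_densely_defined :: "'x topology \<Rightarrow> 'x set \<Rightarrow> bool" where
  "sequentially_densely_defined \<tau> D \<longleftrightarrow>
    (\<forall>x. \<exists>u :: nat \<Rightarrow> 'x. (\<forall>n. u n \<in> D) \<and> limitin \<tau> u x sequentially)"

definition resolvent ::
  "('k \<Rightarrow> 'x::ab_group_add \<Rightarrow> 'x) \<Rightarrow> 'x set \<Rightarrow> ('x \<Rightarrow> 'x) \<Rightarrow> 'k \<Rightarrow> 'x \<Rightarrow> 'x" where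
  "resolvent s D A l = inv_into D (\<lambda>x. s l x - A x)"

definition resolvent_set ::
  "('k \<Rightarrow> 'x::real_normed_vector \<Rightarrow> 'x) \<Rightarrow> 'x set \<Rightarrow> ('x \<Rightarrow> 'x) \<Rightarrow> 'k set" where
  "resolvent_set s D A =
    {l. bij_betw (\<lambda>x. s l x - A x) D UNIV \<and> bounded_linear (resolvent s D A l)}"

definition resolvent_set_weak ::
  "('k::real_normed_field \<Rightarrow> 'x::real_normed_vector \<Rightarrow> 'x) \<Rightarrow> ('x \<Rightarrow> 'y \<Rightarrow> 'k) \<Rightarrow>
    'x set \<Rightarrow> ('x \<Rightarrow> 'x) \<Rightarrow> 'k set" where
  "resolvent_set_weak s B D A =
    {l \<in> resolvent_set s D A. resolvent s D A l \<in> continuous_operators s (weak_topology B)}"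


text \<open>
  Only the values \<open>T t\<close> with \<open>t \<ge> 0\<close> matter. The operator norm \<open>onorm\<close> is meaningful only for
  bounded operators, hence the explicit boundedness.
\<close>

definition semigroup_of_type ::
  "('k::real_normed_field \<Rightarrow> 'x::real_normed_vector \<Rightarrow> 'x) \<Rightarrow> ('x \<Rightarrow> 'y \<Rightarrow> 'k) \<Rightarrow>
    real \<Rightarrow> real \<Rightarrow> (real \<Rightarrow> 'x \<Rightarrow> 'x) \<Rightarrow> bool" where
  "semigroup_of_type s B M \<omega> T \<longleftrightarrow>
    (\<forall>t\<ge>0. T t \<in> continuous_operators s (weak_topology B)) \<and>
    T 0 = id \<and> (\<forall>t\<ge>0. \<forall>r\<ge>0. T (t + r) = T t \<circ> T r) \<and>
    M \<ge> 1 \<and> (\<forall>t\<ge>0. bounded_linear (T t) \<and> onorm (T t) \<le> M * exp (\<omega> * t))"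

definition is_laplace_transform_at ::
  "('k::{real_normed_field,euclidean_space} \<Rightarrow> 'x::real_normed_vector \<Rightarrow> 'x) \<Rightarrow> ('x \<Rightarrow> 'y \<Rightarrow> 'k) \<Rightarrow>
    (real \<Rightarrow> 'x \<Rightarrow> 'x) \<Rightarrow> 'k \<Rightarrow> ('x \<Rightarrow> 'x) \<Rightarrow> bool" where
  "is_laplace_transform_at s B T l R \<longleftrightarrow> R \<in> continuous_operators s (weak_topology B) \<and>
    (\<forall>x y. set_integrable lebesgue {0..} (\<lambda>t. exp (- l * of_real t) * B (T t x) y) \<and>
      B (R x) y = (LINT t:{0..}|lebesgue. exp (- l * of_real t) * B (T t x) y))"

definition integrable_semigroup ::
  "('k::{real_normed_field,euclidean_space} \<Rightarrow> 'x::real_normed_vector \<Rightarrow> 'x) \<Rightarrow> ('x \<Rightarrow> 'y \<Rightarrow> 'k) \<Rightarrow>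
    real \<Rightarrow> real \<Rightarrow> (real \<Rightarrow> 'x \<Rightarrow> 'x) \<Rightarrow> bool" where
  "integrable_semigroup s B M \<omega> T \<longleftrightarrow> semigroup_of_type s B M \<omega> T \<and>
    (\<forall>l. re_part l > \<omega> \<longrightarrow> (\<exists>R. is_laplace_transform_at s B T l R))"

text \<open>
  For an integrable semigroup on a dual pair the operator \<open>R\<close> below exists and, since the pairing
  separates points, is unique.
\<close>

definition is_generator ::
  "('k::{real_normed_field,euclidean_space} \<Rightarrow> 'x::real_normed_vector \<Rightarrow> 'x) \<Rightarrow> ('x \<Rightarrow> 'y \<Rightarrow> 'k) \<Rightarrow>
    real \<Rightarrow> real \<Rightarrow> (real \<Rightarrow> 'x \<Rightarrow> 'x) \<Rightarrow> 'x set \<Rightarrow> ('x \<Rightarrow> 'x) \<Rightarrow> bool" where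
  "is_generator s B M \<omega> T D A \<longleftrightarrow> integrable_semigroup s B M \<omega> T \<and>
    (\<forall>l R. re_part l > \<omega> \<and> is_laplace_transform_at s B T l R \<longrightarrow>
      inj R \<and> bij_betw (\<lambda>x. s l x - A x) D UNIV \<and> R = resolvent s D A l)"

definition continuous_semigroup :: "'x topology \<Rightarrow> (real \<Rightarrow> 'x \<Rightarrow> 'x) \<Rightarrow> bool" where
  "continuous_semigroup \<tau> T \<longleftrightarrow> (\<forall>x. continuous_map (top_of_set {0..}) \<tau> (\<lambda>t. T t x))"

definition quasi_equicontinuous ::
  "('k::real_normed_field \<Rightarrow> 'x::real_vector \<Rightarrow> 'x) \<Rightarrow> 'x topology \<Rightarrow> real \<Rightarrow> (real \<Rightarrow> 'x \<Rightarrow> 'x) \<Rightarrow> bool"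
  where "quasi_equicontinuous s \<tau> \<alpha> T \<longleftrightarrow>
    equicontinuous_ops s \<tau> {\<lambda>x. exp (- \<alpha> * t) *\<^sub>R T t x | t. t \<ge> 0}"

end

theory Submission
  imports Defs
begin

text \<open>
  Everything is expressed through the \<open>\<tau>\<close>-continuous seminorms; by consistency, a linear functional
  dominated by one of them is an element of \<open>Y\<close>, so \<open>\<tau>\<close>-estimates yield adjoints on \<open>Y\<close>.

  For a given semigroup, each seminorm \<open>p\<close> is dominated by \<open>q x = sup\<^sub>t e\<^sup>-\<^sup>\<alpha>\<^sup>t p (T(t) x)\<close>, for which the
  \<open>e\<^sup>-\<^sup>\<alpha>\<^sup>t T(t)\<close> are contractions. By sequential completeness the dyadic Riemann sums of
  \<open>e\<^sup>-\<^sup>\<mu>\<^sup>t T(t) x\<close> on \<open>[0, h]\<close> converge in \<open>\<tau>\<close>, and their limit is \<open>R(\<mu>) x - e\<^sup>-\<^sup>\<mu>\<^sup>h T(h) R(\<mu>) x\<close>.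
  Letting \<open>h\<close> tend to 0 gives \<open>(\<mu> - \<alpha>) q (R(\<mu>) x) \<le> q x\<close> for large \<open>\<mu>\<close> and the density of the domain;
  the Neumann series reaches the remaining \<open>\<lambda> > \<alpha>\<close>, and the uniform boundedness principle makes these
  resolvents norm bounded. The same renorming of the norm of \<open>X\<close> gives the estimate with \<open>M\<close>.

  Conversely, the semigroup is \<open>e\<^sup>\<alpha>\<^sup>t\<close> times the limit of the backward Euler scheme
  \<open>(1 - 2\<^sup>-\<^sup>n t (A - \<alpha>))\<^sup>-\<^sup>k\<close> with \<open>k = 2\<^sup>n\<close>. One step of the scheme has error \<open>O(\<delta>\<^sup>2)\<close> on the domain of
  \<open>A\<^sup>2\<close>, so both convergence and the semigroup law follow by telescoping and density. The weak
  derivative on the domain of \<open>A\<close> then identifies the Laplace transform with the resolvent, whose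
  existence for all (possibly complex) \<open>\<lambda>\<close> with real part above \<open>\<omega>\<close> comes from Neumann series in
  norm, on \<open>X\<close> for the resolvent and on \<open>Y\<close> for its adjoint.
\<close>

section \<open>Families of seminorms and the Neumann series\<close>

text \<open>No order is assumed between \<open>\<alpha>\<close> and \<open>\<omega>\<close>: the
  Laplace integral lives beyond \<open>\<omega>\<close>, the \<open>\<tau>\<close>-estimates beyond
  \<open>\<alpha>\<close>. The forward direction therefore starts beyond both and returns to
  \<open>\<alpha>\<close> by resolvent algebra. Sequential completeness yields limits of sequences
  only, and no integral with values in X is given a priori; hence nested dyadic partitions, whose
  limits are identified by testing against Y. Renorming turns the estimate for one resolvent into
  one with constant 1, so powers are reached by induction rather than through an integral formula.
  In the converse the hypotheses bound powers of a single resolvent, and these are exactly what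
  Euler iterates with equal steps consist of; each further step length in a product costs one change
  of seminorm. The norm need not be \<open>\<tau>\<close>-continuous, but it is a supremum of
  functionals from Y, so norm bounds survive \<open>\<tau>\<close>-limits.\<close>

context
  fixes s :: "'k::real_normed_field \<Rightarrow> 'x::ab_group_add \<Rightarrow> 'x" and p :: "'x \<Rightarrow> real"
  assumes vs: "vector_space s" and p: "is_seminorm s p"
begin

interpretation vector_space s by (rule vs)

lemma seminorm_add: "p (x + y) \<le> p x + p y"
  and seminorm_scale: "p (s c x) = norm c * p x"
  using p by (auto simp: is_seminorm_def)

lemma seminorm_zero: "p 0 = 0"
  using seminorm_scale[of 0 0] by simp

lemma seminorm_minus: "p (- x) = p x"
  using seminorm_scale[of "-1" x] by simp

lemma seminorm_diff: "p (x - y) \<le> p x + p y"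
  using seminorm_add[of x "- y"] seminorm_minus[of y] by simp

lemma seminorm_minus_commute: "p (x - y) = p (y - x)"
  using seminorm_minus[of "x - y"] by simp

lemma seminorm_nonneg: "0 \<le> p x"
  using seminorm_diff[of x x] seminorm_zero by simp

lemma seminorm_triangle: "p (x - z) \<le> p (x - y) + p (y - z)"
  using seminorm_add[of "x - y" "y - z"] by simp

lemma seminorm_triangle3: "\<bar>p x - p y\<bar> \<le> p (x - y)"
  using seminorm_add[of "x - y" y] seminorm_add[of "y - x" x] seminorm_minus_commute[of x y] by simp

lemma seminorm_sum: "p (sum f I) \<le> (\<Sum>i\<in>I. p (f i))"
proof (induction I rule: infinite_finite_induct)
  case (insert i I)
  then show ?case using seminorm_add[of "f i" "sum f I"] by simp
qed (auto simp: seminorm_zero)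

end

text \<open>Instantiated by the \<open>\<tau>\<close>-continuous seminorms of X and by the single
  norms of X and of Y, so that one Neumann argument serves all three. Completeness concerns
  sequences that are Cauchy for every member of \<open>Q\<close> at once.\<close>

locale seminorm_family = vector_space s
  for s :: "'k::real_normed_field \<Rightarrow> 'x::ab_group_add \<Rightarrow> 'x" +
  fixes Q :: "('x \<Rightarrow> real) set"
  assumes is_seminorm: "q \<in> Q \<Longrightarrow> is_seminorm s q"
    and separated: "(\<And>q. q \<in> Q \<Longrightarrow> q x = 0) \<Longrightarrow> x = 0"
    and complete: "(\<And>q e. q \<in> Q \<Longrightarrow> 0 < e \<Longrightarrow> \<exists>N. \<forall>m\<ge>N. \<forall>n\<ge>N. q (u m - u n) < e) \<Longrightarrow>
      \<exists>z. \<forall>q\<in>Q. (\<lambda>n. q (u n - z)) \<longlonglongrightarrow> 0"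
begin

lemmas
  add = seminorm_add[OF vector_space_axioms is_seminorm] and
  scale = seminorm_scale[OF vector_space_axioms is_seminorm] and
  zero = seminorm_zero[OF vector_space_axioms is_seminorm] and
  diff = seminorm_diff[OF vector_space_axioms is_seminorm] and
  minus_commute = seminorm_minus_commute[OF vector_space_axioms is_seminorm] and
  nonneg = seminorm_nonneg[OF vector_space_axioms is_seminorm] and
  triangle = seminorm_triangle[OF vector_space_axioms is_seminorm] and
  triangle3 = seminorm_triangle3[OF vector_space_axioms is_seminorm] and
  sum = seminorm_sum[OF vector_space_axioms is_seminorm]

section \<open>Sequences and Neumann series in a family of seminorms\<close>

definition converges_to :: "(nat \<Rightarrow> 'x) \<Rightarrow> 'x \<Rightarrow> bool" where
  "converges_to u z \<longleftrightarrow> (\<forall>q\<in>Q. (\<lambda>n. q (u n - z)) \<longlonglongrightarrow> 0)"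

lemma converges_toD: "converges_to u z \<Longrightarrow> q \<in> Q \<Longrightarrow> (\<lambda>n. q (u n - z)) \<longlonglongrightarrow> 0"
  by (simp add: converges_to_def)

lemma converges_to_seminorm:
  assumes "converges_to u z" "q \<in> Q"
  shows "(\<lambda>n. q (u n)) \<longlonglongrightarrow> q z"
proof -
  have "(\<lambda>n. q (u n) - q z) \<longlonglongrightarrow> 0"
    by (rule Lim_null_comparison[OF _ converges_toD[OF assms]])
       (use triangle3[OF assms(2)] in auto)
  then show ?thesis by (simp add: LIM_zero_iff)
qed

lemma converges_to_unique:
  assumes "converges_to u z" "converges_to u w"
  shows "z = w"
proof -
  have "q (z - w) = 0" if q: "q \<in> Q" for q
  proof (rule antisym[OF _ nonneg[OF q]])
    have "(\<lambda>n. q (u n - z) + q (u n - w)) \<longlonglongrightarrow> 0 + 0"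
      by (intro tendsto_add converges_toD assms q)
    moreover have "q (z - w) \<le> q (u n - z) + q (u n - w)" for n
      using triangle[OF q, of z w "u n"] minus_commute[OF q, of z "u n"] by simp
    ultimately show "q (z - w) \<le> 0"
      by (intro LIMSEQ_le_const) auto
  qed
  then have "z - w = 0" by (rule separated)
  then show ?thesis by simp
qed

lemma converges_toI_bound:
  assumes "\<And>q. q \<in> Q \<Longrightarrow> \<exists>f. (\<forall>n. q (u n - z) \<le> f n) \<and> f \<longlonglongrightarrow> 0"
  shows "converges_to u z"
  unfolding converges_to_def
proof
  fix q assume q: "q \<in> Q"
  then obtain f where f: "\<forall>n. q (u n - z) \<le> f n" "f \<longlonglongrightarrow> 0"
    using assms by blast
  show "(\<lambda>n. q (u n - z)) \<longlonglongrightarrow> 0"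
    by (rule tendsto_sandwich[OF _ _ tendsto_const f(2)]) (use f(1) nonneg[OF q] in auto)
qed

lemma converges_to_add:
  assumes "converges_to u z" "converges_to v w"
  shows "converges_to (\<lambda>n. u n + v n) (z + w)"
proof (rule converges_toI_bound)
  fix q assume q: "q \<in> Q"
  have "q (u n + v n - (z + w)) \<le> q (u n - z) + q (v n - w)" for n
    using add[OF q, of "u n - z" "v n - w"] by (simp add: algebra_simps)
  moreover have "(\<lambda>n. q (u n - z) + q (v n - w)) \<longlonglongrightarrow> 0 + 0"
    by (intro tendsto_add converges_toD assms q)
  ultimately show "\<exists>f. (\<forall>n. q (u n + v n - (z + w)) \<le> f n) \<and> f \<longlonglongrightarrow> 0"
    by (intro exI[of _ "\<lambda>n. q (u n - z) + q (v n - w)"]) simp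
qed

lemma converges_to_scale:
  assumes "converges_to u z"
  shows "converges_to (\<lambda>n. s c (u n)) (s c z)"
  unfolding converges_to_def
proof
  fix q assume q: "q \<in> Q"
  have "q (s c (u n) - s c z) = norm c * q (u n - z)" for n
    using scale[OF q] by (simp flip: scale_right_diff_distrib)
  then show "(\<lambda>n. q (s c (u n) - s c z)) \<longlonglongrightarrow> 0"
    using tendsto_mult_right_zero[OF converges_toD[OF assms q], of "norm c"] by simp
qed

lemma converges_to_minus: "converges_to u z \<Longrightarrow> converges_to (\<lambda>n. - u n) (- z)"
  using converges_to_scale[of u z "-1"] by simp

lemma converges_to_diff:
  "converges_to u z \<Longrightarrow> converges_to v w \<Longrightarrow> converges_to (\<lambda>n. u n - v n) (z - w)"
  using converges_to_add[OF _ converges_to_minus, of u z v w] by simp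

lemma converges_to_const: "converges_to (\<lambda>n. z) z"
  by (auto simp: converges_to_def zero)

lemma converges_to_image:
  assumes "converges_to u z"
    and "\<And>x y. K (x - y) = K x - K y"
    and "\<And>q. q \<in> Q \<Longrightarrow> \<exists>q'\<in>Q. \<exists>C. \<forall>x. q (K x) \<le> C * q' x"
  shows "converges_to (\<lambda>n. K (u n)) (K z)"
proof (rule converges_toI_bound)
  fix q assume "q \<in> Q"
  then obtain q' C where q': "q' \<in> Q" "\<forall>x. q (K x) \<le> C * q' x"
    using assms(3) by blast
  have "(\<lambda>n. C * q' (u n - z)) \<longlonglongrightarrow> 0"
    by (rule tendsto_mult_right_zero[OF converges_toD[OF assms(1) q'(1)]])
  moreover have "q (K (u n) - K z) \<le> C * q' (u n - z)" for n
    using q'(2) assms(2) by metis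
  ultimately show "\<exists>f. (\<forall>n. q (K (u n) - K z) \<le> f n) \<and> f \<longlonglongrightarrow> 0"
    by (intro exI[of _ "\<lambda>n. C * q' (u n - z)"]) simp
qed

lemma geometric_increments_Cauchy:
  assumes q: "q \<in> Q" and inc: "\<And>n. q (u (Suc n) - u n) \<le> C * r ^ n" and r: "0 \<le> r" "r < 1"
    and e: "0 < e"
  shows "\<exists>N. \<forall>m\<ge>N. \<forall>n\<ge>N. q (u m - u n) < e"
proof -
  have "summable (\<lambda>n. C * r ^ n)"
    using r by (intro summable_mult summable_geometric) auto
  then obtain N where N: "\<And>m n. m \<ge> N \<Longrightarrow> norm (\<Sum>k=m..<n. C * r ^ k) < e"
    using e unfolding summable_Cauchy by blast
  have increments: "q (u n - u m) \<le> (\<Sum>k=m..<n. C * r ^ k)" if "m \<le> n" for m n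
    using that
  proof (induction n rule: dec_induct)
    case base then show ?case by (simp add: zero[OF q])
  next
    case (step n)
    have "q (u (Suc n) - u m) \<le> q (u (Suc n) - u n) + q (u n - u m)"
      by (rule triangle[OF q])
    also have "\<dots> \<le> C * r ^ n + (\<Sum>k=m..<n. C * r ^ k)"
      using step inc by (intro add_mono) auto
    finally show ?case using step by simp
  qed
  have "q (u n - u m) < e" if "N \<le> m" "m \<le> n" for m n
    using increments[OF that(2)] N[OF that(1), of n] by (simp add: abs_less_iff)
  then have "q (u m - u n) < e" if "N \<le> m" "N \<le> n" for m n
    using that minus_commute[OF q, of "u m" "u n"] by (metis nat_le_linear)
  then show ?thesis by (intro exI[of _ N]) simp
qed

text \<open>The partial sums \<open>u\<close> of the Neumann series satisfy
  \<open>u (n + 1) = b + s c (K (u n))\<close>; \<open>bound\<close> makes them Cauchy and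
  \<open>cont\<close> lets \<open>K\<close> pass to the limit. The rate \<open>r\<close> is common
  to all seminorms, while the constant \<open>C\<close> may vary with the seminorm.\<close>

lemma neumann_solution:
  assumes K: "Vector_Spaces.linear s s K"
    and cont: "\<And>q. q \<in> Q \<Longrightarrow> \<exists>q'\<in>Q. \<exists>C. \<forall>x. q (K x) \<le> C * q' x"
    and bound: "\<And>q. q \<in> Q \<Longrightarrow> \<exists>C. \<forall>k. q ((K ^^ k) b) \<le> C * r ^ k"
    and r: "0 \<le> r" "norm c * r < 1"
  shows "\<exists>w. w = b + s c (K w)"
proof -
  interpret K: Vector_Spaces.linear s s K by (rule K)
  define u where "u n = (\<Sum>k<n. s (c ^ k) ((K ^^ k) b))" for n
  have u_Suc: "u (Suc n) = b + s c (K (u n))" for n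
    unfolding u_def K.sum scale_sum_right
    by (subst sum.lessThan_Suc_shift) (simp add: K.scale)
  have "\<exists>z. \<forall>q\<in>Q. (\<lambda>n. q (u n - z)) \<longlonglongrightarrow> 0"
  proof (rule complete)
    fix q and e :: real assume q: "q \<in> Q" and e: "0 < e"
    then obtain C where C: "\<forall>k. q ((K ^^ k) b) \<le> C * r ^ k"
      using bound by blast
    have "q (u (Suc n) - u n) \<le> C * (norm c * r) ^ n" for n
    proof -
      have "q (u (Suc n) - u n) = norm c ^ n * q ((K ^^ n) b)"
        by (simp add: u_def scale[OF q] norm_power)
      also have "\<dots> \<le> norm c ^ n * (C * r ^ n)"
        using C by (intro mult_left_mono) auto
      finally show ?thesis by (simp add: power_mult_distrib mult_ac)
    qed
    then show "\<exists>N. \<forall>m\<ge>N. \<forall>n\<ge>N. q (u m - u n) < e"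
      using q r e by (intro geometric_increments_Cauchy[of q u C "norm c * r"]) auto
  qed
  then obtain w where w: "converges_to u w" by (auto simp: converges_to_def)
  have "converges_to (\<lambda>n. u (Suc n)) w"
    unfolding converges_to_def by (intro ballI LIMSEQ_Suc[OF converges_toD[OF w]])
  moreover have "converges_to (\<lambda>n. u (Suc n)) (b + s c (K w))"
    unfolding u_Suc
    by (rule converges_to_add[OF converges_to_const converges_to_scale[OF converges_to_image[OF w]]])
       (use K.diff cont in auto)
  ultimately have "w = b + s c (K w)" by (rule converges_to_unique)
  then show ?thesis ..
qed

end

section \<open>Consistent topologies\<close>

lemmas
  linear_map_add = module_hom.add[OF module_hom_linearI] and
  linear_map_diff = module_hom.diff[OF module_hom_linearI] and
  linear_map_minus = module_hom.neg[OF module_hom_linearI] and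
  linear_map_zero = module_hom.zero[OF module_hom_linearI] and
  linear_map_scale = module_hom.scale[OF module_hom_linearI] and
  linear_map_sum = module_hom.sum[OF module_hom_linearI]

text \<open>All continuous seminorms are taken, not a generating family: the set is closed under
  sums, nonnegative multiples and domination, so one member replaces a finite subfamily together
  with its constants.\<close>

definition continuous_seminorms ::
  "('k::real_normed_field \<Rightarrow> 'x::ab_group_add \<Rightarrow> 'x) \<Rightarrow> 'x topology \<Rightarrow> ('x \<Rightarrow> real) set" where
  "continuous_seminorms s \<tau> = {q. is_seminorm s q \<and> continuous_map \<tau> euclidean q}"

context
  fixes s :: "'k::real_normed_field \<Rightarrow> 'x::ab_group_add \<Rightarrow> 'x" and \<tau> :: "'x topology"
  assumes vs: "vector_space s" and lc: "locally_convex_topology s \<tau>"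
begin

interpretation vector_space s by (rule vs)

abbreviation (input) "Q \<equiv> continuous_seminorms s \<tau>"

lemma is_seminormD: "q \<in> Q \<Longrightarrow> is_seminorm s q"
  by (simp add: continuous_seminorms_def)

lemma continuous_seminorms_add: "p \<in> Q \<Longrightarrow> q \<in> Q \<Longrightarrow> (\<lambda>x. p x + q x) \<in> Q"
  by (auto simp: continuous_seminorms_def is_seminorm_def distrib_left add_mono
      intro!: continuous_map_add) (smt (verit))

lemma continuous_seminorms_mult: "p \<in> Q \<Longrightarrow> 0 \<le> c \<Longrightarrow> (\<lambda>x. c * p x) \<in> Q"
  by (auto simp: continuous_seminorms_def is_seminorm_def intro!: continuous_map_real_mult)
     (metis distrib_left mult_left_mono)

lemma topspace_locally_convex: "topspace \<tau> = UNIV"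
proof -
  obtain P where P: "P \<noteq> {}" "\<And>p. p \<in> P \<Longrightarrow> is_seminorm s p"
    "\<tau> = topology_generated_by {{x. p (x - a) < r} | p a r. p \<in> P \<and> 0 < r}"
    using lc by (auto simp: locally_convex_topology_def)
  obtain p where p: "p \<in> P" using P(1) by blast
  have "x \<in> \<Union>{{x. p (x - a) < r} | p a r. p \<in> P \<and> 0 < r}" for x
  proof
    show "{y. p (y - x) < 1} \<in> {{x. p (x - a) < r} | p a r. p \<in> P \<and> 0 < r}"
      by (intro CollectI exI[of _ p] exI[of _ x] exI[of _ "1::real"]) (simp add: p)
    show "x \<in> {y. p (y - x) < 1}"
      using seminorm_zero[OF vs P(2)[OF p]] by simp
  qed
  then show ?thesis by (auto simp: P(3))
qed

text \<open>The generating balls have arbitrary centres, so the subbase is invariant under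
  translation. This turns continuity of a seminorm into openness of its balls around every
  point.\<close>

lemma continuous_map_translation: "continuous_map \<tau> \<tau> (\<lambda>y. y - b)"
proof -
  obtain P where P: "P \<noteq> {}" "\<And>p. p \<in> P \<Longrightarrow> is_seminorm s p"
    "\<tau> = topology_generated_by {{x. p (x - a) < r} | p a r. p \<in> P \<and> 0 < r}"
    using lc by (auto simp: locally_convex_topology_def)
  have "continuous_map \<tau> (topology_generated_by {{x. p (x - a) < r} | p a r. p \<in> P \<and> 0 < r}) (\<lambda>y. y - b)"
  proof (rule continuous_on_generated_topo)
    fix U assume "U \<in> {{x. p (x - a) < r} | p a r. p \<in> P \<and> 0 < r}"
    then obtain p a r where U: "U = {x. p (x - a) < r}" "p \<in> P" "0 < r" by blast
    have "(\<lambda>y. y - b) -` U \<inter> topspace \<tau> = {x. p (x - (a + b)) < r}"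
      using U(1) by (auto simp: topspace_locally_convex algebra_simps)
    moreover have "openin \<tau> {x. p (x - (a + b)) < r}"
      unfolding P(3) by (rule topology_generated_by_Basis) (use U in blast)
    ultimately show "openin \<tau> ((\<lambda>y. y - b) -` U \<inter> topspace \<tau>)" by simp
  next
    show "(\<lambda>y. y - b) ` topspace \<tau> \<subseteq> \<Union>{{x. p (x - a) < r} | p a r. p \<in> P \<and> 0 < r}"
      using topspace_locally_convex by (simp add: P(3))
  qed
  then show ?thesis by (simp flip: P(3))
qed

lemma openin_seminorm_ball:
  assumes q: "q \<in> Q"
  shows "openin \<tau> {y. q (y - x) < r}"
proof -
  have "continuous_map \<tau> euclidean q"
    using q by (simp add: continuous_seminorms_def)
  then have "continuous_map \<tau> euclidean (q \<circ> (\<lambda>y. y - x))"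
    by (rule continuous_map_compose[OF continuous_map_translation])
  then have "openin \<tau> {y \<in> topspace \<tau>. (q \<circ> (\<lambda>y. y - x)) y \<in> {..<r}}"
    by (rule openin_continuous_map_preimage) auto
  then show ?thesis by (simp add: topspace_locally_convex)
qed

text \<open>Radius 1 is enough because \<open>Q\<close> absorbs scaling, and a single seminorm is
  enough because \<open>Q\<close> is closed under sums.\<close>

lemma openin_locally_convex_iff:
  "openin \<tau> U \<longleftrightarrow> (\<forall>x\<in>U. \<exists>q\<in>Q. {y. q (y - x) < 1} \<subseteq> U)"
proof
  assume U: "openin \<tau> U"
  obtain P where P: "P \<noteq> {}" "\<And>p. p \<in> P \<Longrightarrow> is_seminorm s p"
    "\<tau> = topology_generated_by {{x. p (x - a) < r} | p a r. p \<in> P \<and> 0 < r}"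
    using lc by (auto simp: locally_convex_topology_def)
  \<comment> \<open>The generating seminorms belong to \<open>Q\<close>: by the reverse triangle
    inequality, the preimage of an open set contains a generating ball around each of its
    points.\<close>
  have PQ: "p \<in> Q" if p: "p \<in> P" for p
    unfolding continuous_seminorms_def
  proof (intro CollectI conjI P(2)[OF p])
    show "continuous_map \<tau> euclidean p"
      unfolding continuous_map topspace_locally_convex
    proof (intro conjI allI impI)
      fix V :: "real set" assume V: "openin euclidean V"
      show "openin \<tau> {x \<in> UNIV. p x \<in> V}"
      proof (subst openin_subopen, intro ballI)
        fix x assume "x \<in> {x \<in> UNIV. p x \<in> V}"
        then obtain e where e: "0 < e" "ball (p x) e \<subseteq> V"
          using V by (metis CollectD open_contains_ball open_openin)
        have "openin \<tau> {y. p (y - x) < e}"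
          unfolding P(3) by (rule topology_generated_by_Basis) (use p e in blast)
        moreover have "x \<in> {y. p (y - x) < e}"
          using e seminorm_zero[OF vs P(2)[OF p]] by simp
        moreover have "{y. p (y - x) < e} \<subseteq> {x \<in> UNIV. p x \<in> V}"
        proof
          fix y assume "y \<in> {y. p (y - x) < e}"
          then have "dist (p x) (p y) < e"
            using seminorm_triangle3[OF vs P(2)[OF p], of y x] by (simp add: dist_real_def)
          then show "y \<in> {x \<in> UNIV. p x \<in> V}" using e by auto
        qed
        ultimately show "\<exists>T. openin \<tau> T \<and> x \<in> T \<and> T \<subseteq> {x \<in> UNIV. p x \<in> V}" by blast
      qed
    qed auto
  qed
  from U have "generate_topology_on {{x. p (x - a) < r} | p a r. p \<in> P \<and> 0 < r} U"
    unfolding P(3) by (rule openin_topology_generated_by)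
  then show "\<forall>x\<in>U. \<exists>q\<in>Q. {y. q (y - x) < 1} \<subseteq> U"
  proof induction
    case (Int a b)
    show ?case
    proof
      fix x assume "x \<in> a \<inter> b"
      then obtain p q where *: "p \<in> Q" "q \<in> Q" "{y. p (y - x) < 1} \<subseteq> a" "{y. q (y - x) < 1} \<subseteq> b"
        using Int by blast
      have "{y. p (y - x) + q (y - x) < 1} \<subseteq> a \<inter> b"
      proof
        fix y assume y: "y \<in> {y. p (y - x) + q (y - x) < 1}"
        have "p (y - x) \<ge> 0" "q (y - x) \<ge> 0"
          using * seminorm_nonneg[OF vs is_seminormD] by blast+
        then show "y \<in> a \<inter> b" using * y by auto
      qed
      then show "\<exists>q\<in>Q. {y. q (y - x) < 1} \<subseteq> a \<inter> b"
        using continuous_seminorms_add[OF *(1,2)] by (intro bexI) auto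
    qed
  next
    case (Basis U)
    then obtain p a r where U: "U = {x. p (x - a) < r}" "p \<in> P" "0 < r" by blast
    show ?case
    proof
      fix x assume x: "x \<in> U"
      \<comment> \<open>The margin left between \<open>x\<close> and the boundary of the ball;
        dividing \<open>p\<close> by it makes the unit ball fit inside.\<close>
      define d where "d = r - p (x - a)"
      have d: "0 < d" using x U by (simp add: d_def)
      have "{y. 1 / d * p (y - x) < 1} \<subseteq> U"
      proof
        fix y assume "y \<in> {y. 1 / d * p (y - x) < 1}"
        then have "p (y - x) < d" using d by (simp add: field_simps)
        then show "y \<in> U"
          using seminorm_triangle[OF vs P(2)[OF U(2)], of y a x] by (simp add: U(1) d_def)
      qed
      moreover have "(\<lambda>y. 1 / d * p y) \<in> Q"
        using d PQ[OF U(2)] by (intro continuous_seminorms_mult) auto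
      ultimately show "\<exists>q\<in>Q. {y. q (y - x) < 1} \<subseteq> U"
        by (intro bexI[of _ "\<lambda>y. 1 / d * p y"])
    qed
  qed blast+
next
  assume U: "\<forall>x\<in>U. \<exists>q\<in>Q. {y. q (y - x) < 1} \<subseteq> U"
  show "openin \<tau> U"
  proof (subst openin_subopen, intro ballI)
    fix x assume "x \<in> U"
    then obtain q where q: "q \<in> Q" "{y. q (y - x) < 1} \<subseteq> U" using U by blast
    then show "\<exists>T. openin \<tau> T \<and> x \<in> T \<and> T \<subseteq> U"
      using openin_seminorm_ball[OF q(1), of x 1] seminorm_zero[OF vs is_seminormD[OF q(1)]]
      by (intro exI[of _ "{y. q (y - x) < 1}"]) auto
  qed
qed

lemma continuous_map_seminormI:
  fixes f :: "'x \<Rightarrow> 'b::metric_space"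
  assumes q: "q \<in> Q" and le: "\<And>x y. dist (f x) (f y) \<le> q (x - y)"
  shows "continuous_map \<tau> euclidean f"
  unfolding continuous_map topspace_locally_convex
proof (intro conjI allI impI)
  fix V :: "'b set" assume V: "openin euclidean V"
  show "openin \<tau> {x \<in> UNIV. f x \<in> V}"
    unfolding openin_locally_convex_iff
  proof
    fix x assume "x \<in> {x \<in> UNIV. f x \<in> V}"
    then obtain e where e: "0 < e" "ball (f x) e \<subseteq> V"
      using V by (metis CollectD open_contains_ball open_openin)
    have "{y. 1 / e * q (y - x) < 1} \<subseteq> {x \<in> UNIV. f x \<in> V}"
    proof
      fix y assume "y \<in> {y. 1 / e * q (y - x) < 1}"
      then have "dist (f x) (f y) < e"
        using le[of y x] e by (simp add: dist_commute field_simps)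
      then show "y \<in> {x \<in> UNIV. f x \<in> V}" using e by auto
    qed
    moreover have "(\<lambda>y. 1 / e * q y) \<in> Q"
      using e q by (intro continuous_seminorms_mult) auto
    ultimately show "\<exists>q\<in>Q. {y. q (y - x) < 1} \<subseteq> {x \<in> UNIV. f x \<in> V}"
      by (intro bexI[of _ "\<lambda>y. 1 / e * q y"])
  qed
qed auto

text \<open>A seminorm below \<open>q\<close> is Lipschitz for \<open>q\<close>. This is how a
  supremum over a whole orbit is seen to be \<open>\<tau>\<close>-continuous.\<close>

lemma continuous_seminorms_dominated:
  assumes "is_seminorm s p" "q \<in> Q" "\<And>x. p x \<le> q x"
  shows "p \<in> Q"
  unfolding continuous_seminorms_def
proof (intro CollectI conjI assms(1) continuous_map_seminormI[OF assms(2)])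
  show "dist (p x) (p y) \<le> q (x - y)" for x y
    using seminorm_triangle3[OF vs assms(1), of x y] assms(3)[of "x - y"] by (simp add: dist_real_def)
qed

lemma continuous_operatorsI:
  assumes S: "Vector_Spaces.linear s s S"
    and le: "\<And>p. p \<in> Q \<Longrightarrow> \<exists>q\<in>Q. \<forall>x. p (S x) \<le> q x"
  shows "S \<in> continuous_operators s \<tau>"
  unfolding continuous_operators_def continuous_map topspace_locally_convex
proof (intro CollectI conjI allI impI S)
  interpret S: Vector_Spaces.linear s s S by (rule S)
  fix U assume U: "openin \<tau> U"
  show "openin \<tau> {x \<in> UNIV. S x \<in> U}"
    unfolding openin_locally_convex_iff
  proof
    fix x assume "x \<in> {x \<in> UNIV. S x \<in> U}"
    then obtain p where p: "p \<in> Q" "{y. p (y - S x) < 1} \<subseteq> U"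
      using U unfolding openin_locally_convex_iff by blast
    obtain q where q: "q \<in> Q" "\<forall>x. p (S x) \<le> q x" using le[OF p(1)] by blast
    have "{y. q (y - x) < 1} \<subseteq> {x \<in> UNIV. S x \<in> U}"
    proof
      fix y assume "y \<in> {y. q (y - x) < 1}"
      then have "p (S y - S x) < 1"
        using q(2)[rule_format, of "y - x"] by (simp add: S.diff)
      then show "y \<in> {x \<in> UNIV. S x \<in> U}" using p by auto
    qed
    then show "\<exists>q\<in>Q. {y. q (y - x) < 1} \<subseteq> {x \<in> UNIV. S x \<in> U}" using q(1) by blast
  qed
qed auto

lemma limitin_locally_convex_iff:
  "limitin \<tau> f l F \<longleftrightarrow> (\<forall>q\<in>Q. ((\<lambda>t. q (f t - l)) \<longlongrightarrow> 0) F)"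
proof
  assume l: "limitin \<tau> f l F"
  show "\<forall>q\<in>Q. ((\<lambda>t. q (f t - l)) \<longlongrightarrow> 0) F"
  proof
    fix q assume q: "q \<in> Q"
    show "((\<lambda>t. q (f t - l)) \<longlongrightarrow> 0) F"
    proof (rule tendstoI)
      fix e :: real assume "0 < e"
      then have "\<forall>\<^sub>F t in F. f t \<in> {y. q (y - l) < e}"
        using l openin_seminorm_ball[OF q, of l e] seminorm_zero[OF vs is_seminormD[OF q]]
        by (auto simp: limitin_def)
      then show "\<forall>\<^sub>F t in F. dist (q (f t - l)) 0 < e"
        using seminorm_nonneg[OF vs is_seminormD[OF q]] by simp
    qed
  qed
next
  assume r: "\<forall>q\<in>Q. ((\<lambda>t. q (f t - l)) \<longlongrightarrow> 0) F"
  show "limitin \<tau> f l F"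
    unfolding limitin_def topspace_locally_convex
  proof (intro conjI allI impI)
    fix U assume "openin \<tau> U \<and> l \<in> U"
    then obtain q where q: "q \<in> Q" "{y. q (y - l) < 1} \<subseteq> U"
      unfolding openin_locally_convex_iff by blast
    then have "\<forall>\<^sub>F t in F. q (f t - l) < 1"
      using r by (intro order_tendstoD(2)) auto
    then show "\<forall>\<^sub>F t in F. f t \<in> U"
      by eventually_elim (use q in auto)
  qed auto
qed

lemma continuous_semigroup_iff:
  "continuous_semigroup \<tau> T \<longleftrightarrow>
    (\<forall>x. \<forall>t\<ge>0. \<forall>q\<in>Q. ((\<lambda>r. q (T r x - T t x)) \<longlongrightarrow> 0) (at t within {0..}))"
proof -
  have "atin (top_of_set {0..}) t = at t within {0..}" if "0 \<le> t" for t :: real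
    using that by (simp add: atin_subtopology_within filter_eq_iff eventually_atin_within
        eventually_at_topological) meson
  then show ?thesis
    unfolding continuous_semigroup_def continuous_map_atin limitin_locally_convex_iff
    by (auto simp: ball_def)
qed

lemma sequentially_complete_seminorms:
  assumes sc: "sequentially_complete \<tau>"
    and u: "\<And>q e. q \<in> Q \<Longrightarrow> 0 < e \<Longrightarrow> \<exists>N. \<forall>m\<ge>N. \<forall>n\<ge>N. q (u m - u n) < e"
  shows "\<exists>z. \<forall>q\<in>Q. (\<lambda>n. q (u n - z)) \<longlonglongrightarrow> 0"
proof -
  have "\<exists>N. \<forall>m\<ge>N. \<forall>n\<ge>N. u m - u n \<in> U" if U: "openin \<tau> U \<and> 0 \<in> U" for U
  proof -
    obtain q where q: "q \<in> Q" "{y. q (y - 0) < 1} \<subseteq> U"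
      using U unfolding openin_locally_convex_iff by blast
    obtain N where "\<forall>m\<ge>N. \<forall>n\<ge>N. q (u m - u n) < 1"
      using u[OF q(1), of 1] by auto
    then show ?thesis using q(2) by (intro exI[of _ N]) auto
  qed
  then have "\<exists>l. limitin \<tau> u l sequentially"
    using sc unfolding sequentially_complete_def by blast
  then show ?thesis by (simp add: limitin_locally_convex_iff)
qed

end

section \<open>Norming dual pairs with a consistent, sequentially complete topology\<close>

locale consistent_pair = norming_dual_pair sX sY B
  for sX :: "'k::{real_normed_field,euclidean_space} \<Rightarrow> 'x::banach \<Rightarrow> 'x"
    and sY :: "'k \<Rightarrow> 'y::banach \<Rightarrow> 'y"
    and B :: "'x \<Rightarrow> 'y \<Rightarrow> 'k" +
  fixes \<tau> :: "'x topology"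
  assumes consistent: "consistent_topology sX B \<tau>"
    and seq_complete: "sequentially_complete \<tau>"
begin

abbreviation Q where "Q \<equiv> continuous_seminorms sX \<tau>"

lemma lc: "locally_convex_topology sX \<tau>"
  using consistent by (simp add: consistent_topology_def)

lemma vsX: "vector_space sX" and vsY: "vector_space sY"
  by unfold_locales

lemma sX_real: "sX (of_real r) x = r *\<^sub>R x" and norm_sX: "norm (sX c x) = norm c * norm x"
  and sY_real: "sY (of_real r) y = r *\<^sub>R y" and norm_sY: "norm (sY c y) = norm c * norm y"
  by (rule X.scale_of_real X.norm_scale Y.scale_of_real Y.norm_scale)+

lemma B_simps:
  "B (x + x') y = B x y + B x' y" "B (x - x') y = B x y - B x' y" "B (- x) y = - B x y" "B 0 y = 0"
  "B (sX c x) y = c * B x y" "B (r *\<^sub>R x) y = r *\<^sub>R B x y"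
  "B (sum f I) y = (\<Sum>i\<in>I. B (f i) y)"
  "B x (y + y') = B x y + B x y'" "B x (y - y') = B x y - B x y'" "B x (- y) = - B x y" "B x 0 = 0"
  "B x (sY c y) = c * B x y" "B x (r *\<^sub>R y) = r *\<^sub>R B x y"
proof -
  note L = linear_left[of y] and R = linear_right[of x]
  show "B (x + x') y = B x y + B x' y" "B (x - x') y = B x y - B x' y" "B (- x) y = - B x y" "B 0 y = 0"
    "B (sX c x) y = c * B x y" "B (sum f I) y = (\<Sum>i\<in>I. B (f i) y)"
    "B x (y + y') = B x y + B x y'" "B x (y - y') = B x y - B x y'" "B x (- y) = - B x y" "B x 0 = 0"
    "B x (sY c y) = c * B x y"
    by (rule linear_map_add[OF L] linear_map_diff[OF L] linear_map_minus[OF L] linear_map_zero[OF L]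
        linear_map_scale[OF L] linear_map_sum[OF L] linear_map_add[OF R] linear_map_diff[OF R]
        linear_map_minus[OF R] linear_map_zero[OF R] linear_map_scale[OF R])+
  show "B (r *\<^sub>R x) y = r *\<^sub>R B x y" "B x (r *\<^sub>R y) = r *\<^sub>R B x y"
    using linear_map_scale[OF L, of "of_real r" x] linear_map_scale[OF R, of "of_real r" y]
    by (simp_all add: sX_real sY_real scaleR_conv_of_real)
qed

lemma B_eqI: "(\<And>y. B x y = B x' y) \<Longrightarrow> x = x'"
  using separating_left[of "x - x'"] by (simp add: B_simps)

lemma B_eqI_right: "(\<And>x. B x y = B x y') \<Longrightarrow> y = y'"
  using separating_right[of "y - y'"] by (simp add: B_simps)

text \<open>The norming property: norm bounds on X are obtained from pairings with the unit ball of
  Y, hence from weak information.\<close>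

lemma norm_leI: "(\<And>y. norm y \<le> 1 \<Longrightarrow> norm (B x y) \<le> c) \<Longrightarrow> norm x \<le> c"
  using norm_left[of x] by (metis (no_types, lifting) cSUP_least CollectD empty_iff mem_Collect_eq norm_zero zero_le_one)

lemma norm_leI_right: "(\<And>x. norm x \<le> 1 \<Longrightarrow> norm (B x y) \<le> c) \<Longrightarrow> norm y \<le> c"
  using norm_right[of y] by (metis (no_types, lifting) cSUP_least CollectD empty_iff mem_Collect_eq norm_zero zero_le_one)

lemma norm_B_le: "norm (B x y) \<le> norm x * norm y"
proof (cases "y = 0")
  case False
  define y' where "y' = (1 / norm y) *\<^sub>R y"
  have "norm (B x y') \<le> norm x"
    by (subst norm_left) (rule cSUP_upper[OF _ bdd_left], use False in \<open>simp add: y'_def\<close>)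
  then show ?thesis using False by (simp add: y'_def B_simps field_simps)
qed (simp add: B_simps)

lemma norm_B_seminorm: "(\<lambda>x. norm (B x y)) \<in> Q"
proof -
  have "continuous_map \<tau> euclidean (\<lambda>x. B x y)"
    using consistent unfolding consistent_topology_def by blast
  then have "continuous_map \<tau> euclidean (norm \<circ> (\<lambda>x. B x y))"
    by (rule continuous_map_compose) (simp add: continuous_on_norm_id)
  then show ?thesis
    by (auto simp: continuous_seminorms_def is_seminorm_def B_simps norm_triangle_ineq norm_mult o_def)
qed

sublocale tau: seminorm_family sX Q
proof (unfold_locales)
  show "is_seminorm sX q" if "q \<in> Q" for q
    using that by (simp add: continuous_seminorms_def)
  show "x = 0" if "\<And>q. q \<in> Q \<Longrightarrow> q x = 0" for x
    using that[OF norm_B_seminorm] separating_left by simp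
  show "\<exists>z. \<forall>q\<in>Q. (\<lambda>n. q (u n - z)) \<longlonglongrightarrow> 0"
    if "\<And>q e. q \<in> Q \<Longrightarrow> 0 < e \<Longrightarrow> \<exists>N. \<forall>m\<ge>N. \<forall>n\<ge>N. q (u m - u n) < e" for u
    using that by (rule sequentially_complete_seminorms[OF vsX lc seq_complete])
qed

sublocale normX: seminorm_family sX "{norm}"
proof (unfold_locales)
  show "is_seminorm sX q" if "q \<in> {norm}" for q
    using that by (auto simp: is_seminorm_def norm_sX norm_triangle_ineq)
  show "\<exists>z. \<forall>q\<in>{norm}. (\<lambda>n. q (u n - z)) \<longlonglongrightarrow> 0"
    if "\<And>q e. q \<in> {norm} \<Longrightarrow> 0 < e \<Longrightarrow> \<exists>N. \<forall>m\<ge>N. \<forall>n\<ge>N. q (u m - u n) < e" for u :: "nat \<Rightarrow> 'x"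
  proof -
    have "Cauchy u" by (rule CauchyI) (use that in auto)
    then obtain z where "u \<longlonglongrightarrow> z" using Cauchy_convergent convergent_def by blast
    then show ?thesis by (auto simp: LIM_zero_iff tendsto_norm_zero_iff)
  qed
qed auto

sublocale normY: seminorm_family sY "{norm}"
proof (unfold_locales)
  show "is_seminorm sY q" if "q \<in> {norm}" for q
    using that by (auto simp: is_seminorm_def norm_sY norm_triangle_ineq)
  show "\<exists>z. \<forall>q\<in>{norm}. (\<lambda>n. q (u n - z)) \<longlonglongrightarrow> 0"
    if "\<And>q e. q \<in> {norm} \<Longrightarrow> 0 < e \<Longrightarrow> \<exists>N. \<forall>m\<ge>N. \<forall>n\<ge>N. q (u m - u n) < e" for u :: "nat \<Rightarrow> 'y"
  proof -
    have "Cauchy u" by (rule CauchyI) (use that in auto)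
    then obtain z where "u \<longlonglongrightarrow> z" using Cauchy_convergent convergent_def by blast
    then show ?thesis by (auto simp: LIM_zero_iff tendsto_norm_zero_iff)
  qed
qed auto

lemma tau_scaleR: "q \<in> Q \<Longrightarrow> q (r *\<^sub>R x) = \<bar>r\<bar> * q x"
  using tau.scale[of q "of_real r" x] by (simp add: sX_real)

text \<open>Domination makes the functional \<open>\<tau>\<close>-continuous, and consistency says
  that such functionals come from Y.\<close>

lemma functional_represented:
  assumes f: "Vector_Spaces.linear sX (*) f" and q: "q \<in> Q" "\<And>x. norm (f x) \<le> q x"
  shows "\<exists>y. \<forall>x. f x = B x y"
proof -
  have "continuous_map \<tau> euclidean f"
    by (rule continuous_map_seminormI[OF vsX lc q(1)])
       (use q(2) in \<open>simp add: dist_norm flip: linear_map_diff[OF f]\<close>)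
  then have "f \<in> range (\<lambda>y x. B x y)"
    using f consistent unfolding consistent_topology_def by blast
  then show ?thesis by auto
qed

text \<open>\<open>norm (B x y)\<close> is itself one of the seminorms, so the functional
  \<open>B (S x) y\<close> of \<open>x\<close> is dominated and hence represented.\<close>

lemma adjoint_exists:
  assumes S: "Vector_Spaces.linear sX sX S" and le: "\<And>p. p \<in> Q \<Longrightarrow> \<exists>q\<in>Q. \<forall>x. p (S x) \<le> q x"
  shows "\<exists>y'. \<forall>x. B (S x) y = B x y'"
proof -
  obtain q where q: "q \<in> Q" "\<forall>x. norm (B (S x) y) \<le> q x"
    using le[OF norm_B_seminorm] by blast
  have "Vector_Spaces.linear sX (*) ((\<lambda>x. B x y) \<circ> S)"
    by (rule Vector_Spaces.linear_compose[OF S linear_left])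
  then show ?thesis using functional_represented[OF _ q(1)] q(2) by (simp add: o_def)
qed

text \<open>The preimage under \<open>S\<close> of a subbasic set given by y is the subbasic set
  given by the adjoint vector y'.\<close>

lemma weak_continuous_operatorsI:
  assumes S: "Vector_Spaces.linear sX sX S" and adj: "\<And>y. \<exists>y'. \<forall>x. B (S x) y = B x y'"
  shows "S \<in> continuous_operators sX (weak_topology B)"
proof -
  have top: "topspace (weak_topology B) = UNIV"
    unfolding weak_topology_def by (auto intro!: exI[of _ UNIV])
  have "continuous_map (weak_topology B) (topology_generated_by {{x. B x y \<in> U} | y U. open U}) S"
  proof (rule continuous_on_generated_topo)
    fix V assume "V \<in> {{x. B x y \<in> U} | y U. open U}"
    then obtain y U where V: "V = {x. B x y \<in> U}" "open U" by blast
    obtain y' where y': "\<forall>x. B (S x) y = B x y'" using adj by blast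
    have "openin (weak_topology B) {x. B x y' \<in> U}"
      unfolding weak_topology_def by (rule topology_generated_by_Basis) (use V in blast)
    moreover have "S -` V \<inter> topspace (weak_topology B) = {x. B x y' \<in> U}"
      using y' by (auto simp: V top)
    ultimately show "openin (weak_topology B) (S -` V \<inter> topspace (weak_topology B))" by simp
  next
    show "S ` topspace (weak_topology B) \<subseteq> \<Union>{{x. B x y \<in> U} | y U. open U}"
      using top unfolding weak_topology_def by simp
  qed
  then show ?thesis using S by (simp add: continuous_operators_def weak_topology_def)
qed

lemma tau_converges_to_B:
  assumes "tau.converges_to u z"
  shows "(\<lambda>n. B (u n) y) \<longlonglongrightarrow> B z y"
proof -
  have "(\<lambda>n. norm (B (u n - z) y)) \<longlonglongrightarrow> 0"
    by (rule tau.converges_toD[OF assms norm_B_seminorm])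
  then show ?thesis by (simp add: B_simps tendsto_norm_zero_iff LIM_zero_iff)
qed

end

section \<open>Boundedness and integrals\<close>

text \<open>By Baire's theorem one of the closed sets \<open>E n\<close> contains a ball around some
  \<open>a\<close>. A vector \<open>v\<close> of length \<open>r\<close> then satisfies
  \<open>f i v = f i (a + v) - f i a\<close>, a difference of two values of norm at most
  \<open>n\<close>.\<close>

lemma uniform_boundedness:
  fixes f :: "'i \<Rightarrow> 'a::banach \<Rightarrow> 'b::real_normed_vector"
  assumes lin: "\<And>i. i \<in> I \<Longrightarrow> bounded_linear (f i)"
    and bdd: "\<And>x. \<exists>C. \<forall>i\<in>I. norm (f i x) \<le> C"
  shows "\<exists>C. \<forall>i\<in>I. \<forall>x. norm (f i x) \<le> C * norm x"
proof -
  define E where "E n = {x. \<forall>i\<in>I. norm (f i x) \<le> real n}" for n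
  have E_closed: "closed (E n)" for n
  proof -
    have "closed {x. norm (f i x) \<le> real n}" if "i \<in> I" for i
      by (intro closed_Collect_le continuous_intros bounded_linear.continuous_on[OF lin[OF that]])
    moreover have "E n = (\<Inter>i\<in>I. {x. norm (f i x) \<le> real n})" by (auto simp: E_def)
    ultimately show ?thesis by auto
  qed
  have E_cover: "(\<Union>n. E n) = UNIV"
  proof -
    have "\<exists>n. x \<in> E n" for x
    proof -
      obtain C where C: "\<forall>i\<in>I. norm (f i x) \<le> C" using bdd by blast
      obtain n where "C \<le> real n" using real_arch_simple by blast
      then show ?thesis using C by (intro exI[of _ n]) (auto simp: E_def intro: order_trans)
    qed
    then show ?thesis by auto
  qed
  have "\<exists>n. interior (E n) \<noteq> {}"
  proof (rule ccontr)
    assume none: "\<nexists>n. interior (E n) \<noteq> {}"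
    have "euclidean interior_of \<Union>(range E) = {}"
      by (rule Baire_category_alt)
         (use none E_closed completely_metrizable_space_euclidean in \<open>auto\<close>)
    then show False using E_cover by simp
  qed
  then obtain n a where "a \<in> interior (E n)" by blast
  then obtain r where r: "0 < r" "cball a r \<subseteq> E n"
    by (meson interior_subset mem_interior_cball)
  have "norm (f i x) \<le> 2 * n / r * norm x" if i: "i \<in> I" for i x
  proof (cases "x = 0")
    case True
    then show ?thesis using linear_0[OF bounded_linear.linear[OF lin[OF i]]] by simp
  next
    case False
    interpret bounded_linear "f i" by (rule lin[OF i])
    define v where "v = (r / norm x) *\<^sub>R x"
    have "a + v \<in> E n" "a \<in> E n" using r False by (auto simp: v_def subset_eq dist_norm)
    then have "norm (f i (a + v) - f i a) \<le> real n + real n"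
      using i by (intro norm_triangle_le_diff add_mono) (auto simp: E_def)
    then have "norm (f i v) \<le> 2 * n" by (simp add: add)
    then show ?thesis using False r by (simp add: v_def scaleR field_simps)
  qed
  then show ?thesis by blast
qed

text \<open>Multiplication by \<open>w\<close> scales the norm by \<open>norm w\<close>, and
  polarisation transfers this to the inner product. It stands in for complex conjugation in an
  abstract scalar field.\<close>

lemma inner_mult_left_cancel:
  fixes w a b :: "'k::{real_normed_field,euclidean_space}"
  shows "(w * a) \<bullet> (w * b) = (norm w)\<^sup>2 * (a \<bullet> b)"
proof -
  have "norm (w * a + w * b) = norm w * norm (a + b)"
    by (simp add: norm_mult flip: distrib_left)
  then show ?thesis
    unfolding dot_norm by (simp add: norm_mult power_mult_distrib right_diff_distrib)
qed

text \<open>The abstract field offers no splitting into real and imaginary parts. Instead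
  \<open>h\<close>, the squared norm of \<open>exp (t z)\<close> divided by its expected value, has
  derivative 0 and equals 1 at 0.\<close>

lemma norm_exp_re_part:
  fixes z :: "'k::{real_normed_field,euclidean_space}"
  shows "norm (exp z) = exp (re_part z)"
proof -
  define h where "h t = exp (t *\<^sub>R z) \<bullet> exp (t *\<^sub>R z) * exp (- (2 * re_part z * t))" for t
  have "(h has_real_derivative 0) (at t)" for t
  proof -
    have w: "((\<lambda>t. exp (t *\<^sub>R z)) has_vector_derivative exp (t *\<^sub>R z) * z) (at t)"
      by (rule exp_scaleR_has_vector_derivative_right)
    have "((\<lambda>t. exp (t *\<^sub>R z) \<bullet> exp (t *\<^sub>R z)) has_real_derivative
        2 * (exp (t *\<^sub>R z) \<bullet> (exp (t *\<^sub>R z) * z))) (at t)"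
      unfolding has_real_derivative_iff_has_vector_derivative
      by (rule has_vector_derivative_eq_rhs[OF bounded_bilinear.has_vector_derivative[OF bounded_bilinear_inner w w]])
         (simp add: inner_commute)
    then have "(h has_real_derivative 2 * (exp (t *\<^sub>R z) \<bullet> (exp (t *\<^sub>R z) * z)) * exp (- (2 * re_part z * t)) +
        exp (- (2 * re_part z * t)) * (- (2 * re_part z)) * (exp (t *\<^sub>R z) \<bullet> exp (t *\<^sub>R z))) (at t)"
      unfolding h_def by (auto intro!: derivative_eq_intros)
    moreover have "exp (t *\<^sub>R z) \<bullet> (exp (t *\<^sub>R z) * z) = (exp (t *\<^sub>R z) \<bullet> exp (t *\<^sub>R z)) * re_part z"
      using inner_mult_left_cancel[of "exp (t *\<^sub>R z)" 1 z] inner_mult_left_cancel[of "exp (t *\<^sub>R z)" 1 1]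
      by (simp add: re_part_def inner_commute dot_square_norm)
    ultimately show ?thesis by (simp add: algebra_simps)
  qed
  then have "h 1 = h 0" by (intro DERIV_isconst_all) auto
  then have "(norm (exp z))\<^sup>2 = (exp (re_part z))\<^sup>2"
    by (simp add: h_def dot_square_norm exp_minus field_simps flip: exp_double)
  then show ?thesis by (simp add: power2_eq_iff_nonneg)
qed

text \<open>All three follow from domination by an integrable exponential. The last form, a limit of
  integrals over \<open>{0..n}\<close>, is the one that can be split, shifted and evaluated by the
  fundamental theorem.\<close>

lemma half_line_integral:
  fixes f :: "real \<Rightarrow> 'b::euclidean_space"
  assumes cont: "continuous_on {0..} f" and e: "0 < e"
    and le: "\<And>t. 0 \<le> t \<Longrightarrow> norm (f t) \<le> C * exp (- e * t)"
  shows "set_integrable lebesgue {0..} f"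
    and "norm (LINT t:{0..}|lebesgue. f t) \<le> C / e"
    and "((\<lambda>n. integral {0..n} f) \<longlongrightarrow> (LINT t:{0..}|lebesgue. f t)) at_top"
proof -
  have g: "((\<lambda>t. C * exp (- e * t)) has_integral C / e) {0..}"
    using has_integral_mult_right[OF has_integral_exp_minus_to_infinity[OF e, of 0], of C] by simp
  have meas: "f \<in> borel_measurable (lebesgue_on {0..})"
    by (rule continuous_imp_measurable_on_sets_lebesgue[OF cont]) auto
  show int: "set_integrable lebesgue {0..} f"
    by (rule measurable_bounded_by_integrable_imp_absolutely_integrable[OF meas _ has_integral_integrable[OF g]])
       (use le in auto)
  have eq: "(LINT t:{0..}|lebesgue. f t) = integral {0..} f"
    by (rule set_lebesgue_integral_eq_integral(2)[OF int])
  have "norm (integral {0..} f) \<le> integral {0..} (\<lambda>t. C * exp (- e * t))"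
    by (rule integral_norm_bound_integral)
       (use g le set_lebesgue_integral_eq_integral(1)[OF int] in auto)
  then show "norm (LINT t:{0..}|lebesgue. f t) \<le> C / e"
    using integral_unique[OF g] by (simp add: eq)
  have "((\<lambda>n. (LINT t:{0..n}|lebesgue. f t)) \<longlongrightarrow> (LINT t:{0..}|lebesgue. f t)) at_top"
    by (rule tendsto_set_lebesgue_integral_at_top[OF _ int]) auto
  moreover have "(LINT t:{0..n}|lebesgue. f t) = integral {0..n} f" for n
    by (rule set_lebesgue_integral_eq_integral(2), rule set_integrable_subset[OF int]) auto
  ultimately show "((\<lambda>n. integral {0..n} f) \<longlongrightarrow> (LINT t:{0..}|lebesgue. f t)) at_top" by simp
qed

text \<open>Only the oscillation from the left endpoint of each cell enters; for a semigroup orbit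
  it is controlled by the behaviour near time 0.\<close>

lemma riemann_sum_error:
  fixes f :: "real \<Rightarrow> 'b::euclidean_space" and N :: nat and d e :: real
  assumes cont: "continuous_on {0..} f" and d: "0 \<le> d"
    and osc: "\<And>t j. j < N \<Longrightarrow> real j * d \<le> t \<Longrightarrow> t \<le> (real j + 1) * d \<Longrightarrow> norm (f t - f (j * d)) \<le> e"
  shows "norm (integral {0..N * d} f - d *\<^sub>R (\<Sum>j<N. f (j * d))) \<le> N * d * e"
  using osc
proof (induction N)
  case (Suc N)
  have sub: "continuous_on {a..b} f" if "0 \<le> a" for a b
    using continuous_on_subset[OF cont] that by auto
  have "0 \<le> N * d" "N * d \<le> (N + 1) * d" using d by (auto simp: distrib_right)
  then have "integral {0..(N + 1) * d} f = integral {0..N * d} f + integral {N * d..(N + 1) * d} f"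
    by (intro Henstock_Kurzweil_Integration.integral_combine[symmetric] integrable_continuous_interval sub) auto
  moreover have "norm (integral {N * d..(N + 1) * d} f - d *\<^sub>R f (N * d)) \<le> d * e"
  proof -
    have "d *\<^sub>R f (N * d) = integral {N * d..(N + 1) * d} (\<lambda>t. f (N * d))"
      using d by (simp add: algebra_simps)
    then have "integral {N * d..(N + 1) * d} f - d *\<^sub>R f (N * d) =
        integral {N * d..(N + 1) * d} (\<lambda>t. f t - f (N * d))"
      using \<open>0 \<le> N * d\<close>
      by (simp add: integral_diff integrable_continuous_interval sub)
    also have "norm \<dots> \<le> integral {N * d..(N + 1) * d} (\<lambda>t. e)"
      using \<open>0 \<le> N * d\<close> Suc.prems[of N, unfolded add.commute[of "real N" 1]]
      by (intro Henstock_Kurzweil_Integration.integral_norm_bound_integral integrable_continuous_interval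
          continuous_intros sub) auto
    finally show ?thesis using d by (simp add: algebra_simps)
  qed
  moreover have "norm (integral {0..N * d} f - d *\<^sub>R (\<Sum>j<N. f (j * d))) \<le> N * d * e"
    using Suc by simp
  ultimately show ?case
    using norm_triangle_ineq[of "integral {0..N * d} f - d *\<^sub>R (\<Sum>j<N. f (j * d))"
        "integral {N * d..(N + 1) * d} f - d *\<^sub>R f (N * d)"]
    by (simp add: algebra_simps)
qed simp

context consistent_pair
begin

text \<open>The vectors \<open>S x\<close> with \<open>norm x \<le> 1\<close>, regarded as
  functionals on Y, are bounded at each y by the norm of the adjoint vector. Uniform boundedness on
  Y and the norming property conclude.\<close>

lemma bounded_if_adjoint:
  assumes S: "Vector_Spaces.linear sX sX S" and adj: "\<And>y. \<exists>y'. \<forall>x. B (S x) y = B x y'"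
  shows "bounded_linear S"
proof -
  have "\<exists>C. \<forall>x\<in>{x. norm x \<le> 1}. \<forall>y. norm (B (S x) y) \<le> C * norm y"
  proof (rule uniform_boundedness)
    fix x
    show "bounded_linear (\<lambda>y. B (S x) y)"
      by (rule bounded_linear_intro[of _ "norm (S x)"]) (auto simp: B_simps norm_B_le mult.commute[of "norm _" "norm (S x)"])
  next
    fix y
    obtain y' where "\<forall>x. B (S x) y = B x y'" using adj by blast
    then have "norm (B (S x) y) \<le> norm y'" if "norm x \<le> 1" for x
      using norm_B_le[of x y'] that mult_right_mono[OF that norm_ge_zero[of y']] by simp
    then show "\<exists>C. \<forall>x\<in>{x. norm x \<le> 1}. norm (B (S x) y) \<le> C" by blast
  qed
  then obtain C where C: "\<And>x y. norm x \<le> 1 \<Longrightarrow> norm (B (S x) y) \<le> C * norm y" by blast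
  have SR: "S (r *\<^sub>R x) = r *\<^sub>R S x" for r x
    using linear_map_scale[OF S, of "of_real r" x] by (simp add: sX_real)
  have C0: "norm (S x) \<le> \<bar>C\<bar>" if "norm x \<le> 1" for x
  proof (rule norm_leI)
    fix y :: 'y assume "norm y \<le> 1"
    have "norm (B (S x) y) \<le> C * norm y" by (rule C[OF that])
    also have "\<dots> \<le> \<bar>C\<bar> * 1" using \<open>norm y \<le> 1\<close> by (intro mult_mono) auto
    finally show "norm (B (S x) y) \<le> \<bar>C\<bar>" by simp
  qed
  show ?thesis
  proof (rule bounded_linear_intro[of _ "\<bar>C\<bar>"])
    show "norm (S x) \<le> norm x * \<bar>C\<bar>" for x
    proof (cases "x = 0")
      case False
      then show ?thesis using C0[of "(1 / norm x) *\<^sub>R x"] by (simp add: SR field_simps)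
    qed (use linear_map_zero[OF S] in simp)
  qed (simp_all add: linear_map_add[OF S] SR)
qed

end

section \<open>Resolvents\<close>

lemma funpow_linear: "Vector_Spaces.linear s s f \<Longrightarrow> vector_space s \<Longrightarrow> Vector_Spaces.linear s s (f ^^ k)"
  by (induction k) (auto simp: Vector_Spaces.linear_iff)

locale operator_on_pair = consistent_pair sX sY B \<tau>
  for sX :: "'k::{real_normed_field,euclidean_space} \<Rightarrow> 'x::banach \<Rightarrow> 'x"
    and sY :: "'k \<Rightarrow> 'y::banach \<Rightarrow> 'y"
    and B :: "'x \<Rightarrow> 'y \<Rightarrow> 'k" and \<tau> :: "'x topology" +
  fixes D :: "'x set" and A :: "'x \<Rightarrow> 'x"
  assumes linear_operator: "linear_operator sX D A"
begin

abbreviation R :: "'k \<Rightarrow> 'x \<Rightarrow> 'x" where "R \<equiv> resolvent sX D A"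

text \<open>The algebraic half of membership in the resolvent set. Boundedness is kept apart because
  the Neumann argument in a seminorm family yields only bijectivity.\<close>

definition regular :: "'k \<Rightarrow> bool" where
  "regular l \<longleftrightarrow> bij_betw (\<lambda>x. sX l x - A x) D UNIV"

lemma D_add: "x \<in> D \<Longrightarrow> y \<in> D \<Longrightarrow> x + y \<in> D"
  and D_scale: "x \<in> D \<Longrightarrow> sX c x \<in> D"
  and A_add: "x \<in> D \<Longrightarrow> y \<in> D \<Longrightarrow> A (x + y) = A x + A y"
  and A_scale: "x \<in> D \<Longrightarrow> A (sX c x) = sX c (A x)"
  using linear_operator X.subspace_add X.subspace_scale by (auto simp: linear_operator_def)

lemma D_minus: "x \<in> D \<Longrightarrow> - x \<in> D" and A_minus: "x \<in> D \<Longrightarrow> A (- x) = - A x"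
  using D_scale[of x "-1"] A_scale[of x "-1"] by auto

lemma D_diff: "x \<in> D \<Longrightarrow> y \<in> D \<Longrightarrow> x - y \<in> D"
  and A_diff: "x \<in> D \<Longrightarrow> y \<in> D \<Longrightarrow> A (x - y) = A x - A y"
  using D_add[of x "- y"] A_add[of x "- y"] D_minus[of y] A_minus[of y] by auto

lemma D_scaleR: "x \<in> D \<Longrightarrow> r *\<^sub>R x \<in> D" and A_scaleR: "x \<in> D \<Longrightarrow> A (r *\<^sub>R x) = r *\<^sub>R A x"
  using D_scale[of x "of_real r"] A_scale[of x "of_real r"] by (auto simp: sX_real)

context
  fixes l assumes l: "regular l"
begin

lemma R_in_D: "R l x \<in> D"
  unfolding resolvent_def by (rule inv_into_into) (use l in \<open>auto simp: regular_def bij_betw_def\<close>)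

lemma R_right_inverse: "sX l (R l x) - A (R l x) = x"
  using f_inv_into_f[of x "\<lambda>x. sX l x - A x" D] l
  by (auto simp: regular_def bij_betw_def resolvent_def)

lemma A_R: "A (R l x) = sX l (R l x) - x"
  using R_right_inverse[of x] by (simp add: algebra_simps)

lemma R_left_inverse: "x \<in> D \<Longrightarrow> R l (sX l x - A x) = x"
  unfolding resolvent_def using l
  by (intro inv_into_f_f[of "\<lambda>x. sX l x - A x"]) (auto simp: regular_def bij_betw_def)

lemma R_eqI: "u \<in> D \<Longrightarrow> sX l u - A u = x \<Longrightarrow> R l x = u"
  using R_left_inverse by blast

lemma R_linear: "Vector_Spaces.linear sX sX (R l)"
  unfolding Vector_Spaces.linear_iff
proof (intro conjI allI vsX)
  show "R l (x + y) = R l x + R l y" for x y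
    by (rule R_eqI)
       (auto simp: R_in_D D_add A_add A_R X.scale_right_distrib)
  show "R l (sX c x) = sX c (R l x)" for c x
    by (rule R_eqI)
       (auto simp: R_in_D D_scale A_scale A_R X.scale_right_diff_distrib X.scale_left_commute)
qed

lemma R_A_commute: "x \<in> D \<Longrightarrow> R l (A x) = A (R l x)"
  using R_left_inverse[of x] linear_map_diff[OF R_linear] linear_map_scale[OF R_linear]
  by (simp add: A_R) (metis add_diff_cancel_left' diff_add_cancel)

end

text \<open>Stated as an equation for \<open>R l\<close> in terms of \<open>R m\<close>, the form in
  which estimates and adjoints are carried from \<open>m\<close> to \<open>l\<close>.\<close>

lemma resolvent_identity:
  assumes "regular l" "regular m"
  shows "R l x = R m (x + sX (m - l) (R l x))"
  by (rule R_eqI[OF assms(2), symmetric])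
     (simp_all add: R_in_D assms A_R X.scale_left_diff_distrib)

lemma resolvent_commute:
  assumes l: "regular l" and m: "regular m"
  shows "R l (R m x) = R m (R l x)"
proof (rule R_eqI[OF l])
  show "R m (R l x) \<in> D" by (rule R_in_D[OF m])
  show "sX l (R m (R l x)) - A (R m (R l x)) = R m x"
    using R_A_commute[OF m R_in_D[OF l, of x]] linear_map_diff[OF R_linear[OF m]]
      linear_map_scale[OF R_linear[OF m]] R_right_inverse[OF l, of x] by metis
qed

text \<open>On \<open>D\<close>, \<open>l - A = (1 - (m - l) R m) (m - A)\<close>, so the question
  is whether \<open>1 - (m - l) R m\<close> is bijective. Growth of orbits at a rate
  \<open>r\<close> common to all seminorms replaces a bound on the operator norm.\<close>

lemma regular_neumann:
  assumes F: "seminorm_family sX F" and m: "regular m"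
    and cont: "\<And>q. q \<in> F \<Longrightarrow> \<exists>q'\<in>F. \<exists>C. \<forall>x. q (R m x) \<le> C * q' x"
    and bound: "\<And>q b. q \<in> F \<Longrightarrow> \<exists>C. \<forall>k. q ((R m ^^ k) b) \<le> C * r ^ k"
    and r: "0 \<le> r" "norm (m - l) * r < 1"
  shows "regular l"
  unfolding regular_def bij_betw_def
proof (intro conjI)
  interpret F: seminorm_family sX F by (rule F)
  show "inj_on (\<lambda>x. sX l x - A x) D"
  proof (rule inj_onI)
    fix u v assume uv: "u \<in> D" "v \<in> D" "sX l u - A u = sX l v - A v"
    \<comment> \<open>An element of the kernel of \<open>l - A\<close> is fixed by
      \<open>(m - l) R m\<close>. Iterating, \<open>q z\<close> is at most a multiple of
      \<open>(norm (m - l) * r) ^ k\<close> for every \<open>k\<close>, hence 0.\<close>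
    define z where "z = u - v"
    have "sX m z - A z = sX (m - l) z"
      using uv by (simp add: z_def A_diff X.scale_right_diff_distrib X.scale_left_diff_distrib algebra_simps)
    then have "R m (sX (m - l) z) = z"
      using R_left_inverse[OF m, of z] uv by (simp add: z_def D_diff)
    then have z: "sX (m - l) (R m z) = z"
      by (simp add: linear_map_scale[OF R_linear[OF m]])
    have z_pow: "sX ((m - l) ^ k) ((R m ^^ k) z) = z" for k
    proof (induction k)
      case (Suc k)
      have "sX ((m - l) ^ Suc k) ((R m ^^ Suc k) z) = sX (m - l) (R m (sX ((m - l) ^ k) ((R m ^^ k) z)))"
        by (simp add: linear_map_scale[OF R_linear[OF m]])
      then show ?case using Suc z by simp
    qed simp
    have "q z = 0" if q: "q \<in> F" for q
    proof (rule antisym[OF _ F.nonneg[OF q]])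
      obtain C where C: "\<forall>k. q ((R m ^^ k) z) \<le> C * r ^ k" using bound[OF q] by blast
      have "q z \<le> C * (norm (m - l) * r) ^ k" for k
      proof -
        have "q z = norm (m - l) ^ k * q ((R m ^^ k) z)"
          using F.scale[OF q, of "(m - l) ^ k" "(R m ^^ k) z"] by (simp add: z_pow norm_power)
        also have "\<dots> \<le> norm (m - l) ^ k * (C * r ^ k)" using C by (intro mult_left_mono) auto
        finally show ?thesis by (simp add: power_mult_distrib mult_ac)
      qed
      moreover have "(\<lambda>k. C * (norm (m - l) * r) ^ k) \<longlonglongrightarrow> C * 0"
        using r by (intro tendsto_mult tendsto_const LIMSEQ_realpow_zero) auto
      ultimately show "q z \<le> 0" by (intro LIMSEQ_le_const) auto
    qed
    then show "u = v" using F.separated[of z] by (simp add: z_def)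
  qed
  show "(\<lambda>x. sX l x - A x) ` D = UNIV"
  proof -
    have "x \<in> (\<lambda>x. sX l x - A x) ` D" for x
    proof -
      \<comment> \<open>The preimage of \<open>x\<close> is \<open>R m w\<close>, since
        \<open>l - A\<close> maps it to \<open>w - (m - l) R m w\<close>.\<close>
      obtain w where w: "w = x + sX (m - l) (R m w)"
        using F.neumann_solution[OF R_linear[OF m] cont bound[of _ x] r] by blast
      have "sX l (R m w) - A (R m w) = w - sX (m - l) (R m w)"
        by (simp add: A_R[OF m] X.scale_left_diff_distrib)
      then have "sX l (R m w) - A (R m w) = x" using w by (metis add_diff_cancel_right')
      then show ?thesis using R_in_D[OF m, of w] by force
    qed
    then show ?thesis by blast
  qed
qed

end

text \<open>\<open>g\<close> makes the supremum finite and need not be a seminorm. The third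
  conclusion says that \<open>q\<close> is the least bound; it yields \<open>q \<le> g\<close> as
  well as estimates of \<open>q\<close> from estimates of \<open>p\<close> along the orbit.\<close>

lemma orbit_seminorm:
  fixes s :: "'k::real_normed_field \<Rightarrow> 'x::ab_group_add \<Rightarrow> 'x" and T :: "real \<Rightarrow> 'x \<Rightarrow> 'x" and a :: real
  assumes vs: "vector_space s" and p: "is_seminorm s p"
    and lin: "\<And>t. 0 \<le> t \<Longrightarrow> Vector_Spaces.linear s s (T t)"
    and zero: "\<And>x. T 0 x = x" and add: "\<And>t r x. 0 \<le> t \<Longrightarrow> 0 \<le> r \<Longrightarrow> T (t + r) x = T t (T r x)"
    and bound: "\<And>t x. 0 \<le> t \<Longrightarrow> exp (- a * t) * p (T t x) \<le> g x"
  obtains q where "is_seminorm s q" "\<And>x. p x \<le> q x"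
    "\<And>x c. (\<And>t. 0 \<le> t \<Longrightarrow> exp (- a * t) * p (T t x) \<le> c) \<Longrightarrow> q x \<le> c"
    "\<And>t x. 0 \<le> t \<Longrightarrow> q (T t x) \<le> exp (a * t) * q x"
proof
  define q where "q x = (SUP t\<in>{0..}. exp (- a * t) * p (T t x))" for x
  have bdd: "bdd_above ((\<lambda>t. exp (- a * t) * p (T t x)) ` {0..})" for x
    using bound by (intro bdd_aboveI[of _ "g x"]) auto
  have upper: "exp (- a * t) * p (T t x) \<le> q x" if "0 \<le> t" for t x
    unfolding q_def by (rule cSUP_upper[OF _ bdd]) (use that in auto)
  have least: "q x \<le> c" if "\<And>t. 0 \<le> t \<Longrightarrow> exp (- a * t) * p (T t x) \<le> c" for x c
    unfolding q_def by (rule cSUP_least) (use that in auto)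
  show "q x \<le> c" if "\<And>t. 0 \<le> t \<Longrightarrow> exp (- a * t) * p (T t x) \<le> c" for x c
    by (rule least[OF that])
  show pq: "p x \<le> q x" for x using upper[of 0 x] by (simp add: zero)
  have scale_le: "q (s c x) \<le> norm c * q x" for c x
  proof (rule least)
    fix t :: real assume t: "0 \<le> t"
    have "exp (- a * t) * p (T t (s c x)) = norm c * (exp (- a * t) * p (T t x))"
      by (simp add: linear_map_scale[OF lin[OF t]] seminorm_scale[OF vs p])
    then show "exp (- a * t) * p (T t (s c x)) \<le> norm c * q x"
      by (simp only: mult_left_mono[OF upper[OF t]] norm_ge_zero)
  qed
  show "is_seminorm s q"
    unfolding is_seminorm_def
  proof (intro conjI allI)
    show "q (x + y) \<le> q x + q y" for x y
    proof (rule least)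
      fix t :: real assume t: "0 \<le> t"
      have "exp (- a * t) * p (T t (x + y)) \<le> exp (- a * t) * (p (T t x) + p (T t y))"
        by (simp add: linear_map_add[OF lin[OF t]] seminorm_add[OF vs p])
      then show "exp (- a * t) * p (T t (x + y)) \<le> q x + q y"
        using upper[OF t, of x] upper[OF t, of y] by (simp add: distrib_left)
    qed
    show "q (s c x) = norm c * q x" for c x
    proof (cases "c = 0")
      case True
      interpret vector_space s by (rule vs)
      have "q 0 \<le> 0"
        by (rule least) (use linear_map_zero[OF lin] seminorm_zero[OF vs p] in simp)
      moreover have "0 \<le> q 0" using pq[of 0] seminorm_zero[OF vs p] by simp
      ultimately show ?thesis using True by simp
    next
      case False
      interpret vector_space s by (rule vs)
      have "norm c * q x = norm c * q (s (inverse c) (s c x))" using False by simp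
      also have "\<dots> \<le> norm c * (norm (inverse c) * q (s c x))"
        by (intro mult_left_mono scale_le) auto
      also have "\<dots> = q (s c x)" using False by (simp add: norm_inverse)
      finally show ?thesis using scale_le[of c x] by simp
    qed
  qed
  \<comment> \<open>Applying \<open>T t\<close> restricts the supremum to times \<open>r + t\<close>
    at the price of the factor \<open>exp (a * t)\<close>.\<close>
  show "q (T t x) \<le> exp (a * t) * q x" if t: "0 \<le> t" for t x
  proof (rule least)
    fix r :: real assume r: "0 \<le> r"
    have "exp (- a * r) * p (T r (T t x)) = exp (a * t) * (exp (- a * (r + t)) * p (T (r + t) x))"
    proof -
      have "exp (- a * r) = exp (a * t) * exp (- a * (r + t))"
        by (simp add: algebra_simps flip: exp_add)
      then show ?thesis by (simp only: add[OF r t] mult.assoc)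
    qed
    also have "\<dots> \<le> exp (a * t) * q x"
      using r t by (intro mult_left_mono upper) auto
    finally show "exp (- a * r) * p (T r (T t x)) \<le> exp (a * t) * q x" .
  qed
qed

section \<open>From the semigroup to the resolvent bounds\<close>

locale generator_on_pair = operator_on_pair sX sY B \<tau> D A
  for sX :: "'k::{real_normed_field,euclidean_space} \<Rightarrow> 'x::banach \<Rightarrow> 'x"
    and sY :: "'k \<Rightarrow> 'y::banach \<Rightarrow> 'y"
    and B :: "'x \<Rightarrow> 'y \<Rightarrow> 'k" and \<tau> :: "'x topology"
    and D :: "'x set" and A :: "'x \<Rightarrow> 'x" +
  fixes M \<alpha> \<omega> :: real and T :: "real \<Rightarrow> 'x \<Rightarrow> 'x"
  assumes generator: "is_generator sX B M \<omega> T D A"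
    and continuous: "continuous_semigroup \<tau> T"
    and quasi_equi: "quasi_equicontinuous sX \<tau> \<alpha> T"
begin

lemma type: "semigroup_of_type sX B M \<omega> T"
  using generator by (simp add: is_generator_def integrable_semigroup_def)

lemma T_linear: "0 \<le> t \<Longrightarrow> Vector_Spaces.linear sX sX (T t)"
  and T_0: "T 0 x = x"
  and T_add: "0 \<le> t \<Longrightarrow> 0 \<le> r \<Longrightarrow> T (t + r) x = T t (T r x)"
  using type by (auto simp: semigroup_of_type_def continuous_operators_def)

lemma M_ge_1: "1 \<le> M" using type by (simp add: semigroup_of_type_def)

lemma T_norm: "0 \<le> t \<Longrightarrow> norm (T t x) \<le> M * exp (\<omega> * t) * norm x"
  using type onorm[of "T t" x] unfolding semigroup_of_type_def
  by (meson mult_right_mono norm_ge_zero order_trans)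

lemma T_seminorm:
  assumes "p \<in> Q"
  shows "\<exists>q\<in>Q. \<forall>t\<ge>0. \<forall>x. exp (- \<alpha> * t) * p (T t x) \<le> q x"
proof -
  obtain q where q: "q \<in> Q" "\<forall>S\<in>{\<lambda>x. exp (- \<alpha> * t) *\<^sub>R T t x | t. t \<ge> 0}. \<forall>x. p (S x) \<le> q x"
    using quasi_equi assms
    unfolding quasi_equicontinuous_def equicontinuous_ops_def continuous_seminorms_def by blast
  have "exp (- \<alpha> * t) * p (T t x) \<le> q x" if "0 \<le> t" for t x
  proof -
    have "p (exp (- \<alpha> * t) *\<^sub>R T t x) \<le> q x" using q(2) that by auto
    then show ?thesis by (simp add: tau_scaleR[OF assms])
  qed
  then show ?thesis using q(1) by blast
qed

text \<open>Lets a \<open>T t\<close> standing in front of a Laplace integral move into the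
  functional and so act under the integral sign.\<close>

lemma T_adjoint:
  assumes t: "0 \<le> t" shows "\<exists>y'. \<forall>x. B (T t x) y = B x y'"
proof (rule adjoint_exists[OF T_linear[OF t]])
  fix p assume "p \<in> Q"
  then obtain q where q: "q \<in> Q" "\<forall>t\<ge>0. \<forall>x. exp (- \<alpha> * t) * p (T t x) \<le> q x"
    using T_seminorm by blast
  have "p (T t x) \<le> exp (\<alpha> * t) * q x" for x
  proof -
    have "p (T t x) = exp (\<alpha> * t) * (exp (- \<alpha> * t) * p (T t x))"
      by (simp flip: exp_add mult.assoc)
    also have "\<dots> \<le> exp (\<alpha> * t) * q x" using q(2) t by (intro mult_left_mono) auto
    finally show ?thesis .
  qed
  then show "\<exists>q\<in>Q. \<forall>x. p (T t x) \<le> q x"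
    using continuous_seminorms_mult[OF vsX lc q(1), of "exp (\<alpha> * t)"]
    by (intro bexI[of _ "\<lambda>x. exp (\<alpha> * t) * q x"]) auto
qed

lemma B_T_continuous: "continuous_on {0..} (\<lambda>t. B (T t x) y)"
  unfolding continuous_on_def
proof
  fix t :: real assume "t \<in> {0..}"
  then have "((\<lambda>r. norm (B (T r x - T t x) y)) \<longlongrightarrow> 0) (at t within {0..})"
    using continuous norm_B_seminorm unfolding continuous_semigroup_iff[OF vsX lc] by force
  then show "((\<lambda>r. B (T r x) y) \<longlongrightarrow> B (T t x) y) (at t within {0..})"
    by (simp add: B_simps tendsto_norm_zero_iff LIM_zero_iff)
qed

context
  fixes l :: real assumes l: "\<omega> < l"
begin

lemma laplace_ex: "\<exists>S. is_laplace_transform_at sX B T (of_real l) S"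
  using generator l unfolding is_generator_def integrable_semigroup_def
  by (simp add: re_part_def)

lemma laplace_R: "is_laplace_transform_at sX B T (of_real l) (R (of_real l))"
  and regular_l: "regular (of_real l)"
  using laplace_ex generator l unfolding is_generator_def regular_def
  by (fastforce simp: re_part_def)+

lemma B_R: "B (R (of_real l) x) y = (LINT t:{0..}|lebesgue. exp (- l * t) *\<^sub>R B (T t x) y)"
proof -
  have "exp (- of_real l * of_real t) * z = exp (- l * t) *\<^sub>R z" for t and z :: 'k
    by (simp add: scaleR_conv_of_real flip: exp_of_real)
  then show ?thesis
    using laplace_R by (simp add: is_laplace_transform_at_def)
qed

lemma kernel_continuous: "continuous_on {0..} (\<lambda>t. exp (- l * t) *\<^sub>R B (T t x) y)"
  by (intro continuous_intros B_T_continuous)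

lemma kernel_tendsto:
  "((\<lambda>n. integral {0..n} (\<lambda>t. exp (- l * t) *\<^sub>R B (T t x) y)) \<longlongrightarrow> B (R (of_real l) x) y) at_top"
  unfolding B_R
proof (rule half_line_integral(3)[OF kernel_continuous])
  show "0 < l - \<omega>" using l by simp
  fix t :: real assume t: "0 \<le> t"
  have "norm (B (T t x) y) \<le> M * exp (\<omega> * t) * norm x * norm y"
    using norm_B_le[of "T t x" y] mult_right_mono[OF T_norm[OF t, of x] norm_ge_zero[of y]] by simp
  then show "norm (exp (- l * t) *\<^sub>R B (T t x) y) \<le> M * norm x * norm y * exp (- (l - \<omega>) * t)"
    by (simp add: left_diff_distrib exp_diff exp_minus field_simps)
qed

text \<open>Through its adjoint, \<open>T t\<close> acts inside the integral, where it commutes with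
  every \<open>T r\<close>.\<close>

lemma T_R_commute:
  assumes t: "0 \<le> t"
  shows "T t (R (of_real l) x) = R (of_real l) (T t x)"
proof (rule B_eqI)
  fix y
  obtain y' where y': "\<forall>x. B (T t x) y = B x y'" using T_adjoint[OF t] by blast
  have "T r (T t x) = T t (T r x)" if "0 \<le> r" for r
    using T_add[OF that t, of x] T_add[OF t that, of x] by (simp add: add.commute)
  then have "(LINT r:{0..}|lebesgue. exp (- l * r) *\<^sub>R B (T r (T t x)) y) =
      (LINT r:{0..}|lebesgue. exp (- l * r) *\<^sub>R B (T r x) y')"
    using y' by (intro set_lebesgue_integral_cong) auto
  then show "B (T t (R (of_real l) x)) y = B (R (of_real l) (T t x)) y"
    using y' by (simp add: B_R)
qed

text \<open>For the orbit norm \<open>q\<close> the estimate of one factor has constant 1 and can be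
  iterated; \<open>M\<close> enters only once, through \<open>q x \<le> M * norm x\<close>.\<close>

lemma R_norm_power: "norm ((l - \<omega>) ^ k *\<^sub>R (R (of_real l) ^^ k) x) \<le> M * norm x"
proof -
  have bound: "exp (- \<omega> * t) * norm (T t x) \<le> M * norm x" if "0 \<le> t" for t x
    using T_norm[OF that, of x] by (simp add: exp_minus field_simps)
  have "is_seminorm sX norm" by (rule normX.is_seminorm) simp
  then obtain q where q: "is_seminorm sX q" "\<And>x. norm x \<le> q x"
    "\<And>x c. (\<And>t. 0 \<le> t \<Longrightarrow> exp (- \<omega> * t) * norm (T t x) \<le> c) \<Longrightarrow> q x \<le> c"
    "\<And>t x. 0 \<le> t \<Longrightarrow> q (T t x) \<le> exp (\<omega> * t) * q x"
    using orbit_seminorm[OF vsX _ T_linear T_0 T_add bound] by blast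
  note q_nonneg = seminorm_nonneg[OF vsX q(1)]
  \<comment> \<open>\<open>q\<close> is not given by elements of Y, so the integral is estimated for
    the norm of \<open>T r\<close> applied to the resolvent, and the supremum over \<open>r\<close>
    is taken afterwards.\<close>
  have norm_TR: "norm (T r (R (of_real l) x)) \<le> exp (\<omega> * r) * (q x / (l - \<omega>))" if r: "0 \<le> r" for r x
  proof (rule norm_leI)
    fix y :: 'y assume y: "norm y \<le> 1"
    have "norm (B (R (of_real l) (T r x)) y) \<le> exp (\<omega> * r) * q x / (l - \<omega>)"
      unfolding B_R
    proof (rule half_line_integral(2)[OF kernel_continuous])
      show "0 < l - \<omega>" using l by simp
      fix t :: real assume t: "0 \<le> t"
      have "norm (B (T t (T r x)) y) \<le> norm (T t (T r x)) * norm y" by (rule norm_B_le)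
      also have "\<dots> \<le> norm (T t (T r x)) * 1" using y by (intro mult_left_mono) auto
      also have "\<dots> \<le> q (T t (T r x))" using q(2) by simp
      also have "\<dots> \<le> exp (\<omega> * t) * (exp (\<omega> * r) * q x)"
        using q(4)[OF t, of "T r x"] q(4)[OF r, of x] by (meson exp_ge_zero mult_left_mono order_trans)
      finally show "norm (exp (- l * t) *\<^sub>R B (T t (T r x)) y) \<le> exp (\<omega> * r) * q x * exp (- (l - \<omega>) * t)"
        by (simp add: left_diff_distrib exp_diff exp_minus field_simps)
    qed
    then show "norm (B (T r (R (of_real l) x)) y) \<le> exp (\<omega> * r) * (q x / (l - \<omega>))"
      by (simp add: T_R_commute[OF r])
  qed
  have qR: "(l - \<omega>) * q (R (of_real l) x) \<le> q x" for x
  proof -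
    have "q (R (of_real l) x) \<le> q x / (l - \<omega>)"
    proof (rule q(3))
      fix t :: real assume "0 \<le> t"
      then show "exp (- \<omega> * t) * norm (T t (R (of_real l) x)) \<le> q x / (l - \<omega>)"
        using norm_TR[of t x] by (simp add: exp_minus field_simps)
    qed
    then show ?thesis using l by (simp add: field_simps)
  qed
  have "(l - \<omega>) ^ k * q ((R (of_real l) ^^ k) x) \<le> q x"
  proof (induction k)
    case (Suc k)
    have "(l - \<omega>) ^ Suc k * q ((R (of_real l) ^^ Suc k) x) =
        (l - \<omega>) ^ k * ((l - \<omega>) * q (R (of_real l) ((R (of_real l) ^^ k) x)))"
      by simp
    also have "\<dots> \<le> (l - \<omega>) ^ k * q ((R (of_real l) ^^ k) x)"
      using l by (intro mult_left_mono qR) auto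
    finally show ?case using Suc by simp
  qed simp
  moreover have "q x \<le> M * norm x" using q(3)[OF bound] .
  moreover have "(l - \<omega>) ^ k * norm ((R (of_real l) ^^ k) x) \<le> (l - \<omega>) ^ k * q ((R (of_real l) ^^ k) x)"
    using l q(2) by (intro mult_left_mono) auto
  ultimately have "(l - \<omega>) ^ k * norm ((R (of_real l) ^^ k) x) \<le> M * norm x" by linarith
  then show ?thesis using l by simp
qed

end

end

lemma split_dyadic_sum:
  fixes f :: "nat \<Rightarrow> 'a::comm_monoid_add"
  assumes "n \<le> m"
  shows "sum f {..<2 ^ m} = (\<Sum>j<2 ^ n. \<Sum>i<2 ^ (m - n). f (j * 2 ^ (m - n) + i))"
proof -
  have "(\<Sum>i<2 ^ (m - n). f (j * 2 ^ (m - n) + i)) = sum f {j * 2 ^ (m - n)..<j * 2 ^ (m - n) + 2 ^ (m - n)}" for j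
    using sum.shift_bounds_nat_ivl[of f 0 "j * 2 ^ (m - n)" "2 ^ (m - n)"]
    by (simp add: atLeast0LessThan add.commute[of _ "j * 2 ^ (m - n)"])
  then have "(\<Sum>j<2 ^ n. \<Sum>i<2 ^ (m - n). f (j * 2 ^ (m - n) + i)) =
      (\<Sum>j<2 ^ n. sum f {j * 2 ^ (m - n)..<j * 2 ^ (m - n) + 2 ^ (m - n)})"
    by simp
  also have "\<dots> = sum f {..<2 ^ n * 2 ^ (m - n)}" by (rule sum.nat_group)
  finally show ?thesis using assms by (simp flip: power_add)
qed

context generator_on_pair
begin

definition adapted :: "('x \<Rightarrow> real) \<Rightarrow> bool" where
  "adapted q \<longleftrightarrow> q \<in> Q \<and> (\<forall>t\<ge>0. \<forall>x. q (T t x) \<le> exp (\<alpha> * t) * q x)"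

text \<open>\<open>q\<close> is the orbit supremum of \<open>p\<close>, and equicontinuity supplies
  the dominating \<open>g\<close> that makes it \<open>\<tau>\<close>-continuous. All
  \<open>\<tau>\<close>-estimates can thus be made with adapted seminorms.\<close>

lemma adapted_above: "p \<in> Q \<Longrightarrow> \<exists>q. adapted q \<and> (\<forall>x. p x \<le> q x)"
proof -
  assume p: "p \<in> Q"
  obtain g where g: "g \<in> Q" "\<And>t x. 0 \<le> t \<Longrightarrow> exp (- \<alpha> * t) * p (T t x) \<le> g x"
    using T_seminorm[OF p] by blast
  obtain q where q: "is_seminorm sX q" "\<And>x. p x \<le> q x"
    "\<And>x c. (\<And>t. 0 \<le> t \<Longrightarrow> exp (- \<alpha> * t) * p (T t x) \<le> c) \<Longrightarrow> q x \<le> c"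
    "\<And>t x. 0 \<le> t \<Longrightarrow> q (T t x) \<le> exp (\<alpha> * t) * q x"
    using orbit_seminorm[OF vsX tau.is_seminorm[OF p] T_linear T_0 T_add g(2)] by blast
  have "q x \<le> g x" for x by (rule q(3)[OF g(2)])
  then have "q \<in> Q" using continuous_seminorms_dominated[OF vsX lc q(1) g(1)] by blast
  then show ?thesis using q unfolding adapted_def by blast
qed

section \<open>Dyadic means of the rescaled semigroup, at a point beyond both
  \<open>\<omega>\<close> and \<open>\<alpha>\<close>\<close>

context
  fixes \<mu> :: real assumes \<mu>: "\<omega> < \<mu>" "\<alpha> < \<mu>"
begin

definition U :: "real \<Rightarrow> 'x \<Rightarrow> 'x" where
  "U t x = exp (- \<mu> * t) *\<^sub>R T t x"

lemma U_linear: "0 \<le> t \<Longrightarrow> Vector_Spaces.linear sX sX (U t)"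
  unfolding Vector_Spaces.linear_iff U_def
  using linear_map_add[OF T_linear] linear_map_scale[OF T_linear] vsX
  by (simp add: X.scale_right_distrib X.scale_left_commute flip: sX_real)

lemma U_0: "U 0 x = x"
  by (simp add: U_def T_0)

lemma U_add:
  assumes "0 \<le> t" "0 \<le> r"
  shows "U (t + r) x = U t (U r x)"
proof -
  have "T t (exp (- \<mu> * r) *\<^sub>R T r x) = exp (- \<mu> * r) *\<^sub>R T t (T r x)"
    using linear_map_scale[OF T_linear[OF assms(1)], of "of_real (exp (- \<mu> * r))"]
    by (simp only: sX_real)
  then show ?thesis
    using assms by (simp add: U_def T_add distrib_left flip: exp_add)
qed

lemma U_adapted:
  assumes q: "adapted q" and t: "0 \<le> t"
  shows "q (U t x) \<le> exp (- (\<mu> - \<alpha>) * t) * q x"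
proof -
  have "q (U t x) = exp (- \<mu> * t) * q (T t x)"
    using q by (simp add: U_def tau_scaleR adapted_def)
  also have "\<dots> \<le> exp (- \<mu> * t) * (exp (\<alpha> * t) * q x)"
    using q t by (simp add: adapted_def)
  finally show ?thesis by (simp add: algebra_simps flip: exp_add mult.assoc)
qed

lemma adapted_nonneg: "adapted q \<Longrightarrow> 0 \<le> q x"
  using tau.nonneg adapted_def by blast

lemma U_contraction:
  assumes q: "adapted q" and t: "0 \<le> t"
  shows "q (U t x) \<le> q x"
proof -
  have "exp (- (\<mu> - \<alpha>) * t) \<le> 1" using \<mu> t by (simp add: mult_nonpos_nonneg)
  then show ?thesis
    using U_adapted[OF q t, of x] mult_right_mono[OF _ adapted_nonneg[OF q, of x]] by fastforce
qed

lemma U_continuous_0: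
  assumes q: "adapted q" and e: "0 < e"
  shows "\<exists>d>0. \<forall>t. 0 \<le> t \<longrightarrow> t \<le> d \<longrightarrow> q (U t x - x) \<le> e"
proof -
  have Q: "q \<in> Q" using q by (simp add: adapted_def)
  have "((\<lambda>t. q (T t x - T 0 x)) \<longlongrightarrow> 0) (at 0 within {0..})"
    using continuous Q unfolding continuous_semigroup_iff[OF vsX lc] by force
  moreover have "((\<lambda>t::real. \<bar>exp (- \<mu> * t) - 1\<bar>) \<longlongrightarrow> \<bar>exp (- \<mu> * 0) - 1\<bar>) (at 0 within {0..})"
    by (intro tendsto_intros)
  ultimately have "((\<lambda>t. exp (- \<mu> * t) * q (T t x - T 0 x) + \<bar>exp (- \<mu> * t) - 1\<bar> * q x) \<longlongrightarrow>
      exp (- \<mu> * 0) * 0 + 0 * q x) (at 0 within {0..})"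
    by (intro tendsto_intros) auto
  then have "\<forall>\<^sub>F t in at 0 within {0..}. exp (- \<mu> * t) * q (T t x - T 0 x) + \<bar>exp (- \<mu> * t) - 1\<bar> * q x < e"
    using e by (intro order_tendstoD) auto
  then obtain d where d: "0 < d" "\<And>t. 0 \<le> t \<Longrightarrow> t \<noteq> 0 \<Longrightarrow> t < d \<Longrightarrow>
      exp (- \<mu> * t) * q (T t x - T 0 x) + \<bar>exp (- \<mu> * t) - 1\<bar> * q x < e"
    by (auto simp: eventually_at dist_real_def)
  have "q (U t x - x) \<le> e" if "0 \<le> t" "t \<le> d / 2" for t
  proof (cases "t = 0")
    case True
    then show ?thesis using e tau.zero[OF Q] by (simp add: U_0)
  next
    case False
    have "U t x - x = exp (- \<mu> * t) *\<^sub>R (T t x - T 0 x) + (exp (- \<mu> * t) - 1) *\<^sub>R x"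
      by (simp add: U_def T_0 scaleR_diff_left scaleR_diff_right)
    then have "q (U t x - x) \<le> exp (- \<mu> * t) * q (T t x - T 0 x) + \<bar>exp (- \<mu> * t) - 1\<bar> * q x"
      using tau.add[OF Q, of "exp (- \<mu> * t) *\<^sub>R (T t x - T 0 x)" "(exp (- \<mu> * t) - 1) *\<^sub>R x"]
      by (simp add: tau_scaleR[OF Q])
    then show ?thesis using d(2)[of t] that False d(1) by linarith
  qed
  then show ?thesis using d(1) by (intro exI[of _ "d / 2"]) auto
qed

text \<open>\<open>h\<close> times this is the left Riemann sum of \<open>U t x\<close> over
  \<open>[0, h]\<close> with \<open>2 ^ n\<close> cells.\<close>

definition dyadic_mean :: "nat \<Rightarrow> real \<Rightarrow> 'x \<Rightarrow> 'x" where
  "dyadic_mean n h x = (1 / 2 ^ n) *\<^sub>R (\<Sum>j<2 ^ n. U (real j * (h / 2 ^ n)) x)"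

lemma dyadic_mean_diff:
  assumes q: "adapted q" and h: "0 \<le> h" and le: "\<And>t. 0 \<le> t \<Longrightarrow> t \<le> h \<Longrightarrow> q (U t x - x) \<le> e"
  shows "q (dyadic_mean n h x - x) \<le> e"
proof -
  have Q: "q \<in> Q" using q by (simp add: adapted_def)
  have "dyadic_mean n h x - x = (1 / 2 ^ n) *\<^sub>R (\<Sum>j<2 ^ n. U (real j * (h / 2 ^ n)) x - x)"
    by (simp add: dyadic_mean_def sum_subtractf scaleR_diff_right scaleR_conv_of_real sum_constant_scaleR)
  then have "q (dyadic_mean n h x - x) = (1 / 2 ^ n) * q (\<Sum>j<2 ^ n. U (real j * (h / 2 ^ n)) x - x)"
    by (simp add: tau_scaleR[OF Q])
  also have "\<dots> \<le> (1 / 2 ^ n) * (\<Sum>j<2 ^ n. q (U (real j * (h / 2 ^ n)) x - x))"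
    by (intro mult_left_mono tau.sum[OF Q]) auto
  also have "\<dots> \<le> (1 / 2 ^ n) * (\<Sum>j<(2::nat) ^ n. e)"
  proof (intro mult_left_mono sum_mono le)
    fix j :: nat assume "j \<in> {..<2 ^ n}"
    then have "real j \<le> 2 ^ n" by (simp add: less_imp_le)
    then have "real j * (h / 2 ^ n) \<le> 2 ^ n * (h / 2 ^ n)" using h by (intro mult_right_mono) auto
    then show "real j * (h / 2 ^ n) \<le> h" by simp
  qed (use h in auto)
  finally show ?thesis by simp
qed

text \<open>Within one coarse cell the finer sum is the image under \<open>U\<close> of a dyadic
  mean over \<open>[0, h / 2 ^ n]\<close>. The difference is therefore an average of contractions
  applied to a single small vector, and continuity of the orbit at time 0 suffices for the Cauchy
  property.\<close>

lemma dyadic_mean_refine: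
  assumes nm: "n \<le> m" and h: "0 \<le> h"
  shows "dyadic_mean m h x - dyadic_mean n h x =
    (1 / 2 ^ n) *\<^sub>R (\<Sum>j<2 ^ n. U (real j * (h / 2 ^ n)) (dyadic_mean (m - n) (h / 2 ^ n) x - x))"
proof -
  define d where "d = h / 2 ^ n"
  have d: "0 \<le> d" using h by (simp add: d_def)
  have pow: "(2::real) ^ m = 2 ^ n * 2 ^ (m - n)" using nm by (simp flip: power_add)
  have hm: "h / 2 ^ m = d / 2 ^ (m - n)" by (simp add: d_def pow)
  have "U (real (j * 2 ^ (m - n) + i) * (h / 2 ^ m)) x = U (real j * d) (U (real i * (d / 2 ^ (m - n))) x)" for i j
    using d by (subst U_add[symmetric]) (auto simp: hm field_simps)
  then have "dyadic_mean m h x = (1 / 2 ^ m) *\<^sub>R (\<Sum>j<2 ^ n. \<Sum>i<2 ^ (m - n). U (real j * d) (U (real i * (d / 2 ^ (m - n))) x))"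
    unfolding dyadic_mean_def split_dyadic_sum[OF nm] by simp
  also have "\<dots> = (1 / 2 ^ n) *\<^sub>R (\<Sum>j<2 ^ n. U (real j * d) (dyadic_mean (m - n) d x))"
  proof -
    have "U (real j * d) (dyadic_mean (m - n) d x) =
        (1 / 2 ^ (m - n)) *\<^sub>R (\<Sum>i<2 ^ (m - n). U (real j * d) (U (real i * (d / 2 ^ (m - n))) x))" for j :: nat
    proof -
      have lin: "Vector_Spaces.linear sX sX (U (real j * d))" using d by (intro U_linear) auto
      show ?thesis
        using linear_map_scale[OF lin, of "of_real (1 / 2 ^ (m - n))"]
        unfolding dyadic_mean_def sX_real by (simp add: linear_map_sum[OF lin])
    qed
    then show ?thesis by (simp add: pow flip: scaleR_sum_right)
  qed
  finally have "dyadic_mean m h x - dyadic_mean n h x =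
      (1 / 2 ^ n) *\<^sub>R (\<Sum>j<2 ^ n. U (real j * d) (dyadic_mean (m - n) d x) - U (real j * d) x)"
    by (simp add: dyadic_mean_def[of n] d_def sum_subtractf scaleR_diff_right)
  then show ?thesis
    using linear_map_diff[OF U_linear] d by (simp add: d_def[symmetric])
qed

lemma dyadic_mean_Cauchy:
  assumes q: "adapted q" and h: "0 \<le> h" and e: "0 < e"
  shows "\<exists>N. \<forall>m\<ge>N. \<forall>n\<ge>N. q (dyadic_mean m h x - dyadic_mean n h x) < e"
proof -
  have Q: "q \<in> Q" using q by (simp add: adapted_def)
  obtain d where d: "0 < d" "\<And>t. 0 \<le> t \<Longrightarrow> t \<le> d \<Longrightarrow> q (U t x - x) \<le> e / 2"
    using U_continuous_0[OF q, of "e / 2"] e by auto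
  \<comment> \<open>From \<open>N\<close> on, the coarse cells have length at most
    \<open>d\<close>.\<close>
  obtain N where N: "h / d < 2 ^ N" using real_arch_pow[of 2 "h / d"] by auto
  have small: "q (dyadic_mean m h x - dyadic_mean n h x) \<le> e / 2" if nm: "N \<le> n" "n \<le> m" for n m
  proof -
    have "h / d < 2 ^ n" using N power_increasing[OF nm(1), of "2::real"] by linarith
    then have hd: "h / 2 ^ n \<le> d" using d(1) by (simp add: field_simps)
    have "q (dyadic_mean m h x - dyadic_mean n h x) =
        (1 / 2 ^ n) * q (\<Sum>j<2 ^ n. U (real j * (h / 2 ^ n)) (dyadic_mean (m - n) (h / 2 ^ n) x - x))"
      by (simp add: dyadic_mean_refine[OF nm(2) h] tau_scaleR[OF Q])
    also have "\<dots> \<le> (1 / 2 ^ n) * (\<Sum>j<2 ^ n. q (U (real j * (h / 2 ^ n)) (dyadic_mean (m - n) (h / 2 ^ n) x - x)))"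
      by (intro mult_left_mono tau.sum[OF Q]) auto
    also have "\<dots> \<le> (1 / 2 ^ n) * (\<Sum>j<(2::nat) ^ n. e / 2)"
    proof (intro mult_left_mono sum_mono)
      fix j :: nat
      have "q (U (real j * (h / 2 ^ n)) (dyadic_mean (m - n) (h / 2 ^ n) x - x)) \<le>
          q (dyadic_mean (m - n) (h / 2 ^ n) x - x)"
        using h by (intro U_contraction[OF q]) auto
      also have "\<dots> \<le> e / 2"
        using h hd d(2) by (intro dyadic_mean_diff[OF q]) auto
      finally show "q (U (real j * (h / 2 ^ n)) (dyadic_mean (m - n) (h / 2 ^ n) x - x)) \<le> e / 2" .
    qed auto
    finally show ?thesis by simp
  qed
  have "q (dyadic_mean m h x - dyadic_mean n h x) < e" if "N \<le> m" "N \<le> n" for m n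
  proof (cases "n \<le> m")
    case True
    then show ?thesis using small[OF that(2) True] e by linarith
  next
    case False
    then show ?thesis
      using small[OF that(1), of n] e tau.minus_commute[OF Q, of "dyadic_mean m h x" "dyadic_mean n h x"]
      by simp
  qed
  then show ?thesis by (intro exI[of _ N]) simp
qed

lemma dyadic_mean_weak_limit:
  assumes h: "0 \<le> h"
  shows "(\<lambda>n. h *\<^sub>R B (dyadic_mean n h x) y) \<longlonglongrightarrow> integral {0..h} (\<lambda>t. B (U t x) y)"
proof (rule LIMSEQ_I)
  fix e :: real assume e: "0 < e"
  obtain q where q: "adapted q" "\<And>z. norm (B z y) \<le> q z"
    using adapted_above[OF norm_B_seminorm] by blast
  have cont: "continuous_on {0..} (\<lambda>t. B (U t x) y)"
    unfolding U_def B_simps by (intro continuous_intros B_T_continuous)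
  \<comment> \<open>The Riemann sum will be off by at most \<open>h * e'\<close>; the summand 1
    keeps the quotient meaningful for \<open>h = 0\<close>.\<close>
  define e' where "e' = e / (2 * (h + 1))"
  have e': "0 < e'" using e h by (simp add: e'_def)
  obtain d where d: "0 < d" "\<And>t. 0 \<le> t \<Longrightarrow> t \<le> d \<Longrightarrow> q (U t x - x) \<le> e'"
    using U_continuous_0[OF q(1) e'] by auto
  obtain N where N: "h / d < 2 ^ N" using real_arch_pow[of 2 "h / d"] by auto
  show "\<exists>N. \<forall>n\<ge>N. norm (h *\<^sub>R B (dyadic_mean n h x) y - integral {0..h} (\<lambda>t. B (U t x) y)) < e"
  proof (intro exI[of _ N] allI impI)
    fix n assume "N \<le> n"
    define c where "c = h / 2 ^ n"
    have c0: "0 \<le> c" using h by (simp add: c_def)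
    have "h / d < 2 ^ n" using N power_increasing[OF \<open>N \<le> n\<close>, of "2::real"] by linarith
    then have cd: "c \<le> d" using d(1) by (simp add: c_def field_simps)
    have "norm (integral {0..(2 ^ n :: nat) * c} (\<lambda>t. B (U t x) y) - c *\<^sub>R (\<Sum>j<2 ^ n. B (U (real j * c) x) y)) \<le>
        (2 ^ n :: nat) * c * e'"
    proof (rule riemann_sum_error[OF cont c0])
      fix t :: real and j :: nat assume t: "j * c \<le> t" "t \<le> (real j + 1) * c"
      have jc: "0 \<le> j * c" using c0 by simp
      have tj: "0 \<le> t - j * c" "t - j * c \<le> d" using t cd by (auto simp: distrib_right)
      have "U t x - U (real j * c) x = U (real j * c) (U (t - j * c) x - x)"
        using U_add[OF jc tj(1), of x] linear_map_diff[OF U_linear[OF jc]] by simp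
      then have "norm (B (U t x) y - B (U (real j * c) x) y) \<le> q (U (real j * c) (U (t - j * c) x - x))"
        using q(2) by (simp flip: B_simps(2))
      also have "\<dots> \<le> q (U (t - j * c) x - x)" by (rule U_contraction[OF q(1) jc])
      also have "\<dots> \<le> e'" using d(2) tj by simp
      finally show "norm (B (U t x) y - B (U (real j * c) x) y) \<le> e'" .
    qed
    moreover have "c *\<^sub>R (\<Sum>j<2 ^ n. B (U (real j * c) x) y) = h *\<^sub>R B (dyadic_mean n h x) y"
      by (simp add: dyadic_mean_def B_simps c_def)
    ultimately have "norm (integral {0..h} (\<lambda>t. B (U t x) y) - h *\<^sub>R B (dyadic_mean n h x) y) \<le> h * e'"
      by (simp add: c_def)
    also have "h * e' \<le> e / 2" using h e by (simp add: e'_def field_simps)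
    also have "e / 2 < e" using e by simp
    finally show "norm (h *\<^sub>R B (dyadic_mean n h x) y - integral {0..h} (\<lambda>t. B (U t x) y)) < e"
      by (simp add: norm_minus_commute)
  qed
qed

text \<open>
  The mean of \<open>t \<mapsto> e\<^sup>-\<^sup>\<mu>\<^sup>t T(t) x\<close> over \<open>[0, h]\<close>, written without an integral.
\<close>

definition mean :: "real \<Rightarrow> 'x \<Rightarrow> 'x" where
  "mean h x = (1 / h) *\<^sub>R (R (of_real \<mu>) x - U h (R (of_real \<mu>) x))"

text \<open>The resolvent paired with y is an integral over the half-line, and the term with
  \<open>U h\<close> is its tail from \<open>h\<close> on: by the adjoint of \<open>T h\<close>, the
  tail is an integral of the same kind with y' in place of y.\<close>

lemma B_mean:
  assumes h: "0 < h"
  shows "h *\<^sub>R B (mean h x) y = integral {0..h} (\<lambda>t. B (U t x) y)"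
proof -
  define f where "f t = B (U t x) y" for t
  define I where "I t = integral {0..t} f" for t
  have f_eq: "f = (\<lambda>t. exp (- \<mu> * t) *\<^sub>R B (T t x) y)"
    by (simp add: f_def U_def B_simps fun_eq_iff)
  have cont: "continuous_on {0..} f" unfolding f_eq by (rule kernel_continuous[OF \<mu>(1)])
  have cont': "continuous_on {a..b} f" if "0 \<le> a" for a b
    using continuous_on_subset[OF cont] that by auto
  have I: "(I \<longlongrightarrow> B (R (of_real \<mu>) x) y) at_top"
    unfolding I_def f_eq by (rule kernel_tendsto[OF \<mu>(1)])
  have "h \<ge> 0" using h by simp
  obtain y' where y': "\<forall>x. B (T h x) y = B x y'" using T_adjoint[OF \<open>h \<ge> 0\<close>] by blast
  define g where "g t = exp (- \<mu> * t) *\<^sub>R B (T t x) y'" for t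
  have fg: "f (t + h) = exp (- \<mu> * h) *\<^sub>R g t" if "0 \<le> t" for t
  proof -
    have "T (t + h) x = T h (T t x)" using T_add[OF \<open>h \<ge> 0\<close> that, of x] by (simp add: add.commute)
    moreover have "exp (- \<mu> * (t + h)) = exp (- \<mu> * h) * exp (- \<mu> * t)"
      by (simp add: algebra_simps flip: exp_add)
    ultimately show ?thesis using y' by (simp add: f_eq g_def)
  qed
  have "I (n + h) - I h = exp (- \<mu> * h) *\<^sub>R integral {0..n} g" if n: "0 \<le> n" for n
  proof -
    have "I (n + h) = I h + integral {h..n + h} f"
      unfolding I_def using n h
      by (intro Henstock_Kurzweil_Integration.integral_combine[symmetric] integrable_continuous_interval cont') auto
    also have "integral {h..n + h} f = integral {0..n} (f \<circ> (\<lambda>x. x + h))"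
      using integral_shift[of 0 h n f] cont'[of h "n + h"] h by simp
    also have "\<dots> = integral {0..n} (\<lambda>t. exp (- \<mu> * h) *\<^sub>R g t)"
      by (rule integral_cong) (use fg in auto)
    also have "\<dots> = exp (- \<mu> * h) *\<^sub>R integral {0..n} g" by simp
    finally show ?thesis by simp
  qed
  then have "\<forall>\<^sub>F n in at_top. exp (- \<mu> * h) *\<^sub>R integral {0..n} g = I (n + h) - I h"
    by (intro eventually_mono[OF eventually_ge_at_top[of 0]]) simp
  moreover have "((\<lambda>n. I (n + h) - I h) \<longlongrightarrow> B (R (of_real \<mu>) x) y - I h) at_top"
  proof (intro tendsto_diff tendsto_const filterlim_compose[OF I])
    show "LIM n at_top. n + h :> at_top"
      using filterlim_tendsto_add_at_top[OF tendsto_const filterlim_ident, of h] by (simp add: add.commute)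
  qed
  ultimately have "((\<lambda>n. exp (- \<mu> * h) *\<^sub>R integral {0..n} g) \<longlongrightarrow> B (R (of_real \<mu>) x) y - I h) at_top"
    by (simp cong: filterlim_cong)
  moreover have "((\<lambda>n. exp (- \<mu> * h) *\<^sub>R integral {0..n} g) \<longlongrightarrow> exp (- \<mu> * h) *\<^sub>R B (R (of_real \<mu>) x) y') at_top"
    unfolding g_def by (intro tendsto_intros kernel_tendsto[OF \<mu>(1)])
  ultimately have "exp (- \<mu> * h) *\<^sub>R B (R (of_real \<mu>) x) y' = B (R (of_real \<mu>) x) y - I h"
    by (intro tendsto_unique[of at_top]) auto
  moreover have "h *\<^sub>R B (mean h x) y = B (R (of_real \<mu>) x) y - exp (- \<mu> * h) *\<^sub>R B (R (of_real \<mu>) x) y'"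
    using h y' by (simp add: mean_def U_def B_simps)
  ultimately show ?thesis by (simp add: I_def f_def[abs_def])
qed

text \<open>Completeness provides some limit; it is \<open>mean h x\<close> because both have the
  same pairings with Y.\<close>

lemma dyadic_mean_converges:
  assumes h: "0 < h"
  shows "tau.converges_to (\<lambda>n. dyadic_mean n h x) (mean h x)"
proof -
  have "\<exists>z. \<forall>q\<in>Q. (\<lambda>n. q (dyadic_mean n h x - z)) \<longlonglongrightarrow> 0"
  proof (rule tau.complete)
    fix p and e :: real assume p: "p \<in> Q" and e: "0 < e"
    obtain q where q: "adapted q" "\<And>x. p x \<le> q x" using adapted_above[OF p] by blast
    obtain N where "\<forall>m\<ge>N. \<forall>n\<ge>N. q (dyadic_mean m h x - dyadic_mean n h x) < e"
      using dyadic_mean_Cauchy[OF q(1) less_imp_le[OF h] e] by blast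
    then have "\<forall>m\<ge>N. \<forall>n\<ge>N. p (dyadic_mean m h x - dyadic_mean n h x) < e"
      using q(2) order_le_less_trans by blast
    then show "\<exists>N. \<forall>m\<ge>N. \<forall>n\<ge>N. p (dyadic_mean m h x - dyadic_mean n h x) < e" by blast
  qed
  then obtain z where z: "tau.converges_to (\<lambda>n. dyadic_mean n h x) z"
    by (auto simp: tau.converges_to_def)
  have "z = mean h x"
  proof (rule B_eqI)
    fix y
    have "(\<lambda>n. h *\<^sub>R B (dyadic_mean n h x) y) \<longlonglongrightarrow> h *\<^sub>R B z y"
      by (intro tendsto_intros tau_converges_to_B z)
    then have "h *\<^sub>R B z y = h *\<^sub>R B (mean h x) y"
      using LIMSEQ_unique dyadic_mean_weak_limit[OF less_imp_le[OF h], of x y] B_mean[OF h, of x y]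
      by auto
    then show "B z y = B (mean h x) y" using h by simp
  qed
  then show ?thesis using z by simp
qed

lemma mean_diff:
  assumes q: "adapted q" and h: "0 < h" and le: "\<And>t. 0 \<le> t \<Longrightarrow> t \<le> h \<Longrightarrow> q (U t x - x) \<le> e"
  shows "q (mean h x - x) \<le> e"
proof -
  have Q: "q \<in> Q" using q by (simp add: adapted_def)
  have "(\<lambda>n. q (dyadic_mean n h x - x)) \<longlonglongrightarrow> q (mean h x - x)"
    by (rule tau.converges_to_seminorm[OF tau.converges_to_diff[OF dyadic_mean_converges[OF h] tau.converges_to_const] Q])
  then show ?thesis
    using dyadic_mean_diff[OF q less_imp_le[OF h] le] by (intro LIMSEQ_le_const2) auto
qed

text \<open>The resolvent is \<open>U h\<close> of itself plus \<open>h\<close> times a mean close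
  to \<open>x\<close>. Since \<open>U h\<close> contracts by \<open>exp (- \<beta> * h)\<close>, its
  term can be absorbed on the left; then \<open>h\<close> and the error \<open>e\<close> tend to
  0.\<close>

lemma R_adapted_large:
  assumes q: "adapted q"
  shows "(\<mu> - \<alpha>) * q (R (of_real \<mu>) x) \<le> q x"
proof (rule field_le_epsilon)
  fix e :: real assume e: "0 < e"
  have Q: "q \<in> Q" using q by (simp add: adapted_def)
  obtain d where d: "0 < d" "\<And>t. 0 \<le> t \<Longrightarrow> t \<le> d \<Longrightarrow> q (U t x - x) \<le> e"
    using U_continuous_0[OF q e] by auto
  define \<beta> where "\<beta> = \<mu> - \<alpha>"
  have \<beta>: "0 < \<beta>" using \<mu> by (simp add: \<beta>_def)
  \<comment> \<open>With \<open>exp (- \<beta> * h) \<le> 1 / (1 + \<beta> * h)\<close>, multiply by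
    \<open>1 + \<beta> * h\<close>, cancel the resolvent term and divide by
    \<open>h\<close>.\<close>
  have est: "\<beta> * q (R (of_real \<mu>) x) \<le> (1 + \<beta> * h) * (q x + e)" if h: "0 < h" "h \<le> d" for h
  proof -
    have "R (of_real \<mu>) x = U h (R (of_real \<mu>) x) + h *\<^sub>R mean h x"
      using h by (simp add: mean_def)
    then have "q (R (of_real \<mu>) x) \<le> q (U h (R (of_real \<mu>) x)) + h * q (mean h x)"
      using tau.add[OF Q, of "U h (R (of_real \<mu>) x)" "h *\<^sub>R mean h x"] h by (simp add: tau_scaleR[OF Q])
    moreover have "q (mean h x) \<le> q x + e"
      using mean_diff[OF q h(1), of x e] d(2) h(2) tau.add[OF Q, of "mean h x - x" x] by fastforce
    moreover have "q (U h (R (of_real \<mu>) x)) \<le> exp (- \<beta> * h) * q (R (of_real \<mu>) x)"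
      using U_adapted[OF q, of h] h by (simp add: \<beta>_def)
    moreover have "exp (- \<beta> * h) * q (R (of_real \<mu>) x) \<le> 1 / (1 + \<beta> * h) * q (R (of_real \<mu>) x)"
    proof (intro mult_right_mono tau.nonneg[OF Q])
      have "1 + \<beta> * h \<le> exp (\<beta> * h)" by simp
      moreover have "0 < 1 + \<beta> * h" using \<beta> h by (simp add: add_pos_nonneg)
      ultimately show "exp (- \<beta> * h) \<le> 1 / (1 + \<beta> * h)" by (simp add: exp_minus field_simps)
    qed
    ultimately have "q (R (of_real \<mu>) x) \<le> 1 / (1 + \<beta> * h) * q (R (of_real \<mu>) x) + h * (q x + e)"
      using h mult_left_mono[of "q (mean h x)" "q x + e" h] by linarith
    moreover have "0 < 1 + \<beta> * h" using \<beta> h by (simp add: add_pos_nonneg)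
    ultimately have "(1 + \<beta> * h) * q (R (of_real \<mu>) x) \<le> q (R (of_real \<mu>) x) + (1 + \<beta> * h) * (h * (q x + e))"
      using mult_left_mono[of "q (R (of_real \<mu>) x)" _ "1 + \<beta> * h"] by (simp add: field_simps)
    then have "h * (\<beta> * q (R (of_real \<mu>) x)) \<le> h * ((1 + \<beta> * h) * (q x + e))"
      by (simp add: algebra_simps)
    then show ?thesis using h by simp
  qed
  have "((\<lambda>h. (1 + \<beta> * h) * (q x + e)) \<longlongrightarrow> (1 + \<beta> * 0) * (q x + e)) (at_right 0)"
    by (intro tendsto_intros)
  moreover have "\<forall>\<^sub>F h in at_right 0. \<beta> * q (R (of_real \<mu>) x) \<le> (1 + \<beta> * h) * (q x + e)"
    unfolding eventually_at_right_field using d(1) est by (intro exI[of _ d]) auto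
  ultimately have "\<beta> * q (R (of_real \<mu>) x) \<le> (1 + \<beta> * 0) * (q x + e)"
    by (intro tendsto_lowerbound) auto
  then show "(\<mu> - \<alpha>) * q (R (of_real \<mu>) x) \<le> q x + e" by (simp add: \<beta>_def)
qed

text \<open>\<open>U h\<close> commutes with the resolvent, so both terms of \<open>mean h x\<close>
  lie in its range.\<close>

lemma mean_in_D:
  assumes h: "0 < h"
  shows "mean h x \<in> D"
  using h R_in_D[OF regular_l[OF \<mu>(1)]] T_R_commute[OF \<mu>(1), of h]
  by (simp add: mean_def U_def D_scaleR D_diff)

lemma densely_defined: "sequentially_densely_defined \<tau> D"
  unfolding sequentially_densely_defined_def
proof
  fix x
  have "limitin \<tau> (\<lambda>n. mean (1 / Suc n) x) x sequentially"
    unfolding limitin_locally_convex_iff[OF vsX lc]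
  proof
    fix p assume p: "p \<in> Q"
    obtain q where q: "adapted q" "\<And>x. p x \<le> q x" using adapted_above[OF p] by blast
    show "(\<lambda>n. p (mean (1 / Suc n) x - x)) \<longlonglongrightarrow> 0"
    proof (rule LIMSEQ_I)
      fix e :: real assume "0 < e"
      then obtain d where d: "0 < d" "\<And>t. 0 \<le> t \<Longrightarrow> t \<le> d \<Longrightarrow> q (U t x - x) \<le> e / 2"
        using U_continuous_0[OF q(1), of "e / 2"] by auto
      obtain N where N: "1 / real (Suc N) < d" using nat_approx_posE[OF d(1)] by blast
      show "\<exists>N. \<forall>n\<ge>N. norm (p (mean (1 / Suc n) x - x) - 0) < e"
      proof (intro exI[of _ N] allI impI)
        fix n assume "N \<le> n"
        then have "1 / real (Suc n) \<le> 1 / real (Suc N)" by (intro divide_left_mono) auto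
        then have "q (mean (1 / Suc n) x - x) \<le> e / 2"
          using N d(2) by (intro mean_diff[OF q(1)]) auto
        then show "norm (p (mean (1 / Suc n) x - x) - 0) < e"
          using q(2)[of "mean (1 / Suc n) x - x"] tau.nonneg[OF p] \<open>0 < e\<close> by simp
      qed
    qed
  qed
  then show "\<exists>u. (\<forall>n. u n \<in> D) \<and> limitin \<tau> u x sequentially"
    using mean_in_D by (intro exI[of _ "\<lambda>n. mean (1 / Suc n) x"]) auto
qed

end

section \<open>All resolvents beyond \<open>\<alpha>\<close>, and the conditions of (2)\<close>

lemma R_seminorm_large:
  assumes \<mu>: "\<omega> < \<mu>" "\<alpha> < \<mu>" and q: "adapted q"
  shows "q (R (of_real \<mu>) x) \<le> 1 / (\<mu> - \<alpha>) * q x"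
  using R_adapted_large[OF \<mu> q, of x] \<mu> by (simp add: field_simps)

lemma R_power_seminorm_large:
  assumes \<mu>: "\<omega> < \<mu>" "\<alpha> < \<mu>" and q: "adapted q"
  shows "q ((R (of_real \<mu>) ^^ k) x) \<le> q x * (1 / (\<mu> - \<alpha>)) ^ k"
proof (induction k)
  case (Suc k)
  have "q ((R (of_real \<mu>) ^^ Suc k) x) \<le> 1 / (\<mu> - \<alpha>) * q ((R (of_real \<mu>) ^^ k) x)"
    using R_seminorm_large[OF \<mu> q] by simp
  also have "\<dots> \<le> 1 / (\<mu> - \<alpha>) * (q x * (1 / (\<mu> - \<alpha>)) ^ k)"
    using \<mu> Suc by (intro mult_left_mono) auto
  finally show ?case by (simp add: mult_ac)
qed simp

lemma regular_right_of_alpha: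
  assumes l: "\<alpha> < l"
  shows "regular (of_real l)"
proof -
  \<comment> \<open>The Neumann ratio \<open>(\<mu> - l) / (\<mu> - \<alpha>)\<close> is below 1 for
    every \<open>l > \<alpha>\<close>, so a single expansion point beyond \<open>\<omega>\<close>
    reaches \<open>l\<close> without intermediate steps.\<close>
  define \<mu> where "\<mu> = max l \<omega> + 1"
  have \<mu>: "\<omega> < \<mu>" "\<alpha> < \<mu>" "l < \<mu>" using l by (auto simp: \<mu>_def)
  show ?thesis
  proof (rule regular_neumann[OF tau.seminorm_family_axioms regular_l[OF \<mu>(1)]])
    fix p assume "p \<in> Q"
    then obtain q where q: "adapted q" "\<And>x. p x \<le> q x" using adapted_above by blast
    show "\<exists>q'\<in>Q. \<exists>C. \<forall>x. p (R (of_real \<mu>) x) \<le> C * q' x"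
      using q R_seminorm_large[OF \<mu>(1,2) q(1)]
      by (intro bexI[of _ q] exI[of _ "1 / (\<mu> - \<alpha>)"]) (auto simp: adapted_def intro: order_trans)
    show "\<exists>C. \<forall>k. p ((R (of_real \<mu>) ^^ k) b) \<le> C * (1 / (\<mu> - \<alpha>)) ^ k" for b
      using q(2) R_power_seminorm_large[OF \<mu>(1,2) q(1)] by (blast intro: order_trans)
  next
    have "norm (of_real \<mu> - of_real l :: 'k) = \<mu> - l"
      using \<mu> by (simp flip: of_real_diff)
    then show "norm (of_real \<mu> - of_real l :: 'k) * (1 / (\<mu> - \<alpha>)) < 1"
      using \<mu> l by simp
  qed (use \<mu> in auto)
qed

text \<open>The estimate at \<open>\<mu>\<close> and the resolvent identity give \<open>(\<mu> -
  \<alpha>) * q (R l x) \<le> q x + (\<mu> - l) * q (R l x)\<close>; the two factors differ by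
  \<open>l - \<alpha>\<close>, so the constant stays 1.\<close>

lemma R_adapted:
  assumes l: "\<alpha> < l" and q: "adapted q"
  shows "(l - \<alpha>) * q (R (of_real l) x) \<le> q x"
proof -
  define \<mu> where "\<mu> = max l \<omega> + 1"
  have \<mu>: "\<omega> < \<mu>" "\<alpha> < \<mu>" "l < \<mu>" using l by (auto simp: \<mu>_def)
  have Q: "q \<in> Q" using q by (simp add: adapted_def)
  have "R (of_real l) x = R (of_real \<mu>) (x + (\<mu> - l) *\<^sub>R R (of_real l) x)"
    using resolvent_identity[OF regular_right_of_alpha[OF l] regular_l[OF \<mu>(1)], of x]
    by (simp flip: of_real_diff add: sX_real)
  then have "(\<mu> - \<alpha>) * q (R (of_real l) x) \<le> q (x + (\<mu> - l) *\<^sub>R R (of_real l) x)"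
    using R_adapted_large[OF \<mu>(1,2) q] by metis
  also have "\<dots> \<le> q x + (\<mu> - l) * q (R (of_real l) x)"
    using tau.add[OF Q, of x "(\<mu> - l) *\<^sub>R R (of_real l) x"] \<mu> by (simp add: tau_scaleR[OF Q])
  finally show ?thesis by (simp add: algebra_simps)
qed

lemma R_adapted_power:
  assumes l: "\<alpha> < l" and q: "adapted q"
  shows "q ((l - \<alpha>) ^ k *\<^sub>R (R (of_real l) ^^ k) x) \<le> q x"
proof -
  have Q: "q \<in> Q" using q by (simp add: adapted_def)
  have "(l - \<alpha>) ^ k * q ((R (of_real l) ^^ k) x) \<le> q x"
  proof (induction k)
    case (Suc k)
    have "(l - \<alpha>) ^ Suc k * q ((R (of_real l) ^^ Suc k) x) =
        (l - \<alpha>) ^ k * ((l - \<alpha>) * q (R (of_real l) ((R (of_real l) ^^ k) x)))"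
      by simp
    also have "\<dots> \<le> (l - \<alpha>) ^ k * q ((R (of_real l) ^^ k) x)"
      using l by (intro mult_left_mono R_adapted q) auto
    finally show ?case using Suc by simp
  qed simp
  then show ?thesis using l by (simp add: tau_scaleR[OF Q])
qed

lemma scaled_power_linear:
  assumes "regular l"
  shows "Vector_Spaces.linear sX sX (\<lambda>x. c *\<^sub>R (R l ^^ k) x)"
  using funpow_linear[OF R_linear[OF assms] vsX, of k] unfolding Vector_Spaces.linear_iff
  by (simp add: X.scale_right_distrib X.scale_left_commute flip: sX_real)

lemma equicontinuous_resolvents:
  "equicontinuous_ops sX \<tau>
    {\<lambda>x. (l - \<alpha>) ^ k *\<^sub>R (R (of_real l) ^^ k) x | l (k::nat). l > \<alpha>}"
proof -
  have le: "\<exists>q\<in>Q. \<forall>l>\<alpha>. \<forall>k x. p ((l - \<alpha>) ^ k *\<^sub>R (R (of_real l) ^^ k) x) \<le> q x" if p: "p \<in> Q" for p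
  proof -
    obtain q where q: "adapted q" "\<And>x. p x \<le> q x" using adapted_above[OF p] by blast
    have "p ((l - \<alpha>) ^ k *\<^sub>R (R (of_real l) ^^ k) x) \<le> q x" if "\<alpha> < l" for l k x
      by (rule order_trans[OF q(2) R_adapted_power[OF that q(1)]])
    then show ?thesis using q(1) by (intro bexI[of _ q]) (auto simp: adapted_def)
  qed
  have "(\<lambda>x. (l - \<alpha>) ^ k *\<^sub>R (R (of_real l) ^^ k) x) \<in> continuous_operators sX \<tau>" if l: "\<alpha> < l" for l k
    by (rule continuous_operatorsI[OF vsX lc scaled_power_linear[OF regular_right_of_alpha[OF l]]])
       (use le l in blast)
  moreover have "\<exists>q. is_seminorm sX q \<and> continuous_map \<tau> euclidean q \<and>
      (\<forall>S\<in>{\<lambda>x. (l - \<alpha>) ^ k *\<^sub>R (R (of_real l) ^^ k) x | l (k::nat). l > \<alpha>}. \<forall>x. p (S x) \<le> q x)"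
    if "is_seminorm sX p \<and> continuous_map \<tau> euclidean p" for p
  proof -
    have "p \<in> Q" using that by (simp add: continuous_seminorms_def)
    then obtain q where "q \<in> Q" "\<forall>l>\<alpha>. \<forall>k x. p ((l - \<alpha>) ^ k *\<^sub>R (R (of_real l) ^^ k) x) \<le> q x"
      using le by blast
    then show ?thesis by (intro exI[of _ q]) (auto simp: continuous_seminorms_def)
  qed
  ultimately show ?thesis unfolding equicontinuous_ops_def by blast
qed

text \<open>For \<open>l\<close> between \<open>\<alpha>\<close> and \<open>\<omega>\<close> no norm
  estimate is at hand; the \<open>\<tau>\<close>-estimate provides an adjoint, and the adjoint
  provides boundedness.\<close>

lemma resolvent_set_right_of_alpha:
  assumes l: "\<alpha> < l"
  shows "of_real l \<in> resolvent_set sX D A"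
proof -
  have reg: "regular (of_real l)" by (rule regular_right_of_alpha[OF l])
  have "bounded_linear (R (of_real l))"
  proof (rule bounded_if_adjoint[OF R_linear[OF reg] adjoint_exists[OF R_linear[OF reg]]])
    fix p assume "p \<in> Q"
    then obtain q where q: "adapted q" "\<And>x. p x \<le> q x" using adapted_above by blast
    have "p (R (of_real l) x) \<le> 1 / (l - \<alpha>) * q x" for x
      using R_adapted[OF l q(1), of x] q(2)[of "R (of_real l) x"] l
      by (simp add: pos_le_divide_eq mult.commute) (meson diff_gt_0_iff_gt mult_left_mono less_imp_le order_trans)
    moreover have "(\<lambda>x. 1 / (l - \<alpha>) * q x) \<in> Q"
      using q(1) l by (intro continuous_seminorms_mult[OF vsX lc]) (auto simp: adapted_def)
    ultimately show "\<exists>q\<in>Q. \<forall>x. p (R (of_real l) x) \<le> q x"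
      by (intro bexI[of _ "\<lambda>x. 1 / (l - \<alpha>) * q x"]) auto
  qed
  then show ?thesis using reg by (simp add: resolvent_set_def regular_def)
qed

lemma resolvent_set_weak_right_of_omega:
  assumes l: "\<omega> < l"
  shows "of_real l \<in> resolvent_set_weak sX B D A"
proof -
  have reg: "regular (of_real l)" by (rule regular_l[OF l])
  have "bounded_linear (R (of_real l))"
  proof (rule bounded_linear_intro[of _ "M / (l - \<omega>)"])
    show "norm (R (of_real l) x) \<le> norm x * (M / (l - \<omega>))" for x
    proof -
      have "(l - \<omega>) * norm (R (of_real l) x) \<le> M * norm x"
        using R_norm_power[OF l, of 1 x] l unfolding norm_scaleR by simp
      then show ?thesis using l by (simp add: pos_le_divide_eq mult.commute)
    qed
    show "R (of_real l) (x + y) = R (of_real l) x + R (of_real l) y" for x y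
      by (rule linear_map_add[OF R_linear[OF reg]])
    show "R (of_real l) (r *\<^sub>R x) = r *\<^sub>R R (of_real l) x" for r x
      using linear_map_scale[OF R_linear[OF reg], of "of_real r"] by (simp add: sX_real)
  qed
  then show ?thesis
    using reg laplace_R[OF l]
    by (simp add: resolvent_set_weak_def resolvent_set_def regular_def is_laplace_transform_at_def)
qed

lemma onorm_resolvent_power:
  assumes l: "\<omega> < l"
  shows "onorm (\<lambda>x. (l - \<omega>) ^ k *\<^sub>R (R (of_real l) ^^ k) x) \<le> M"
  using M_ge_1 R_norm_power[OF l] by (intro onorm_bound) auto

end

section \<open>From the resolvent bounds to the semigroup\<close>

locale resolvent_bounds = operator_on_pair sX sY B \<tau> D A
  for sX :: "'k::{real_normed_field,euclidean_space} \<Rightarrow> 'x::banach \<Rightarrow> 'x"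
    and sY :: "'k \<Rightarrow> 'y::banach \<Rightarrow> 'y"
    and B :: "'x \<Rightarrow> 'y \<Rightarrow> 'k" and \<tau> :: "'x topology"
    and D :: "'x set" and A :: "'x \<Rightarrow> 'x" +
  fixes M \<alpha> \<omega> :: real
  assumes M_ge_1: "1 \<le> M"
    and dense: "sequentially_densely_defined \<tau> D"
    and right_of_omega: "\<And>l. \<omega> < l \<Longrightarrow> of_real l \<in> resolvent_set_weak sX B D A"
    and onorm_bound: "\<And>l k. \<omega> < l \<Longrightarrow>
      onorm (\<lambda>x. (l - \<omega>) ^ k *\<^sub>R (resolvent sX D A (of_real l) ^^ k) x) \<le> M"
    and right_of_alpha: "\<And>l. \<alpha> < l \<Longrightarrow> of_real l \<in> resolvent_set sX D A"
    and equi: "equicontinuous_ops sX \<tau>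
      {\<lambda>x. (l - \<alpha>) ^ k *\<^sub>R (resolvent sX D A (of_real l) ^^ k) x | l (k::nat). l > \<alpha>}"
begin

lemma regular_omega: "\<omega> < l \<Longrightarrow> regular (of_real l)"
  and regular_alpha: "\<alpha> < l \<Longrightarrow> regular (of_real l)"
  using right_of_omega right_of_alpha
  by (auto simp: resolvent_set_weak_def resolvent_set_def regular_def)

lemma R_power_norm:
  assumes l: "\<omega> < l"
  shows "norm ((R (of_real l) ^^ k) x) \<le> M / (l - \<omega>) ^ k * norm x"
proof -
  have bl: "bounded_linear (R (of_real l))"
    using right_of_omega[OF l] by (simp add: resolvent_set_weak_def resolvent_set_def)
  have "bounded_linear (R (of_real l) ^^ k)"
    by (induction k) (use bl bounded_linear_compose in \<open>auto simp: o_def id_def\<close>)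
  then have "norm ((l - \<omega>) ^ k *\<^sub>R (R (of_real l) ^^ k) x) \<le>
      onorm (\<lambda>x. (l - \<omega>) ^ k *\<^sub>R (R (of_real l) ^^ k) x) * norm x"
    by (intro onorm bounded_linear_scaleR_right[THEN bounded_linear_compose])
  also have "\<dots> \<le> M * norm x" by (intro mult_right_mono onorm_bound l) auto
  finally have "(l - \<omega>) ^ k * norm ((R (of_real l) ^^ k) x) \<le> M * norm x" using l by simp
  then show ?thesis using l by (simp add: field_simps)
qed

section \<open>The backward Euler step and its consistency error\<close>

text \<open>
  \<open>A0\<close> is \<open>A - \<alpha>\<close>, and \<open>F \<delta>\<close> is the backward Euler step \<open>(1 - \<delta> A0)\<^sup>-\<^sup>1\<close>.
\<close>

definition A0 :: "'x \<Rightarrow> 'x" where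
  "A0 x = A x - \<alpha> *\<^sub>R x"

definition F :: "real \<Rightarrow> 'x \<Rightarrow> 'x" where
  "F \<delta> x = (if \<delta> = 0 then x else (1 / \<delta>) *\<^sub>R R (of_real (\<alpha> + 1 / \<delta>)) x)"

lemma F_0: "F 0 x = x" by (simp add: F_def)

text \<open>\<open>1 - \<delta> A0\<close> equals
  \<open>\<delta> (\<alpha> + 1 / \<delta> - A)\<close>, which explains the factor and the point in
  \<open>F\<close>. The convention that \<open>F 0\<close> is the identity lets the later estimates
  include time 0.\<close>

lemma regular_F: "0 < \<delta> \<Longrightarrow> regular (of_real (\<alpha> + 1 / \<delta>))"
  by (rule regular_alpha) simp

lemma F_linear:
  assumes "0 \<le> \<delta>"
  shows "Vector_Spaces.linear sX sX (F \<delta>)"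
proof (cases "\<delta> = 0")
  case True
  then show ?thesis using vsX by (simp add: Vector_Spaces.linear_iff F_def)
next
  case False
  then have "regular (of_real (\<alpha> + 1 / \<delta>))" using assms by (intro regular_F) auto
  from R_linear[OF this] show ?thesis
    using False unfolding Vector_Spaces.linear_iff F_def
    by (simp add: X.scale_right_distrib X.scale_left_commute flip: sX_real)
qed

lemma F_scaleR: "0 \<le> \<delta> \<Longrightarrow> F \<delta> (r *\<^sub>R x) = r *\<^sub>R F \<delta> x"
  using linear_map_scale[OF F_linear, of \<delta> "of_real r"] by (simp add: sX_real)

lemmas F_add = linear_map_add[OF F_linear]
  and F_diff = linear_map_diff[OF F_linear]

lemma F_power_linear: "0 \<le> \<delta> \<Longrightarrow> Vector_Spaces.linear sX sX (F \<delta> ^^ k)"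
  by (intro funpow_linear F_linear vsX)

lemma A0_diff: "x \<in> D \<Longrightarrow> y \<in> D \<Longrightarrow> A0 (x - y) = A0 x - A0 y"
  and A0_scaleR: "x \<in> D \<Longrightarrow> A0 (r *\<^sub>R x) = r *\<^sub>R A0 x"
  by (simp_all add: A0_def A_diff A_scaleR algebra_simps)

lemma F_in_D: "0 < \<delta> \<Longrightarrow> F \<delta> x \<in> D"
  using R_in_D[OF regular_F] by (simp add: F_def D_scaleR)

lemma F_in_D': "0 \<le> \<delta> \<Longrightarrow> x \<in> D \<Longrightarrow> F \<delta> x \<in> D"
  using F_in_D[of \<delta> x] by (cases "\<delta> = 0") (auto simp: F_0)

lemma F_left_inverse:
  assumes "0 \<le> \<delta>" "x \<in> D"
  shows "F \<delta> (x - \<delta> *\<^sub>R A0 x) = x"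
proof (cases "\<delta> = 0")
  case False
  then have \<delta>: "0 < \<delta>" using assms by simp
  have "x - \<delta> *\<^sub>R A0 x = \<delta> *\<^sub>R (sX (of_real (\<alpha> + 1 / \<delta>)) x - A x)"
    using \<delta> unfolding sX_real by (simp add: A0_def algebra_simps)
  then have "F \<delta> (x - \<delta> *\<^sub>R A0 x) = \<delta> *\<^sub>R F \<delta> (sX (of_real (\<alpha> + 1 / \<delta>)) x - A x)"
    using assms(1) by (simp only: F_scaleR)
  also have "\<dots> = R (of_real (\<alpha> + 1 / \<delta>)) (sX (of_real (\<alpha> + 1 / \<delta>)) x - A x)"
    using \<delta> by (simp add: F_def)
  also have "\<dots> = x" by (rule R_left_inverse[OF regular_F[OF \<delta>] assms(2)])
  finally show ?thesis .
qed (simp add: F_0)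

lemma F_A0_commute:
  assumes "0 \<le> \<delta>" "x \<in> D"
  shows "A0 (F \<delta> x) = F \<delta> (A0 x)"
proof (cases "\<delta> = 0")
  case False
  then have \<delta>: "0 < \<delta>" using assms by simp
  show ?thesis
    using \<delta> R_A_commute[OF regular_F[OF \<delta>] assms(2)] R_in_D[OF regular_F[OF \<delta>]]
      F_diff[OF assms(1), of "A x" "\<alpha> *\<^sub>R x"] F_scaleR[OF assms(1), of \<alpha> x]
    by (simp add: A0_def F_def A_scaleR)
qed (simp add: F_0)

lemma F_diff_id: "0 \<le> \<delta> \<Longrightarrow> x \<in> D \<Longrightarrow> F \<delta> x - x = \<delta> *\<^sub>R F \<delta> (A0 x)"
  using F_left_inverse[of \<delta> x] by (simp add: F_diff F_scaleR algebra_simps)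

lemma F_commute:
  assumes "0 \<le> \<delta>" "0 \<le> \<epsilon>"
  shows "F \<delta> (F \<epsilon> x) = F \<epsilon> (F \<delta> x)"
proof (cases "\<delta> = 0 \<or> \<epsilon> = 0")
  case False
  then have \<delta>: "0 < \<delta>" and \<epsilon>: "0 < \<epsilon>" using assms by auto
  let ?a = "of_real (\<alpha> + 1 / \<delta>) :: 'k" and ?b = "of_real (\<alpha> + 1 / \<epsilon>) :: 'k"
  have Rs: "R ?a (r *\<^sub>R x) = r *\<^sub>R R ?a x" "R ?b (r *\<^sub>R x) = r *\<^sub>R R ?b x" for r x
    using linear_map_scale[OF R_linear[OF regular_F[OF \<delta>]], of "of_real r" x]
      linear_map_scale[OF R_linear[OF regular_F[OF \<epsilon>]], of "of_real r" x]
    unfolding sX_real .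
  show ?thesis
    using False resolvent_commute[OF regular_F[OF \<delta>] regular_F[OF \<epsilon>], of x]
    by (simp add: F_def Rs mult.commute del: of_real_add)
qed (auto simp: F_0)

lemma F_power_commute:
  assumes "0 \<le> \<delta>" "0 \<le> \<epsilon>"
  shows "(F \<delta> ^^ i) ((F \<epsilon> ^^ j) x) = (F \<epsilon> ^^ j) ((F \<delta> ^^ i) x)"
proof -
  have 1: "F \<delta> ((F \<epsilon> ^^ j) x) = (F \<epsilon> ^^ j) (F \<delta> x)" for x
    by (induction j arbitrary: x) (simp_all add: F_commute[OF assms])
  show ?thesis by (induction i arbitrary: x) (simp_all add: 1)
qed

text \<open>Equicontinuity of the resolvents in Euler form, with
  \<open>l - \<alpha> = 1 / \<delta>\<close>. The bound is uniform in the step length and in the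
  number of steps.\<close>

lemma F_power_seminorm:
  assumes p: "p \<in> Q"
  shows "\<exists>q\<in>Q. \<forall>\<delta>\<ge>0. \<forall>k x. p ((F \<delta> ^^ k) x) \<le> q x"
proof -
  obtain q where q: "q \<in> Q"
    "\<forall>S\<in>{\<lambda>x. (l - \<alpha>) ^ k *\<^sub>R (R (of_real l) ^^ k) x | l (k::nat). l > \<alpha>}. \<forall>x. p (S x) \<le> q x"
    using equi p unfolding equicontinuous_ops_def continuous_seminorms_def by blast
  have le: "p ((l - \<alpha>) ^ k *\<^sub>R (R (of_real l) ^^ k) x) \<le> q x" if "\<alpha> < l" for l k x
    using q(2)[rule_format, of "\<lambda>x. (l - \<alpha>) ^ k *\<^sub>R (R (of_real l) ^^ k) x" x] that by auto
  have "p ((F \<delta> ^^ k) x) \<le> q x" if "0 \<le> \<delta>" for \<delta> k x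
  proof (cases "\<delta> = 0")
    case True
    have "F 0 = id" by (simp add: F_def fun_eq_iff)
    \<comment> \<open>The member with \<open>k = 0\<close> is the identity, which settles the step
      length 0.\<close>
    then show ?thesis using le[of "\<alpha> + 1" 0 x] True by simp
  next
    case False
    then have \<delta>: "0 < \<delta>" using that by simp
    have "(F \<delta> ^^ k) x = (1 / \<delta>) ^ k *\<^sub>R (R (of_real (\<alpha> + 1 / \<delta>)) ^^ k) x"
    proof (induction k)
      case (Suc k)
      have eq: "(F \<delta> ^^ Suc k) x = (1 / \<delta>) ^ k *\<^sub>R F \<delta> ((R (of_real (\<alpha> + 1 / \<delta>)) ^^ k) x)"
        using Suc F_scaleR[OF that] by simp
      have F_eq: "F \<delta> y = (1 / \<delta>) *\<^sub>R R (of_real (\<alpha> + 1 / \<delta>)) y" for y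
        using \<delta> by (simp add: F_def)
      show ?case unfolding eq F_eq[of "(R (of_real (\<alpha> + 1 / \<delta>)) ^^ k) x"] by simp
    qed simp
    then show ?thesis using le[of "\<alpha> + 1 / \<delta>" k x] \<delta> by simp
  qed
  then show ?thesis using q(1) by blast
qed

text \<open>Expand \<open>(1 - \<delta> A0) (1 - \<epsilon> A0) = 1 - (\<delta> + \<epsilon>) A0 +
  \<delta> \<epsilon> A0 A0\<close>. Applied to \<open>e\<close>, the right side is
  \<open>x + \<delta> \<epsilon> A0 (A0 e)\<close>; inverting the two factors on the left gives the
  formula.\<close>

lemma F_compose_error:
  assumes \<delta>: "0 \<le> \<delta>" and \<epsilon>: "0 \<le> \<epsilon>" and x: "x \<in> D" "A0 x \<in> D"
  shows "F \<delta> (F \<epsilon> x) - F (\<delta> + \<epsilon>) x = - (\<delta> * \<epsilon>) *\<^sub>R F \<delta> (F \<epsilon> (F (\<delta> + \<epsilon>) (A0 (A0 x))))"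
proof -
  define e where "e = F (\<delta> + \<epsilon>) x"
  have \<delta>\<epsilon>: "0 \<le> \<delta> + \<epsilon>" using \<delta> \<epsilon> by simp
  have e: "e \<in> D" "A0 e = F (\<delta> + \<epsilon>) (A0 x)" "A0 e \<in> D" "A0 (A0 e) = F (\<delta> + \<epsilon>) (A0 (A0 x))"
    using F_in_D'[OF \<delta>\<epsilon>] F_A0_commute[OF \<delta>\<epsilon>] x by (auto simp: e_def)
  define w where "w = e - \<delta> *\<^sub>R A0 e"
  have w: "w \<in> D" using e by (simp add: w_def D_diff D_scaleR)
  have "e = F \<delta> w" using F_left_inverse[OF \<delta> e(1)] by (simp add: w_def)
  also have "w = F \<epsilon> (w - \<epsilon> *\<^sub>R A0 w)" using F_left_inverse[OF \<epsilon> w] by simp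
  also have "w - \<epsilon> *\<^sub>R A0 w = (e - (\<delta> + \<epsilon>) *\<^sub>R A0 e) + (\<delta> * \<epsilon>) *\<^sub>R A0 (A0 e)"
    using e by (simp add: w_def A0_diff A0_scaleR D_scaleR algebra_simps)
  also have "e - (\<delta> + \<epsilon>) *\<^sub>R A0 e = x"
    using F_diff_id[OF \<delta>\<epsilon> x(1)] by (simp add: e_def[symmetric] e(2)) (metis add_diff_cancel_left' diff_add_cancel diff_diff_eq2)
  finally have "e = F \<delta> (F \<epsilon> x) + (\<delta> * \<epsilon>) *\<^sub>R F \<delta> (F \<epsilon> (A0 (A0 e)))"
    by (simp add: F_add F_scaleR \<delta> \<epsilon>)
  then show ?thesis by (simp add: e_def[symmetric] e(4)[symmetric] algebra_simps)
qed

text \<open>The difference of powers is a sum of terms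
  \<open>(S ^^ i) ((E ^^ j) (S x - E x))\<close>. As \<open>p\<close> is not assumed to be
  contracted by \<open>S\<close>, these terms are bounded as a whole, and the induction carries an
  extra power of \<open>S\<close>.\<close>

lemma telescope:
  fixes N :: nat and c :: real
  assumes p: "p \<in> Q" and lin: "Vector_Spaces.linear sX sX S"
    and comm: "\<And>x. S (E x) = E (S x)"
    and le: "\<And>i j. p ((S ^^ i) ((E ^^ j) (S x - E x))) \<le> c"
    and linE: "Vector_Spaces.linear sX sX E"
  shows "p ((S ^^ N) x - (E ^^ N) x) \<le> N * c"
proof -
  have comm_pow: "S ((E ^^ n) x) = (E ^^ n) (S x)" for n x
    by (induction n) (simp_all add: comm)
  have "p ((S ^^ i) ((S ^^ N) x - (E ^^ N) x)) \<le> N * c" for i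
  proof (induction N arbitrary: i)
    case 0
    then show ?case using linear_map_zero[OF funpow_linear[OF lin vsX]] tau.zero[OF p] by simp
  next
    case (Suc n)
    have "(S ^^ Suc n) x - (E ^^ Suc n) x = S ((S ^^ n) x - (E ^^ n) x) + (S ((E ^^ n) x) - (E ^^ n) (E x))"
      using linear_map_diff[OF lin] by (simp add: funpow_swap1)
    also have "S ((E ^^ n) x) - (E ^^ n) (E x) = (E ^^ n) (S x - E x)"
      by (simp add: comm_pow linear_map_diff[OF funpow_linear[OF linE vsX]])
    finally have "(S ^^ i) ((S ^^ Suc n) x - (E ^^ Suc n) x) =
        (S ^^ Suc i) ((S ^^ n) x - (E ^^ n) x) + (S ^^ i) ((E ^^ n) (S x - E x))"
      by (simp add: linear_map_add[OF funpow_linear[OF lin vsX]] funpow_swap1)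
    then have "p ((S ^^ i) ((S ^^ Suc n) x - (E ^^ Suc n) x)) \<le>
        p ((S ^^ Suc i) ((S ^^ n) x - (E ^^ n) x)) + p ((S ^^ i) ((E ^^ n) (S x - E x)))"
      using tau.add[OF p] by metis
    also have "\<dots> \<le> n * c + c" by (intro add_mono Suc.IH le)
    finally show ?case by (simp add: algebra_simps)
  qed
  from this[of 0] show ?thesis by simp
qed

lemma F_compose_power:
  assumes "0 \<le> \<delta>" "0 \<le> \<epsilon>"
  shows "((\<lambda>x. F \<delta> (F \<epsilon> x)) ^^ n) x = (F \<delta> ^^ n) ((F \<epsilon> ^^ n) x)"
proof (induction n)
  case (Suc n)
  then show ?case
    using F_power_commute[OF assms(2,1), of 1 n] by simp
qed simp

text \<open>Each passage to a larger seminorm absorbs the powers of one of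
  \<open>F \<delta>\<close>, \<open>F \<epsilon>\<close>, \<open>F (\<delta> + \<epsilon>)\<close>,
  so \<open>q\<close> depends on \<open>p\<close> alone. For steps proportional to
  \<open>1 / N\<close> the bound is of order \<open>1 / N\<close>.\<close>

lemma F_consistency:
  assumes p: "p \<in> Q"
  shows "\<exists>q\<in>Q. \<forall>\<delta>\<ge>0. \<forall>\<epsilon>\<ge>0. \<forall>N. \<forall>x\<in>D. A0 x \<in> D \<longrightarrow>
    p ((F \<delta> ^^ N) ((F \<epsilon> ^^ N) x) - (F (\<delta> + \<epsilon>) ^^ N) x) \<le> N * (\<delta> * \<epsilon> * q (A0 (A0 x)))"
proof -
  obtain q1 where q1: "q1 \<in> Q" "\<And>\<delta> k x. 0 \<le> \<delta> \<Longrightarrow> p ((F \<delta> ^^ k) x) \<le> q1 x"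
    using F_power_seminorm[OF p] by blast
  obtain q2 where q2: "q2 \<in> Q" "\<And>\<delta> k x. 0 \<le> \<delta> \<Longrightarrow> q1 ((F \<delta> ^^ k) x) \<le> q2 x"
    using F_power_seminorm[OF q1(1)] by blast
  obtain q3 where q3: "q3 \<in> Q" "\<And>\<delta> k x. 0 \<le> \<delta> \<Longrightarrow> q2 ((F \<delta> ^^ k) x) \<le> q3 x"
    using F_power_seminorm[OF q2(1)] by blast
  have "p ((F \<delta> ^^ N) ((F \<epsilon> ^^ N) x) - (F (\<delta> + \<epsilon>) ^^ N) x) \<le> N * (\<delta> * \<epsilon> * q3 (A0 (A0 x)))"
    if \<delta>: "0 \<le> \<delta>" and \<epsilon>: "0 \<le> \<epsilon>" and x: "x \<in> D" "A0 x \<in> D" for \<delta> \<epsilon> N x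
  proof -
    have \<delta>\<epsilon>: "0 \<le> \<delta> + \<epsilon>" using \<delta> \<epsilon> by simp
    have lin: "Vector_Spaces.linear sX sX (\<lambda>x. F \<delta> (F \<epsilon> x))"
      using Vector_Spaces.linear_compose[OF F_linear[OF \<epsilon>] F_linear[OF \<delta>]] by (simp add: o_def)
    have "p (((\<lambda>x. F \<delta> (F \<epsilon> x)) ^^ N) x - (F (\<delta> + \<epsilon>) ^^ N) x) \<le> N * (\<delta> * \<epsilon> * q3 (A0 (A0 x)))"
    proof (rule telescope[OF p lin _ _ F_linear[OF \<delta>\<epsilon>]])
      show "F \<delta> (F \<epsilon> (F (\<delta> + \<epsilon>) x)) = F (\<delta> + \<epsilon>) (F \<delta> (F \<epsilon> x))" for x
        using F_commute[OF \<delta> \<delta>\<epsilon>] F_commute[OF \<epsilon> \<delta>\<epsilon>] by simp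
    next
      fix i j
      define z where "z = A0 (A0 x)"
      define w where "w = (F (\<delta> + \<epsilon>) ^^ Suc j) z"
      have "(F (\<delta> + \<epsilon>) ^^ j) (F \<delta> (F \<epsilon> x) - F (\<delta> + \<epsilon>) x) =
          - (\<delta> * \<epsilon>) *\<^sub>R (F (\<delta> + \<epsilon>) ^^ j) (F \<delta> (F \<epsilon> (F (\<delta> + \<epsilon>) z)))"
        using linear_map_scale[OF F_power_linear[OF \<delta>\<epsilon>], of j "of_real (- (\<delta> * \<epsilon>))"]
        unfolding sX_real F_compose_error[OF \<delta> \<epsilon> x] z_def .
      also have "(F (\<delta> + \<epsilon>) ^^ j) (F \<delta> (F \<epsilon> (F (\<delta> + \<epsilon>) z))) = F \<delta> (F \<epsilon> w)"
        using F_power_commute[OF \<delta>\<epsilon> \<delta>, of j 1] F_power_commute[OF \<delta>\<epsilon> \<epsilon>, of j 1]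
        by (simp add: w_def funpow_swap1)
      finally have error: "(F (\<delta> + \<epsilon>) ^^ j) (F \<delta> (F \<epsilon> x) - F (\<delta> + \<epsilon>) x) =
          - (\<delta> * \<epsilon>) *\<^sub>R F \<delta> (F \<epsilon> w)" .
      have "((\<lambda>x. F \<delta> (F \<epsilon> x)) ^^ i) (- (\<delta> * \<epsilon>) *\<^sub>R F \<delta> (F \<epsilon> w)) =
          - (\<delta> * \<epsilon>) *\<^sub>R ((\<lambda>x. F \<delta> (F \<epsilon> x)) ^^ Suc i) w"
        using linear_map_scale[OF funpow_linear[OF lin vsX], of i "of_real (- (\<delta> * \<epsilon>))"]
          funpow_swap1[of "\<lambda>x. F \<delta> (F \<epsilon> x)" i w]
        unfolding sX_real by simp
      then have "((\<lambda>x. F \<delta> (F \<epsilon> x)) ^^ i) ((F (\<delta> + \<epsilon>) ^^ j) (F \<delta> (F \<epsilon> x) - F (\<delta> + \<epsilon>) x)) =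
          - (\<delta> * \<epsilon>) *\<^sub>R (F \<delta> ^^ Suc i) ((F \<epsilon> ^^ Suc i) w)"
        unfolding error F_compose_power[OF \<delta> \<epsilon>, of "Suc i"] .
      then have "p (((\<lambda>x. F \<delta> (F \<epsilon> x)) ^^ i) ((F (\<delta> + \<epsilon>) ^^ j) (F \<delta> (F \<epsilon> x) - F (\<delta> + \<epsilon>) x))) =
          \<delta> * \<epsilon> * p ((F \<delta> ^^ Suc i) ((F \<epsilon> ^^ Suc i) w))"
        using \<delta> \<epsilon> by (simp only: tau_scaleR[OF p]) simp
      also have "\<dots> \<le> \<delta> * \<epsilon> * q3 z"
      proof (rule mult_left_mono)
        show "p ((F \<delta> ^^ Suc i) ((F \<epsilon> ^^ Suc i) w)) \<le> q3 z"
          unfolding w_def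
          by (rule order_trans[OF q1(2)[OF \<delta>] order_trans[OF q2(2)[OF \<epsilon>] q3(2)[OF \<delta>\<epsilon>]]])
      qed (use \<delta> \<epsilon> in simp)
      finally show "p (((\<lambda>x. F \<delta> (F \<epsilon> x)) ^^ i) ((F (\<delta> + \<epsilon>) ^^ j) (F \<delta> (F \<epsilon> x) - F (\<delta> + \<epsilon>) x))) \<le>
          \<delta> * \<epsilon> * q3 (A0 (A0 x))" by (simp only: z_def)
    qed
    then show ?thesis unfolding F_compose_power[OF \<delta> \<epsilon>] .
  qed
  then show ?thesis using q3(1) by blast
qed

lemma D_dense:
  assumes p: "p \<in> Q" and e: "0 < e"
  shows "\<exists>x'\<in>D. p (x - x') < e"
proof -
  obtain u where u: "\<forall>n. u n \<in> D" "limitin \<tau> u x sequentially"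
    using dense unfolding sequentially_densely_defined_def by blast
  have "(\<lambda>n. p (u n - x)) \<longlonglongrightarrow> 0"
    using u(2) p by (simp add: limitin_locally_convex_iff[OF vsX lc])
  then have "\<forall>\<^sub>F n in sequentially. p (u n - x) < e" using e by (rule order_tendstoD)
  then obtain n where "p (u n - x) < e" by (auto simp: eventually_sequentially)
  then show ?thesis using u(1) tau.minus_commute[OF p, of x "u n"] by (intro bexI[of _ "u n"]) auto
qed

text \<open>On \<open>D\<close> each step moves the iterate by \<open>\<delta>\<close> times a
  bounded vector; density extends this to all \<open>z\<close>. Uniformity over all step lengths
  with the same total time is what survives the limit of the scheme.\<close>

lemma F_power_near_id:
  assumes p: "p \<in> Q" and e: "0 < e"
  shows "\<exists>h>0. \<forall>\<delta>\<ge>0. \<forall>j. real j * \<delta> \<le> h \<longrightarrow> p ((F \<delta> ^^ j) z - z) \<le> e"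
proof -
  obtain q where q: "q \<in> Q" "\<And>\<delta> k x. 0 \<le> \<delta> \<Longrightarrow> p ((F \<delta> ^^ k) x) \<le> q x"
    using F_power_seminorm[OF p] by blast
  obtain x where x: "x \<in> D" "q (z - x) + p (z - x) < e / 2"
    using D_dense[OF continuous_seminorms_add[OF vsX lc q(1) p], of "e / 2" z] e by auto
  have x_near: "p ((F \<delta> ^^ j) x - x) \<le> j * \<delta> * q (A0 x)" if \<delta>: "0 \<le> \<delta>" for \<delta> j
  proof (induction j)
    case (Suc j)
    have "(F \<delta> ^^ Suc j) x - x = (F \<delta> ^^ j) (F \<delta> x - x) + ((F \<delta> ^^ j) x - x)"
      by (simp add: linear_map_diff[OF F_power_linear[OF \<delta>]] funpow_swap1)
    moreover have "(F \<delta> ^^ j) (F \<delta> x - x) = \<delta> *\<^sub>R (F \<delta> ^^ Suc j) (A0 x)"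
      using linear_map_scale[OF F_power_linear[OF \<delta>], of j "of_real \<delta>"]
      unfolding F_diff_id[OF \<delta> x(1)] sX_real by (simp add: funpow_swap1)
    ultimately have "p ((F \<delta> ^^ Suc j) x - x) \<le> p (\<delta> *\<^sub>R (F \<delta> ^^ Suc j) (A0 x)) + p ((F \<delta> ^^ j) x - x)"
      using tau.add[OF p] by metis
    also have "\<dots> \<le> \<delta> * q (A0 x) + j * \<delta> * q (A0 x)"
    proof (intro add_mono Suc)
      show "p (\<delta> *\<^sub>R (F \<delta> ^^ Suc j) (A0 x)) \<le> \<delta> * q (A0 x)"
        unfolding tau_scaleR[OF p] using q(2)[OF \<delta>, of "Suc j" "A0 x"] \<delta> by (simp add: mult_left_mono)
    qed
    finally show ?case by (simp add: algebra_simps)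
  qed (simp add: tau.zero[OF p])
  \<comment> \<open>Ensures \<open>h * q (A0 x) \<le> e / 2\<close>; the summand 1 covers
    \<open>q (A0 x) = 0\<close>.\<close>
  define h where "h = e / (2 * (q (A0 x) + 1))"
  have q0: "0 \<le> q (A0 x)" by (rule tau.nonneg[OF q(1)])
  have h: "0 < h" "h * q (A0 x) \<le> e / 2" using e q0 by (auto simp: h_def field_simps)
  have "p ((F \<delta> ^^ j) z - z) \<le> e" if \<delta>: "0 \<le> \<delta>" and j: "real j * \<delta> \<le> h" for \<delta> j
  proof -
    have eq: "(F \<delta> ^^ j) z - z = (F \<delta> ^^ j) (z - x) + (((F \<delta> ^^ j) x - x) - (z - x))"
      by (simp add: linear_map_diff[OF F_power_linear[OF \<delta>]])
    have "p ((F \<delta> ^^ j) z - z) \<le> p ((F \<delta> ^^ j) (z - x)) + (p ((F \<delta> ^^ j) x - x) + p (z - x))"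
      unfolding eq
      using tau.add[OF p, of "(F \<delta> ^^ j) (z - x)" "((F \<delta> ^^ j) x - x) - (z - x)"]
        tau.diff[OF p, of "(F \<delta> ^^ j) x - x" "z - x"] by linarith
    moreover have "p ((F \<delta> ^^ j) x - x) \<le> h * q (A0 x)"
      using x_near[OF \<delta>, of j] mult_right_mono[OF j q0] by linarith
    ultimately show ?thesis using q(2)[OF \<delta>, of j "z - x"] x(2) h(2) by linarith
  qed
  then show ?thesis using h(1) by blast
qed

text \<open>An Euler step commutes with \<open>A0\<close> on \<open>D\<close>, so it maps
  \<open>D\<close> into the domain of the square, and a short step moves \<open>z\<close>
  little.\<close>

lemma D2_dense:
  assumes p: "p \<in> Q" and e: "0 < e"
  shows "\<exists>x'\<in>D. A0 x' \<in> D \<and> p (x - x') < e"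
proof -
  obtain z where z: "z \<in> D" "p (x - z) < e / 2" using D_dense[OF p, of "e / 2"] e by auto
  obtain h where h: "0 < h" "\<And>\<delta> j. 0 \<le> \<delta> \<Longrightarrow> real j * \<delta> \<le> h \<Longrightarrow> p ((F \<delta> ^^ j) z - z) \<le> e / 2"
    using F_power_near_id[OF p, of "e / 2" z] e by auto
  have "p (F h z - z) \<le> e / 2" using h(2)[of h 1] h(1) by simp
  then have "p (x - F h z) < e"
    using tau.triangle[OF p, of x "F h z" z] tau.minus_commute[OF p, of z "F h z"] z(2) by linarith
  moreover have "F h z \<in> D" "A0 (F h z) \<in> D"
    using h(1) z(1) F_in_D F_A0_commute by auto
  ultimately show ?thesis by blast
qed

section \<open>The limit of the Euler scheme and its semigroup law\<close>

definition J :: "nat \<Rightarrow> real \<Rightarrow> 'x \<Rightarrow> 'x" where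
  "J n t = F (t / 2 ^ n) ^^ (2 ^ n)"

lemma J_linear: "0 \<le> t \<Longrightarrow> Vector_Spaces.linear sX sX (J n t)"
  unfolding J_def by (rule F_power_linear) simp

lemma J_seminorm:
  assumes "p \<in> Q"
  shows "\<exists>q\<in>Q. \<forall>n. \<forall>t\<ge>0. \<forall>x. p (J n t x) \<le> q x"
proof -
  obtain q where "q \<in> Q" "\<forall>\<delta>\<ge>0. \<forall>k x. p ((F \<delta> ^^ k) x) \<le> q x"
    using F_power_seminorm[OF assms] by blast
  then show ?thesis unfolding J_def by (intro bexI[of _ q]) auto
qed

text \<open>Each of the \<open>2 ^ n\<close> steps is halved, which is \<open>F_consistency\<close>
  with two equal steps; the total error \<open>2 ^ n * (t / 2 ^ Suc n)\<^sup>2\<close> is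
  \<open>t\<^sup>2 / 4\<close> times \<open>(1 / 2) ^ n\<close>.\<close>

lemma J_increment:
  assumes p: "p \<in> Q" and t: "0 \<le> t" and x: "x \<in> D" "A0 x \<in> D"
  shows "\<exists>C. \<forall>n. p (J (Suc n) t x - J n t x) \<le> C * (1 / 2) ^ n"
proof -
  obtain q where q: "\<And>\<delta> \<epsilon> N. 0 \<le> \<delta> \<Longrightarrow> 0 \<le> \<epsilon> \<Longrightarrow>
      p ((F \<delta> ^^ N) ((F \<epsilon> ^^ N) x) - (F (\<delta> + \<epsilon>) ^^ N) x) \<le> N * (\<delta> * \<epsilon> * q (A0 (A0 x)))"
    using F_consistency[OF p] x by blast
  have "p (J (Suc n) t x - J n t x) \<le> t\<^sup>2 / 4 * q (A0 (A0 x)) * (1 / 2) ^ n" for n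
  proof -
    define \<delta> where "\<delta> = t / 2 ^ Suc n"
    have \<delta>: "0 \<le> \<delta>" "\<delta> + \<delta> = t / 2 ^ n" using t by (auto simp: \<delta>_def)
    have pow: "(2::nat) ^ Suc n = 2 ^ n + 2 ^ n" by simp
    have "J (Suc n) t x = (F \<delta> ^^ (2 ^ n)) ((F \<delta> ^^ (2 ^ n)) x)"
      unfolding J_def \<delta>_def pow funpow_add o_apply ..
    then have "p (J (Suc n) t x - J n t x) \<le> (2 ^ n :: nat) * (\<delta> * \<delta> * q (A0 (A0 x)))"
      using q[OF \<delta>(1) \<delta>(1), of "2 ^ n"] by (simp add: J_def \<delta>(2))
    also have "\<dots> = t\<^sup>2 / 4 * q (A0 (A0 x)) * (1 / 2) ^ n"
      by (simp add: \<delta>_def power2_eq_square power_divide)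
    finally show ?thesis .
  qed
  then show ?thesis by blast
qed

lemma J_Cauchy:
  assumes p: "p \<in> Q" and t: "0 \<le> t" and e: "0 < e"
  shows "\<exists>N. \<forall>m\<ge>N. \<forall>n\<ge>N. p (J m t x - J n t x) < e"
proof -
  obtain q where q: "q \<in> Q" "\<And>n t x. 0 \<le> t \<Longrightarrow> p (J n t x) \<le> q x"
    using J_seminorm[OF p] by blast
  obtain x' where x': "x' \<in> D" "A0 x' \<in> D" "q (x - x') < e / 4"
    using D2_dense[OF q(1), of "e / 4"] e by auto
  obtain C where "\<And>n. p (J (Suc n) t x' - J n t x') \<le> C * (1 / 2) ^ n"
    using J_increment[OF p t x'(1,2)] by blast
  then obtain N where N: "\<And>m n. N \<le> m \<Longrightarrow> N \<le> n \<Longrightarrow> p (J m t x' - J n t x') < e / 2"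
    using tau.geometric_increments_Cauchy[OF p, of "\<lambda>n. J n t x'" C "1 / 2" "e / 2"] e by auto
  have "p (J m t x - J n t x) < e" if "N \<le> m" "N \<le> n" for m n
  proof -
    have eq: "J m t x - J n t x = (J m t (x - x') - J n t (x - x')) + (J m t x' - J n t x')"
      by (simp add: linear_map_diff[OF J_linear[OF t]])
    show ?thesis
      unfolding eq
      using tau.add[OF p, of "J m t (x - x') - J n t (x - x')" "J m t x' - J n t x'"]
        tau.diff[OF p, of "J m t (x - x')" "J n t (x - x')"] q(2)[OF t, of m "x - x'"]
        q(2)[OF t, of n "x - x'"] N[OF that] x'(3) by linarith
  qed
  then show ?thesis by (intro exI[of _ N]) simp
qed

definition S :: "real \<Rightarrow> 'x \<Rightarrow> 'x" where
  "S t x = (SOME z. tau.converges_to (\<lambda>n. J n t x) z)"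

lemma J_converges: "0 \<le> t \<Longrightarrow> tau.converges_to (\<lambda>n. J n t x) (S t x)"
proof -
  assume t: "0 \<le> t"
  have "\<exists>z. \<forall>q\<in>Q. (\<lambda>n. q (J n t x - z)) \<longlonglongrightarrow> 0"
    by (rule tau.complete) (rule J_Cauchy[OF _ t])
  then have "\<exists>z. tau.converges_to (\<lambda>n. J n t x) z" by (simp add: tau.converges_to_def)
  then show ?thesis unfolding S_def by (rule someI_ex)
qed

lemma S_le_of_J:
  assumes p: "p \<in> Q" and t: "0 \<le> t" and le: "\<And>n. p (J n t x - y) \<le> c"
  shows "p (S t x - y) \<le> c"
proof -
  have "(\<lambda>n. p (J n t x - y)) \<longlonglongrightarrow> p (S t x - y)"
    by (rule tau.converges_to_seminorm[OF tau.converges_to_diff[OF J_converges[OF t] tau.converges_to_const] p])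
  then show ?thesis using le by (intro LIMSEQ_le_const2) auto
qed

lemma S_linear: "0 \<le> t \<Longrightarrow> Vector_Spaces.linear sX sX (S t)"
  unfolding Vector_Spaces.linear_iff
proof (intro conjI allI vsX)
  assume t: "0 \<le> t"
  note J = J_converges[OF t]
  show "S t (x + y) = S t x + S t y" for x y
    using tau.converges_to_add[OF J J, of x y] J[of "x + y"] tau.converges_to_unique
    by (simp add: linear_map_add[OF J_linear[OF t]])
  show "S t (sX c x) = sX c (S t x)" for c x
    using tau.converges_to_scale[OF J, of c x] J[of "sX c x"] tau.converges_to_unique
    by (simp add: linear_map_scale[OF J_linear[OF t]])
qed

lemma S_0: "S 0 x = x"
proof -
  have "F 0 = id" by (simp add: fun_eq_iff F_0)
  then have "(\<lambda>n. J n 0 x) = (\<lambda>n. x)" by (simp add: J_def)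
  then show ?thesis
    using J_converges[of 0 x] tau.converges_to_const[of x] tau.converges_to_unique by simp
qed

lemma S_seminorm:
  assumes "p \<in> Q"
  shows "\<exists>q\<in>Q. \<forall>t\<ge>0. \<forall>x. p (S t x) \<le> q x"
proof -
  obtain q where q: "q \<in> Q" "\<And>n t x. 0 \<le> t \<Longrightarrow> p (J n t x) \<le> q x"
    using J_seminorm[OF assms] by blast
  have "p (S t x) \<le> q x" if "0 \<le> t" for t x
    using S_le_of_J[OF assms that, of x 0] q(2)[OF that] by simp
  then show ?thesis using q(1) by blast
qed

text \<open>The times \<open>t\<close>, \<open>r\<close> and \<open>t + r\<close> are all divided
  into \<open>2 ^ n\<close> steps, so \<open>F_consistency\<close> compares
  \<open>J n t (J n r x)\<close> with \<open>J n (t + r) x\<close>, up to a multiple of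
  \<open>t * r / 2 ^ n\<close>. Density then frees \<open>x\<close> from the domain of the
  square.\<close>

lemma S_add:
  assumes t: "0 \<le> t" and r: "0 \<le> r"
  shows "S (t + r) x = S t (S r x)"
proof -
  have tr: "0 \<le> t + r" using t r by simp
  have on_D2: "S (t + r) x = S t (S r x)" if x: "x \<in> D" "A0 x \<in> D" for x
  proof (rule tau.converges_to_unique)
    show "tau.converges_to (\<lambda>n. J n t (S r x)) (S t (S r x))" by (rule J_converges[OF t])
    have 1: "tau.converges_to (\<lambda>n. J n t (J n r x) - J n (t + r) x) 0"
    proof (rule tau.converges_toI_bound)
      fix p assume p: "p \<in> Q"
      obtain q where q: "\<And>\<delta> \<epsilon> N. 0 \<le> \<delta> \<Longrightarrow> 0 \<le> \<epsilon> \<Longrightarrow>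
          p ((F \<delta> ^^ N) ((F \<epsilon> ^^ N) x) - (F (\<delta> + \<epsilon>) ^^ N) x) \<le> N * (\<delta> * \<epsilon> * q (A0 (A0 x)))"
        using F_consistency[OF p] x by blast
      have "p (J n t (J n r x) - J n (t + r) x) \<le> t * r * q (A0 (A0 x)) * (1 / 2) ^ n" for n
      proof -
        have "real (2 ^ n) * (t / 2 ^ n * (r / 2 ^ n) * q (A0 (A0 x))) = t * r * q (A0 (A0 x)) * (1 / 2) ^ n"
          by (simp add: power_divide)
        then show ?thesis
          using q[of "t / 2 ^ n" "r / 2 ^ n" "2 ^ n"] t r by (simp add: J_def add_divide_distrib)
      qed
      moreover have "(\<lambda>n. t * r * q (A0 (A0 x)) * (1 / 2) ^ n) \<longlonglongrightarrow> t * r * q (A0 (A0 x)) * 0"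
        by (intro tendsto_intros LIMSEQ_realpow_zero) auto
      ultimately show "\<exists>f. (\<forall>n. p (J n t (J n r x) - J n (t + r) x - 0) \<le> f n) \<and> f \<longlonglongrightarrow> 0"
        by (intro exI[of _ "\<lambda>n. t * r * q (A0 (A0 x)) * (1 / 2) ^ n"]) simp
    qed
    \<comment> \<open>The bound on \<open>J n t\<close> is uniform in \<open>n\<close>, so the inner
      approximation may be replaced by its limit.\<close>
    have 2: "tau.converges_to (\<lambda>n. J n t (S r x - J n r x)) 0"
    proof (rule tau.converges_toI_bound)
      fix p assume p: "p \<in> Q"
      obtain q where q: "q \<in> Q" "\<And>n t x. 0 \<le> t \<Longrightarrow> p (J n t x) \<le> q x"
        using J_seminorm[OF p] by blast
      have "(\<lambda>n. q (J n r x - S r x)) \<longlonglongrightarrow> 0"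
        by (rule tau.converges_toD[OF J_converges[OF r] q(1)])
      moreover have "p (J n t (S r x - J n r x) - 0) \<le> q (J n r x - S r x)" for n
        using q(2)[OF t, of n "S r x - J n r x"] tau.minus_commute[OF q(1), of "S r x" "J n r x"] by simp
      ultimately show "\<exists>f. (\<forall>n. p (J n t (S r x - J n r x) - 0) \<le> f n) \<and> f \<longlonglongrightarrow> 0"
        by (intro exI[of _ "\<lambda>n. q (J n r x - S r x)"]) simp
    qed
    have "(\<lambda>n. J n t (S r x)) =
        (\<lambda>n. J n t (S r x - J n r x) + ((J n t (J n r x) - J n (t + r) x) + J n (t + r) x))"
      by (simp add: fun_eq_iff linear_map_diff[OF J_linear[OF t]])
    moreover have "tau.converges_to
        (\<lambda>n. J n t (S r x - J n r x) + ((J n t (J n r x) - J n (t + r) x) + J n (t + r) x))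
        (0 + (0 + S (t + r) x))"
      by (intro tau.converges_to_add 1 2 J_converges[OF tr])
    ultimately show "tau.converges_to (\<lambda>n. J n t (S r x)) (S (t + r) x)" by simp
  qed
  have "p (S (t + r) x - S t (S r x)) \<le> 0" if p: "p \<in> Q" for p
  proof (rule field_le_epsilon)
    fix e :: real assume e: "0 < e"
    obtain q1 where q1: "q1 \<in> Q" "\<And>t x. 0 \<le> t \<Longrightarrow> p (S t x) \<le> q1 x"
      using S_seminorm[OF p] by blast
    obtain q2 where q2: "q2 \<in> Q" "\<And>t x. 0 \<le> t \<Longrightarrow> q1 (S t x) \<le> q2 x"
      using S_seminorm[OF q1(1)] by blast
    obtain x' where x': "x' \<in> D" "A0 x' \<in> D" "q1 (x - x') + q2 (x - x') < e"
      using D2_dense[OF continuous_seminorms_add[OF vsX lc q1(1) q2(1)] e] by auto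
    have "S (t + r) x - S t (S r x) = S (t + r) (x - x') - S t (S r (x - x'))"
      using on_D2[OF x'(1,2)] t r
      by (simp add: linear_map_diff[OF S_linear] )
    then have "p (S (t + r) x - S t (S r x)) \<le> p (S (t + r) (x - x')) + p (S t (S r (x - x')))"
      using tau.diff[OF p] by metis
    also have "\<dots> \<le> q1 (x - x') + q2 (x - x')"
      using q1(2)[OF tr, of "x - x'"] q1(2)[OF t, of "S r (x - x')"] q2(2)[OF r, of "x - x'"]
      by linarith
    finally show "p (S (t + r) x - S t (S r x)) \<le> 0 + e" using x'(3) by simp
  qed
  then have "S (t + r) x - S t (S r x) = 0"
    by (intro tau.separated antisym tau.nonneg) auto
  then show ?thesis by simp
qed

lemma S_near_id:
  assumes p: "p \<in> Q" and e: "0 < e"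
  shows "\<exists>h0>0. \<forall>h. 0 \<le> h \<longrightarrow> h \<le> h0 \<longrightarrow> p (S h z - z) \<le> e"
proof -
  obtain h0 where h0: "0 < h0" "\<And>\<delta> j. 0 \<le> \<delta> \<Longrightarrow> real j * \<delta> \<le> h0 \<Longrightarrow> p ((F \<delta> ^^ j) z - z) \<le> e"
    using F_power_near_id[OF p e] by blast
  have "p (S h z - z) \<le> e" if "0 \<le> h" "h \<le> h0" for h
    by (rule S_le_of_J[OF p that(1)]) (use that in \<open>auto simp: J_def intro!: h0(2)\<close>)
  then show ?thesis using h0(1) by blast
qed

text \<open>\<open>S h x - x\<close> should be the integral of \<open>S t (A0 x)\<close> over
  \<open>[0, h]\<close>. The discrete counterpart, \<open>\<delta>\<close> times the sum of the
  Euler iterates of \<open>A0 x\<close>, has an error bound independent of \<open>n\<close>.\<close>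

lemma S_derivative_bound:
  assumes p: "p \<in> Q" and e: "0 < e" and x: "x \<in> D"
  shows "\<exists>h0>0. \<forall>h. 0 \<le> h \<longrightarrow> h \<le> h0 \<longrightarrow> p (S h x - x - h *\<^sub>R A0 x) \<le> h * e"
proof -
  obtain h0 where h0: "0 < h0"
    "\<And>\<delta> j. 0 \<le> \<delta> \<Longrightarrow> real j * \<delta> \<le> h0 \<Longrightarrow> p ((F \<delta> ^^ j) (A0 x) - A0 x) \<le> e"
    using F_power_near_id[OF p e] by blast
  have step: "p ((F \<delta> ^^ N) x - x - (N * \<delta>) *\<^sub>R A0 x) \<le> N * \<delta> * e"
    if \<delta>: "0 \<le> \<delta>" and N: "N * \<delta> \<le> h0" for \<delta> :: real and N :: nat
    using N
  proof (induction N)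
    case (Suc N)
    have le: "real N * \<delta> \<le> real (Suc N) * \<delta>" using \<delta> by (intro mult_right_mono) auto
    have eq: "(F \<delta> ^^ Suc N) x - x - (Suc N * \<delta>) *\<^sub>R A0 x =
        ((F \<delta> ^^ N) x - x - (N * \<delta>) *\<^sub>R A0 x) + \<delta> *\<^sub>R ((F \<delta> ^^ Suc N) (A0 x) - A0 x)"
    proof -
      have "(F \<delta> ^^ Suc N) x - (F \<delta> ^^ N) x = (F \<delta> ^^ N) (F \<delta> x - x)"
        by (simp add: linear_map_diff[OF F_power_linear[OF \<delta>]] funpow_swap1)
      also have "\<dots> = \<delta> *\<^sub>R (F \<delta> ^^ Suc N) (A0 x)"
        using linear_map_scale[OF F_power_linear[OF \<delta>], of N "of_real \<delta>"]
        unfolding F_diff_id[OF \<delta> x] sX_real by (simp add: funpow_swap1)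
      finally show ?thesis by (simp add: algebra_simps)
    qed
    have "p ((F \<delta> ^^ Suc N) x - x - (Suc N * \<delta>) *\<^sub>R A0 x) \<le>
        p ((F \<delta> ^^ N) x - x - (N * \<delta>) *\<^sub>R A0 x) + \<delta> * p ((F \<delta> ^^ Suc N) (A0 x) - A0 x)"
      unfolding eq
      using tau.add[OF p, of "(F \<delta> ^^ N) x - x - (N * \<delta>) *\<^sub>R A0 x" "\<delta> *\<^sub>R ((F \<delta> ^^ Suc N) (A0 x) - A0 x)"] \<delta>
      by (simp only: tau_scaleR[OF p] abs_of_nonneg)
    also have "\<dots> \<le> N * \<delta> * e + \<delta> * e"
      using Suc le \<delta> h0(2)[OF \<delta> Suc.prems] by (intro add_mono mult_left_mono) auto
    finally show ?case by (simp add: algebra_simps)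
  qed (simp add: tau.zero[OF p])
  have "p (S h x - x - h *\<^sub>R A0 x) \<le> h * e" if h: "0 \<le> h" "h \<le> h0" for h
  proof -
    have "p (S h x - (x + h *\<^sub>R A0 x)) \<le> h * e"
    proof (rule S_le_of_J[OF p h(1)])
      show "p (J n h x - (x + h *\<^sub>R A0 x)) \<le> h * e" for n
        using step[of "h / 2 ^ n" "2 ^ n"] h by (simp add: J_def diff_diff_eq)
    qed
    then show ?thesis by (simp add: diff_diff_eq)
  qed
  then show ?thesis using h0(1) by blast
qed

text \<open>The iterate \<open>J n t\<close> uses the resolvent at the point \<open>l\<close> with
  \<open>(l - \<omega>) * \<delta> = 1 + c / 2 ^ n\<close>, so the norm bound on resolvent powers
  gives \<open>g n\<close>, and the denominators tend to \<open>exp c\<close>.\<close>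

lemma S_norm:
  assumes t: "0 \<le> t"
  shows "norm (S t x) \<le> M * exp ((\<omega> - \<alpha>) * t) * norm x"
proof (cases "t = 0")
  case True
  have "1 * norm x \<le> M * norm x" using M_ge_1 by (intro mult_right_mono) auto
  then show ?thesis using True by (simp add: S_0)
next
  case False
  then have t0: "0 < t" using t by simp
  define c where "c = (\<alpha> - \<omega>) * t"
  define g where "g n = M / (1 + c / 2 ^ n) ^ (2 ^ n) * norm x" for n :: nat
  have lim2: "filterlim (\<lambda>n::nat. (2::nat) ^ n) sequentially sequentially"
    unfolding filterlim_at_top
  proof
    fix Z :: nat
    have "Z \<le> 2 ^ n" if "Z \<le> n" for n
      using that less_exp[of n] by linarith
    then show "\<forall>\<^sub>F n in sequentially. Z \<le> 2 ^ n" by (rule eventually_sequentiallyI)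
  qed
  have "(\<lambda>n. (1 + c / real n) ^ n) \<longlonglongrightarrow> exp c" by (rule tendsto_exp_limit_sequentially)
  from filterlim_compose[OF this lim2] have "(\<lambda>n. (1 + c / 2 ^ n) ^ (2 ^ n)) \<longlonglongrightarrow> exp c" by simp
  then have "g \<longlonglongrightarrow> M / exp c * norm x"
    unfolding g_def by (intro tendsto_intros) auto
  then have g: "g \<longlonglongrightarrow> M * exp ((\<omega> - \<alpha>) * t) * norm x"
    by (simp add: c_def exp_minus divide_inverse algebra_simps flip: exp_minus)
  \<comment> \<open>From \<open>N\<close> on \<open>1 + c / 2 ^ n\<close> is positive, which puts
    \<open>l\<close> beyond \<open>\<omega>\<close>, where the norm bound is available.\<close>
  obtain N where N: "\<bar>c\<bar> < 2 ^ N" using real_arch_pow[of 2 "\<bar>c\<bar>"] by auto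
  have "\<bar>c\<bar> < 2 ^ n" if "N \<le> n" for n
    using N power_increasing[OF that, of "2::real"] by linarith
  then have ev: "\<forall>\<^sub>F n in sequentially. \<bar>c\<bar> < 2 ^ n" by (rule eventually_sequentiallyI)
  have J_le: "norm (J n t x) \<le> g n" if n: "\<bar>c\<bar> < 2 ^ n" for n
  proof -
    define \<delta> where "\<delta> = t / 2 ^ n"
    define l where "l = \<alpha> + 1 / \<delta>"
    have \<delta>: "0 < \<delta>" using t0 by (simp add: \<delta>_def)
    have c\<delta>: "c / 2 ^ n = (\<alpha> - \<omega>) * \<delta>" by (simp add: c_def \<delta>_def)
    have "- (2 ^ n) < c" using n by linarith
    then have "- 1 < c / 2 ^ n" by (simp add: field_simps)
    then have pos: "0 < 1 + (\<alpha> - \<omega>) * \<delta>" by (simp add: c\<delta>)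
    have l: "(l - \<omega>) * \<delta> = 1 + (\<alpha> - \<omega>) * \<delta>" using \<delta> by (simp add: l_def field_simps)
    then have "0 < (l - \<omega>) * \<delta>" using pos by simp
    then have "0 < l - \<omega>" by (rule zero_less_mult_pos2[OF _ \<delta>])
    then have "\<omega> < l" by simp
    have "(F \<delta> ^^ k) x = (1 / \<delta>) ^ k *\<^sub>R (R (of_real l) ^^ k) x" for k
    proof (induction k)
      case (Suc k)
      have eq: "(F \<delta> ^^ Suc k) x = (1 / \<delta>) ^ k *\<^sub>R F \<delta> ((R (of_real l) ^^ k) x)"
        using Suc F_scaleR[of \<delta>] \<delta> by simp
      have F_eq: "F \<delta> y = (1 / \<delta>) *\<^sub>R R (of_real l) y" for y
        using \<delta> by (simp add: F_def l_def)
      show ?case unfolding eq F_eq[of "(R (of_real l) ^^ k) x"] by simp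
    qed simp
    then have "norm (J n t x) = (1 / \<delta>) ^ (2 ^ n) * norm ((R (of_real l) ^^ (2 ^ n)) x)"
      using \<delta> by (simp add: J_def \<delta>_def[symmetric])
    also have "\<dots> \<le> (1 / \<delta>) ^ (2 ^ n) * (M / (l - \<omega>) ^ (2 ^ n) * norm x)"
      using \<delta> by (intro mult_left_mono R_power_norm[OF \<open>\<omega> < l\<close>]) auto
    also have "\<dots> = M / ((l - \<omega>) * \<delta>) ^ (2 ^ n) * norm x"
      by (simp add: power_mult_distrib power_divide)
    also have "\<dots> = g n" by (simp add: g_def l c\<delta>)
    finally show ?thesis .
  qed
  \<comment> \<open>The iterates converge in \<open>\<tau>\<close> but possibly not in norm, so the
    limit is taken in the pairings with the unit ball of Y.\<close>
  show ?thesis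
  proof (rule norm_leI)
    fix y :: 'y assume y: "norm y \<le> 1"
    have "(\<lambda>n. norm (B (J n t x) y)) \<longlonglongrightarrow> norm (B (S t x) y)"
      by (intro tendsto_norm tau_converges_to_B J_converges t)
    moreover have "\<forall>\<^sub>F n in sequentially. norm (B (J n t x) y) \<le> g n"
      using ev
    proof eventually_elim
      case (elim n)
      have "norm (B (J n t x) y) \<le> norm (J n t x) * norm y" by (rule norm_B_le)
      also have "\<dots> \<le> norm (J n t x) * 1" using y by (intro mult_left_mono) auto
      finally show ?case using J_le[OF elim] by simp
    qed
    ultimately show "norm (B (S t x) y) \<le> M * exp ((\<omega> - \<alpha>) * t) * norm x"
      by (intro tendsto_le[OF _ g]) auto
  qed
qed

lemma S_diff_bound:
  assumes p: "p \<in> Q"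
  shows "\<exists>q\<in>Q. \<forall>t\<ge>0. \<forall>r\<ge>0. \<forall>x. p (S r x - S t x) \<le> q (S \<bar>r - t\<bar> x - x)"
proof -
  obtain q where q: "q \<in> Q" "\<And>t x. 0 \<le> t \<Longrightarrow> p (S t x) \<le> q x" using S_seminorm[OF p] by blast
  have le: "p (S (t + h) x - S t x) \<le> q (S h x - x)" if "0 \<le> t" "0 \<le> h" for t h x
    using q(2)[OF that(1), of "S h x - x"] by (simp add: linear_map_diff[OF S_linear] that S_add)
  have "p (S r x - S t x) \<le> q (S \<bar>r - t\<bar> x - x)" if "0 \<le> t" "0 \<le> r" for t r x
  proof (cases "t \<le> r")
    case True
    then show ?thesis using le[of t "r - t" x] that by simp
  next
    case False
    then show ?thesis
      using le[of r "t - r" x] that tau.minus_commute[OF p, of "S r x" "S t x"] by simp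
  qed
  then show ?thesis using q(1) by blast
qed

lemma S_tendsto:
  assumes p: "p \<in> Q" and t: "0 \<le> t"
  shows "((\<lambda>r. p (S r x - S t x)) \<longlongrightarrow> 0) (at t within {0..})"
proof (rule tendstoI)
  fix e :: real assume e: "0 < e"
  obtain q where q: "q \<in> Q" "\<And>t r x. 0 \<le> t \<Longrightarrow> 0 \<le> r \<Longrightarrow> p (S r x - S t x) \<le> q (S \<bar>r - t\<bar> x - x)"
    using S_diff_bound[OF p] by blast
  obtain d where d: "0 < d" "\<And>h. 0 \<le> h \<Longrightarrow> h \<le> d \<Longrightarrow> q (S h x - x) \<le> e / 2"
    using S_near_id[OF q(1), of "e / 2" x] e by auto
  have "dist (p (S r x - S t x)) 0 < e" if "0 \<le> r" "dist r t < d" for r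
  proof -
    have "p (S r x - S t x) \<le> e / 2"
      using q(2)[OF t that(1), of x] d(2)[of "\<bar>r - t\<bar>"] that(2) by (simp add: dist_real_def)
    then show ?thesis using e tau.nonneg[OF p, of "S r x - S t x"] by simp
  qed
  then show "\<forall>\<^sub>F r in at t within {0..}. dist (p (S r x - S t x)) 0 < e"
    unfolding eventually_at using d(1) by (intro exI[of _ d]) auto
qed

text \<open>Only a forward estimate is available. For \<open>r < t\<close> it is applied at
  \<open>r\<close>, and continuity of \<open>S\<close> on \<open>A0 x\<close> replaces the slope at
  \<open>r\<close> by the slope at \<open>t\<close>.\<close>

lemma B_S_derivative:
  assumes x: "x \<in> D" and t: "0 \<le> t"
  shows "((\<lambda>t. B (S t x) y) has_vector_derivative B (S t (A0 x)) y) (at t within {0..})"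
  unfolding has_vector_derivative_def has_derivative_within_alt
proof (intro conjI allI impI)
  show "bounded_linear (\<lambda>h. h *\<^sub>R B (S t (A0 x)) y)" by (rule bounded_linear_scaleR_left)
  fix e :: real assume e: "0 < e"
  obtain q where q: "q \<in> Q" "\<And>t z. 0 \<le> t \<Longrightarrow> norm (B (S t z) y) \<le> q z"
    using S_seminorm[OF norm_B_seminorm[of y]] by blast
  obtain d1 where d1: "0 < d1" "\<And>h. 0 \<le> h \<Longrightarrow> h \<le> d1 \<Longrightarrow> q (S h x - x - h *\<^sub>R A0 x) \<le> h * (e / 2)"
    using S_derivative_bound[OF q(1) _ x, of "e / 2"] e by auto
  obtain d2 where d2: "0 < d2" "\<And>h. 0 \<le> h \<Longrightarrow> h \<le> d2 \<Longrightarrow> q (S h (A0 x) - A0 x) \<le> e / 2"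
    using S_near_id[OF q(1), of "e / 2"] e by auto
  have forward: "norm (B (S (r + h) x) y - B (S r x) y - h *\<^sub>R B (S r (A0 x)) y) \<le> h * (e / 2)"
    if "0 \<le> r" "0 \<le> h" "h \<le> d1" for r h
  proof -
    have "S r (h *\<^sub>R A0 x) = h *\<^sub>R S r (A0 x)"
      using linear_map_scale[OF S_linear[OF that(1)], of "of_real h"] by (simp add: sX_real)
    then have "B (S (r + h) x) y - B (S r x) y - h *\<^sub>R B (S r (A0 x)) y =
        B (S r (S h x - x - h *\<^sub>R A0 x)) y"
      using that by (simp add: S_add linear_map_diff[OF S_linear] B_simps)
    then show ?thesis
      using q(2)[OF that(1), of "S h x - x - h *\<^sub>R A0 x"] d1(2)[OF that(2,3)] by simp
  qed
  have "norm (B (S r x) y - B (S t x) y - (r - t) *\<^sub>R B (S t (A0 x)) y) \<le> e * norm (r - t)"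
    if r: "0 \<le> r" "norm (r - t) < min d1 d2" for r
  proof (cases "t \<le> r")
    case True
    then have "(r - t) * (e / 2) \<le> (r - t) * e" using e by (intro mult_left_mono) auto
    then show ?thesis using forward[OF t, of "r - t"] r True by (simp add: mult.commute)
  next
    case False
    define h where "h = t - r"
    have h: "0 \<le> h" "h \<le> d1" "h \<le> d2" "t = r + h" using False r by (auto simp: h_def)
    have "B (S t (A0 x)) y - B (S r (A0 x)) y = B (S r (S h (A0 x) - A0 x)) y"
      using r h by (simp add: S_add linear_map_diff[OF S_linear] B_simps)
    then have "norm (B (S t (A0 x)) y - B (S r (A0 x)) y) \<le> e / 2"
      using q(2)[OF r(1), of "S h (A0 x) - A0 x"] d2(2)[OF h(1,3)] by simp
    then have "h * norm (B (S t (A0 x)) y - B (S r (A0 x)) y) \<le> h * (e / 2)"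
      using h(1) by (intro mult_left_mono) auto
    then have 1: "norm (h *\<^sub>R (B (S t (A0 x)) y - B (S r (A0 x)) y)) \<le> h * (e / 2)" using h(1) by simp
    have 2: "norm (B (S t x) y - B (S r x) y - h *\<^sub>R B (S r (A0 x)) y) \<le> h * (e / 2)"
      using forward[OF r(1) h(1,2)] by (simp add: h(4))
    have eq: "B (S r x) y - B (S t x) y - (r - t) *\<^sub>R B (S t (A0 x)) y =
        h *\<^sub>R (B (S t (A0 x)) y - B (S r (A0 x)) y) - (B (S t x) y - B (S r x) y - h *\<^sub>R B (S r (A0 x)) y)"
      by (simp add: h_def algebra_simps)
    have "norm (B (S r x) y - B (S t x) y - (r - t) *\<^sub>R B (S t (A0 x)) y) \<le> h * (e / 2) + h * (e / 2)"
      unfolding eq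
      using norm_triangle_ineq4[of "h *\<^sub>R (B (S t (A0 x)) y - B (S r (A0 x)) y)"
          "B (S t x) y - B (S r x) y - h *\<^sub>R B (S r (A0 x)) y"] 1 2 by linarith
    then show ?thesis using False by (simp add: h_def mult.commute)
  qed
  then show "\<exists>d>0. \<forall>r\<in>{0..}. norm (r - t) < d \<longrightarrow>
      norm (B (S r x) y - B (S t x) y - (r - t) *\<^sub>R B (S t (A0 x)) y) \<le> e * norm (r - t)"
    using d1(1) d2(1) by (intro exI[of _ "min d1 d2"]) auto
qed

section \<open>The semigroup \<open>T\<close> obtained by rescaling\<close>

definition T :: "real \<Rightarrow> 'x \<Rightarrow> 'x" where
  "T t x = exp (\<alpha> * t) *\<^sub>R S t x"

lemma T_linear: "0 \<le> t \<Longrightarrow> Vector_Spaces.linear sX sX (T t)"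
  using S_linear[of t] unfolding Vector_Spaces.linear_iff T_def
  by (simp add: X.scale_right_distrib X.scale_left_commute flip: sX_real)

lemma T_scaleR: "0 \<le> t \<Longrightarrow> T t (r *\<^sub>R x) = r *\<^sub>R T t x"
  using linear_map_scale[OF T_linear, of t "of_real r" x] by (simp add: sX_real)

lemma T_norm:
  assumes t: "0 \<le> t"
  shows "norm (T t x) \<le> M * exp (\<omega> * t) * norm x"
proof -
  have "norm (T t x) \<le> exp (\<alpha> * t) * (M * exp ((\<omega> - \<alpha>) * t) * norm x)"
    unfolding T_def norm_scaleR using S_norm[OF t, of x] by simp
  also have "\<dots> = M * (exp (\<alpha> * t) * exp ((\<omega> - \<alpha>) * t)) * norm x" by (simp only: mult_ac)
  also have "exp (\<alpha> * t) * exp ((\<omega> - \<alpha>) * t) = exp (\<omega> * t)"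
    by (simp add: algebra_simps flip: exp_add)
  finally show ?thesis .
qed

lemma T_operator_bound:
  assumes t: "0 \<le> t" and p: "p \<in> Q"
  shows "\<exists>q\<in>Q. \<forall>x. p (T t x) \<le> q x"
proof -
  obtain q where q: "q \<in> Q" "\<And>x. p (S t x) \<le> q x" using S_seminorm[OF p] t by blast
  then have "p (T t x) \<le> exp (\<alpha> * t) * q x" for x by (simp add: T_def tau_scaleR[OF p])
  moreover have "(\<lambda>x. exp (\<alpha> * t) * q x) \<in> Q"
    by (rule continuous_seminorms_mult[OF vsX lc q(1)]) simp
  ultimately show ?thesis by (intro bexI[of _ "\<lambda>x. exp (\<alpha> * t) * q x"]) auto
qed

lemma T_type: "semigroup_of_type sX B M \<omega> T"
  unfolding semigroup_of_type_def
proof (intro conjI allI impI M_ge_1)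
  show "T 0 = id" by (simp add: T_def S_0 fun_eq_iff)
  fix t :: real assume t: "0 \<le> t"
  show "T t \<in> continuous_operators sX (weak_topology B)"
    by (intro weak_continuous_operatorsI T_linear t adjoint_exists T_operator_bound)
  show "bounded_linear (T t)"
    by (rule bounded_linear_intro[of _ "M * exp (\<omega> * t)"])
       (use T_norm[OF t] in \<open>simp_all add: linear_map_add[OF T_linear] T_scaleR t mult_ac\<close>)
  show "onorm (T t) \<le> M * exp (\<omega> * t)"
    using M_ge_1 T_norm[OF t] by (intro Operator_Norm.onorm_bound) auto
  fix r :: real assume r: "0 \<le> r"
  have "T t (T r x) = exp (\<alpha> * r) *\<^sub>R T t (S r x)" for x by (simp add: T_def[of r] T_scaleR t)
  then show "T (t + r) = T t \<circ> T r"
    using t r by (simp add: fun_eq_iff T_def S_add distrib_left exp_add mult.commute)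
qed

lemma T_quasi_equicontinuous: "quasi_equicontinuous sX \<tau> \<alpha> T"
proof -
  have S_eq: "exp (- \<alpha> * t) *\<^sub>R T t x = S t x" for t x by (simp add: T_def flip: exp_add)
  have "S t \<in> continuous_operators sX \<tau>" if "0 \<le> t" for t
    by (rule continuous_operatorsI[OF vsX lc S_linear[OF that]]) (use S_seminorm that in blast)
  moreover have "\<exists>q. is_seminorm sX q \<and> continuous_map \<tau> euclidean q \<and> (\<forall>t\<ge>0. \<forall>x. p (S t x) \<le> q x)"
    if "is_seminorm sX p" "continuous_map \<tau> euclidean p" for p
    using S_seminorm[of p] that unfolding continuous_seminorms_def by blast
  ultimately show ?thesis
    unfolding quasi_equicontinuous_def equicontinuous_ops_def S_eq by fastforce
qed

lemma T_continuous: "continuous_semigroup \<tau> T"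
  unfolding continuous_semigroup_iff[OF vsX lc]
proof (intro allI ballI impI)
  fix x p and t :: real assume t: "0 \<le> t" and p: "p \<in> Q"
  have "((\<lambda>r. exp (\<alpha> * r) * p (S r x - S t x) + \<bar>exp (\<alpha> * r) - exp (\<alpha> * t)\<bar> * p (S t x)) \<longlongrightarrow>
      exp (\<alpha> * t) * 0 + \<bar>exp (\<alpha> * t) - exp (\<alpha> * t)\<bar> * p (S t x)) (at t within {0..})"
    by (intro tendsto_intros S_tendsto p t)
  then have lim: "((\<lambda>r. exp (\<alpha> * r) * p (S r x - S t x) + \<bar>exp (\<alpha> * r) - exp (\<alpha> * t)\<bar> * p (S t x)) \<longlongrightarrow> 0)
      (at t within {0..})" by simp
  have "p (T r x - T t x) \<le> exp (\<alpha> * r) * p (S r x - S t x) + \<bar>exp (\<alpha> * r) - exp (\<alpha> * t)\<bar> * p (S t x)" for r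
  proof -
    have "T r x - T t x = exp (\<alpha> * r) *\<^sub>R (S r x - S t x) + (exp (\<alpha> * r) - exp (\<alpha> * t)) *\<^sub>R S t x"
      by (simp add: T_def algebra_simps)
    then show ?thesis
      using tau.add[OF p, of "exp (\<alpha> * r) *\<^sub>R (S r x - S t x)" "(exp (\<alpha> * r) - exp (\<alpha> * t)) *\<^sub>R S t x"]
      by (simp add: tau_scaleR[OF p])
  qed
  then show "((\<lambda>r. p (T r x - T t x)) \<longlongrightarrow> 0) (at t within {0..})"
    using tau.nonneg[OF p] by (intro tendsto_sandwich[OF _ _ tendsto_const lim]) auto
qed

lemma B_T_derivative:
  assumes x: "x \<in> D" and t: "0 \<le> t"
  shows "((\<lambda>t. B (T t x) y) has_vector_derivative B (T t (A x)) y) (at t within {0..})"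
proof -
  have A0: "A x = A0 x + \<alpha> *\<^sub>R x" by (simp add: A0_def)
  have "S t (\<alpha> *\<^sub>R x) = \<alpha> *\<^sub>R S t x"
    using linear_map_scale[OF S_linear[OF t], of "of_real \<alpha>"] by (simp add: sX_real)
  then have eq: "B (T t (A x)) y = exp (\<alpha> * t) *\<^sub>R B (S t (A0 x)) y + (exp (\<alpha> * t) * \<alpha>) *\<^sub>R B (S t x) y"
    by (simp add: T_def A0 linear_map_add[OF S_linear[OF t]] B_simps scaleR_add_right)
  have "((\<lambda>t. exp (\<alpha> * t)) has_real_derivative exp (\<alpha> * t) * \<alpha>) (at t within {0..})"
    by (auto intro!: derivative_eq_intros)
  from has_vector_derivative_scaleR[OF this B_S_derivative[OF x t, of y]]
  show ?thesis unfolding eq by (simp add: T_def B_simps)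
qed

lemma T_kernel_norm:
  assumes t: "0 \<le> t"
  shows "norm (exp (- l * of_real t) * B (T t x) y) \<le> M * norm x * norm y * exp (- (re_part l - \<omega>) * t)"
proof -
  have "norm (B (T t x) y) \<le> M * exp (\<omega> * t) * norm x * norm y"
    using norm_B_le[of "T t x" y] mult_right_mono[OF T_norm[OF t, of x] norm_ge_zero[of y]] by simp
  moreover have "norm (exp (- l * of_real t)) = exp (- (re_part l * t))"
  proof -
    have "- l * of_real t = (- t) *\<^sub>R l" by (simp add: scaleR_conv_of_real mult.commute)
    then show ?thesis by (simp add: norm_exp_re_part re_part_def mult.commute)
  qed
  ultimately have "norm (exp (- l * of_real t) * B (T t x) y) \<le>
      exp (- (re_part l * t)) * (M * exp (\<omega> * t) * norm x * norm y)"
    by (simp add: norm_mult)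
  also have "\<dots> = M * norm x * norm y * (exp (- (re_part l * t)) * exp (\<omega> * t))" by (simp only: mult_ac)
  also have "exp (- (re_part l * t)) * exp (\<omega> * t) = exp (- (re_part l - \<omega>) * t)"
    by (simp add: algebra_simps flip: exp_add)
  finally show ?thesis .
qed

lemma T_kernel_continuous: "continuous_on {0..} (\<lambda>t. exp (- l * of_real t) * B (T t x) y)"
proof -
  have "continuous_on {0..} (\<lambda>t. B (T t x) y)"
    unfolding continuous_on_def
  proof
    fix t :: real assume "t \<in> {0..}"
    then have "((\<lambda>r. norm (B (T r x - T t x) y)) \<longlongrightarrow> 0) (at t within {0..})"
      using T_continuous norm_B_seminorm unfolding continuous_semigroup_iff[OF vsX lc] by force
    then show "((\<lambda>r. B (T r x) y) \<longlongrightarrow> B (T t x) y) (at t within {0..})"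
      by (simp add: B_simps tendsto_norm_zero_iff LIM_zero_iff)
  qed
  then show ?thesis by (intro continuous_intros)
qed

section \<open>The resolvent on the half-plane and the Laplace transform\<close>

context
  fixes l :: 'k assumes l: "\<omega> < re_part l"
begin

text \<open>Comparing squares, the inequality amounts to \<open>(norm l)\<^sup>2 - \<omega>\<^sup>2
  < 2 * m * (re_part l - \<omega>)\<close>, which holds as soon as \<open>m\<close> exceeds
  \<open>c\<close>. The discs around large real points thus exhaust the half-plane.\<close>

lemma near_large_real: "\<exists>m. \<omega> < m \<and> \<alpha> < m \<and> norm (of_real m - l) < m - \<omega>"
proof -
  define c where "c = ((norm l)\<^sup>2 - \<omega>\<^sup>2) / (2 * (re_part l - \<omega>))"
  define m where "m = max (max \<alpha> \<omega> + 1) (c + 1)"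
  have m: "\<omega> < m" "\<alpha> < m" "c < m" by (auto simp: m_def)
  have "(norm l)\<^sup>2 - \<omega>\<^sup>2 < m * (2 * (re_part l - \<omega>))"
    using m(3) l by (simp add: c_def pos_divide_less_eq)
  moreover have "(norm (of_real m - l))\<^sup>2 = m\<^sup>2 - 2 * m * re_part l + (norm l)\<^sup>2"
    using dot_norm_neg[of "of_real m" l] inner_scaleR_left[of m 1 l]
    by (simp add: re_part_def scaleR_conv_of_real inner_commute)
  ultimately have "(norm (of_real m - l))\<^sup>2 < (m - \<omega>)\<^sup>2"
    by (simp add: power2_eq_square algebra_simps)
  then have "norm (of_real m - l) < m - \<omega>"
    by (rule power2_less_imp_less) (use m(1) in simp)
  then show ?thesis using m by blast
qed

lemma regular_half_plane: "regular l"
proof -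
  obtain m where m: "\<omega> < m" "\<alpha> < m" "norm (of_real m - l) < m - \<omega>" using near_large_real by blast
  show ?thesis
  proof (rule regular_neumann[OF normX.seminorm_family_axioms regular_omega[OF m(1)]])
    fix q b assume "q \<in> {norm :: 'x \<Rightarrow> real}"
    then have q: "q = norm" by simp
    show "\<exists>q'\<in>{norm}. \<exists>C. \<forall>x. q (R (of_real m) x) \<le> C * q' x"
      using R_power_norm[OF m(1), of 1] by (auto simp: q intro!: exI[of _ "M / (m - \<omega>)"])
    show "\<exists>C. \<forall>k. q ((R (of_real m) ^^ k) b) \<le> C * (1 / (m - \<omega>)) ^ k"
      using R_power_norm[OF m(1), of _ b]
      by (intro exI[of _ "M * norm b"]) (simp add: q power_divide)
  qed (use m in auto)
qed

text \<open>With \<open>K\<close> the adjoint of the resolvent at \<open>m\<close>, transposing the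
  resolvent identity suggests the equation \<open>w = K y + c K w\<close> for the image
  \<open>w\<close> of y. It is solved by a Neumann series in Y, where \<open>K\<close> inherits the
  power bounds through the norming property.\<close>

lemma resolvent_adjoint: "\<exists>y'. \<forall>x. B (R l x) y = B x y'"
proof -
  obtain m where m: "\<omega> < m" "\<alpha> < m" "norm (of_real m - l) < m - \<omega>" using near_large_real by blast
  define Rm where "Rm = R (of_real m)"
  define c where "c = of_real m - l"
  have reg: "regular (of_real m)" by (rule regular_omega[OF m(1)])
  \<comment> \<open>As \<open>m > \<alpha>\<close>, \<open>Rm\<close> is a multiple of an Euler
    step, which supplies the \<open>\<tau>\<close>-estimates.\<close>
  have "\<exists>y'. \<forall>x. B (Rm x) y = B x y'" for y
  proof (rule adjoint_exists)
    show "Vector_Spaces.linear sX sX Rm" unfolding Rm_def by (rule R_linear[OF reg])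
    fix p assume p: "p \<in> Q"
    obtain q where q: "q \<in> Q" "\<And>\<delta> k x. 0 \<le> \<delta> \<Longrightarrow> p ((F \<delta> ^^ k) x) \<le> q x"
      using F_power_seminorm[OF p] by blast
    define \<delta> where "\<delta> = 1 / (m - \<alpha>)"
    have \<delta>: "0 < \<delta>" using m by (simp add: \<delta>_def)
    have "Rm x = \<delta> *\<^sub>R F \<delta> x" for x using m by (simp add: F_def Rm_def \<delta>_def)
    then have "p (Rm x) \<le> \<delta> * q x" for x
      using q(2)[of \<delta> 1 x] \<delta> by (simp add: tau_scaleR[OF p])
    moreover have "(\<lambda>x. \<delta> * q x) \<in> Q"
      using \<delta> by (intro continuous_seminorms_mult[OF vsX lc q(1)]) simp
    ultimately show "\<exists>q\<in>Q. \<forall>x. p (Rm x) \<le> q x" by (intro bexI[of _ "\<lambda>x. \<delta> * q x"]) auto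
  qed
  then obtain K where K: "\<And>x y. B (Rm x) y = B x (K y)" by metis
  have K_pow: "B ((Rm ^^ k) x) y = B x ((K ^^ k) y)" for k x y
    by (induction k arbitrary: x) (simp_all add: K funpow_swap1)
  have K_lin: "Vector_Spaces.linear sY sY K"
    unfolding Vector_Spaces.linear_iff
    by (intro conjI allI vsY B_eqI_right) (simp_all add: B_simps flip: K)
  have K_norm: "norm ((K ^^ k) y) \<le> M * norm y * (1 / (m - \<omega>)) ^ k" for k y
  proof (rule norm_leI_right)
    fix x :: 'x assume x: "norm x \<le> 1"
    have "norm (B x ((K ^^ k) y)) \<le> norm ((Rm ^^ k) x) * norm y" by (simp add: norm_B_le flip: K_pow)
    also have "\<dots> \<le> (M / (m - \<omega>) ^ k * 1) * norm y"
    proof (intro mult_right_mono)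
      have "norm ((Rm ^^ k) x) \<le> M / (m - \<omega>) ^ k * norm x"
        unfolding Rm_def by (rule R_power_norm[OF m(1)])
      also have "\<dots> \<le> M / (m - \<omega>) ^ k * 1"
        using x M_ge_1 m(1) by (intro mult_left_mono) auto
      finally show "norm ((Rm ^^ k) x) \<le> M / (m - \<omega>) ^ k * 1" .
    qed simp
    finally show "norm (B x ((K ^^ k) y)) \<le> M * norm y * (1 / (m - \<omega>)) ^ k"
      by (simp add: power_divide)
  qed
  have "\<exists>w. w = K y + sY c (K w)"
  proof (rule normY.neumann_solution[OF K_lin])
    fix q assume "q \<in> {norm :: 'y \<Rightarrow> real}"
    then have q: "q = norm" by simp
    show "\<exists>q'\<in>{norm}. \<exists>C. \<forall>x. q (K x) \<le> C * q' x"
      using K_norm[of 1] by (auto simp: q intro!: exI[of _ "M / (m - \<omega>)"])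
    show "\<exists>C. \<forall>k. q ((K ^^ k) (K y)) \<le> C * (1 / (m - \<omega>)) ^ k"
      using K_norm[of _ "K y"] unfolding q by blast
  qed (use m in \<open>auto simp: c_def\<close>)
  then obtain w where w: "w = K y + sY c (K w)" by blast
  have "B (R l x) y = B x w" for x
  proof -
    \<comment> \<open>\<open>B v w\<close> is computed twice, from the equation for \<open>w\<close>
      and from the definition of \<open>v\<close>; the terms \<open>c * B (R l x) w\<close>
      cancel.\<close>
    define v where "v = x + sX c (R l x)"
    have Rv: "R l x = Rm v"
      unfolding v_def c_def Rm_def by (rule resolvent_identity[OF regular_half_plane reg])
    have "B v w = B v (K y) + c * B v (K w)"
      using arg_cong[OF w, of "B v"] by (simp only: B_simps)
    then have "B v w = B (Rm v) y + c * B (Rm v) w" by (simp only: K)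
    moreover have "B v w = B x w + c * B (R l x) w" unfolding v_def B_simps ..
    ultimately show ?thesis by (simp add: Rv)
  qed
  then show ?thesis by blast
qed

text \<open>For \<open>x = R l z\<close> one has \<open>A x = l x - z\<close>, so the damped orbit
  \<open>g\<close> of \<open>x\<close> has derivative \<open>- f\<close>, where \<open>f\<close> is
  the Laplace kernel of \<open>z\<close>. As \<open>g\<close> tends to 0, integration leaves
  \<open>g 0 = B x y\<close>.\<close>

lemma laplace_transform_T: "is_laplace_transform_at sX B T l (R l)"
  unfolding is_laplace_transform_at_def
proof (intro conjI allI)
  show "R l \<in> continuous_operators sX (weak_topology B)"
    by (rule weak_continuous_operatorsI[OF R_linear[OF regular_half_plane] resolvent_adjoint])
  fix z y
  define f where "f t = exp (- l * of_real t) * B (T t z) y" for t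
  have pos: "0 < re_part l - \<omega>" using l by simp
  note half_line = half_line_integral[OF T_kernel_continuous[of l z y] pos T_kernel_norm]
  show "set_integrable lebesgue {0..} (\<lambda>t. exp (- l * of_real t) * B (T t z) y)"
    by (rule half_line(1))
  define x where "x = R l z"
  have x: "x \<in> D" "A x = sX l x - z"
    unfolding x_def using R_in_D[OF regular_half_plane] A_R[OF regular_half_plane] by auto
  define g where "g t = exp (- l * of_real t) * B (T t x) y" for t
  have exp_eq: "exp (- l * of_real t) = exp (t *\<^sub>R (- l))" for t
    by (simp add: scaleR_conv_of_real mult.commute)
  have g': "(g has_vector_derivative - f t) (at t within {0..})" if t: "0 \<le> t" for t
  proof -
    have "(g has_vector_derivative exp (t *\<^sub>R (- l)) * B (T t (A x)) y + exp (t *\<^sub>R (- l)) * (- l) * B (T t x) y)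
        (at t within {0..})"
      unfolding g_def exp_eq
      by (intro has_vector_derivative_mult exp_scaleR_has_vector_derivative_right B_T_derivative x(1) t)
    moreover have "B (T t (A x)) y = l * B (T t x) y - B (T t z) y"
      by (simp add: x(2) linear_map_diff[OF T_linear[OF t]] linear_map_scale[OF T_linear[OF t]] B_simps)
    ultimately show ?thesis
      unfolding f_def exp_eq by (simp add: algebra_simps)
  qed
  have int: "integral {0..n} f = B x y - g n" if n: "0 \<le> n" for n
  proof -
    have "((\<lambda>t. - f t) has_integral (g n - g 0)) {0..n}"
      by (rule fundamental_theorem_of_calculus[OF n], rule has_vector_derivative_within_subset[OF g']) auto
    from has_integral_neg[OF this] have "(f has_integral (g 0 - g n)) {0..n}" by simp
    moreover have "g 0 = B x y" using T_type by (simp add: g_def semigroup_of_type_def)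
    ultimately show ?thesis by (simp add: integral_unique)
  qed
  have "(g \<longlongrightarrow> 0) at_top"
  proof (rule Lim_null_comparison)
    show "\<forall>\<^sub>F t in at_top. norm (g t) \<le> M * norm x * norm y * exp (- (re_part l - \<omega>) * t)"
      unfolding g_def using eventually_ge_at_top[of 0] by eventually_elim (rule T_kernel_norm)
    have "((\<lambda>t. exp (- (re_part l - \<omega>) * t)) \<longlongrightarrow> 0) at_top"
      by (rule filterlim_compose[OF exp_at_bot])
         (use pos in \<open>auto intro!: filterlim_tendsto_neg_mult_at_bot[OF tendsto_const _ filterlim_ident]\<close>)
    then show "((\<lambda>t. M * norm x * norm y * exp (- (re_part l - \<omega>) * t)) \<longlongrightarrow> 0) at_top"
      by (rule tendsto_mult_right_zero)
  qed
  then have "((\<lambda>n. B x y - g n) \<longlongrightarrow> B x y - 0) at_top" by (intro tendsto_intros)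
  moreover have "\<forall>\<^sub>F n in at_top. B x y - g n = integral {0..n} f"
    by (intro eventually_mono[OF eventually_ge_at_top[of 0]]) (simp add: int)
  ultimately have "((\<lambda>n. integral {0..n} f) \<longlongrightarrow> B x y) at_top"
    by (simp cong: filterlim_cong)
  then show "B (R l z) y = (LINT t:{0..}|lebesgue. exp (- l * of_real t) * B (T t z) y)"
    using half_line(3) unfolding x_def f_def[abs_def] by (intro tendsto_unique[of at_top]) auto
qed

end

text \<open>Y separates points, so a Laplace transform at \<open>l\<close> is unique and must be
  \<open>R l\<close>.\<close>

lemma T_generator: "is_generator sX B M \<omega> T D A"
  unfolding is_generator_def integrable_semigroup_def
proof (intro conjI allI impI T_type)
  show "\<exists>S. is_laplace_transform_at sX B T l S" if "\<omega> < re_part l" for l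
    using laplace_transform_T[OF that] by blast
  fix l S assume "\<omega> < re_part l \<and> is_laplace_transform_at sX B T l S"
  then have l: "\<omega> < re_part l" and S: "is_laplace_transform_at sX B T l S" by auto
  have reg: "regular l" by (rule regular_half_plane[OF l])
  show "bij_betw (\<lambda>x. sX l x - A x) D UNIV" using reg by (simp add: regular_def)
  show S_eq: "S = R l"
    using S laplace_transform_T[OF l] by (intro ext B_eqI) (simp add: is_laplace_transform_at_def)
  show "inj S" unfolding S_eq by (rule injI) (metis R_right_inverse[OF reg])
qed

end

theorem theorem3p5:
  fixes sX :: "'k::{real_normed_field,euclidean_space} \<Rightarrow> 'x::banach \<Rightarrow> 'x"
    and sY :: "'k \<Rightarrow> 'y::banach \<Rightarrow> 'y"
    and B :: "'x \<Rightarrow> 'y \<Rightarrow> 'k"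
    and \<tau> :: "'x topology"
    and D :: "'x set" and A :: "'x \<Rightarrow> 'x"
    and M \<alpha> \<omega> :: real
  assumes "norming_dual_pair sX sY B"
    and "consistent_topology sX B \<tau>"
    and "sequentially_complete \<tau>"
    and "linear_operator sX D A"
    and "closed_operator (weak_topology B) D A"
    and "M \<ge> 1"
  shows "(\<exists>T. is_generator sX B M \<omega> T D A \<and> continuous_semigroup \<tau> T \<and>
            quasi_equicontinuous sX \<tau> \<alpha> T)
     \<longleftrightarrow>
         (sequentially_densely_defined \<tau> D \<and>
          ((\<forall>l>\<omega>. of_real l \<in> resolvent_set_weak sX B D A) \<and>
           (\<forall>l>\<omega>. \<forall>k::nat.
              onorm (\<lambda>x. (l - \<omega>) ^ k *\<^sub>R (resolvent sX D A (of_real l) ^^ k) x) \<le> M)) \<and>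
          ((\<forall>l>\<alpha>. of_real l \<in> resolvent_set sX D A) \<and>
           equicontinuous_ops sX \<tau>
             {\<lambda>x. (l - \<alpha>) ^ k *\<^sub>R (resolvent sX D A (of_real l) ^^ k) x | l (k::nat). l > \<alpha>}))"
    (is "?L \<longleftrightarrow> ?R")
proof
  have op: "operator_on_pair sX sY B \<tau> D A"
    using assms by (intro operator_on_pair.intro consistent_pair.intro consistent_pair_axioms.intro
        operator_on_pair_axioms.intro)
  {
    assume ?L
    then obtain T where T: "is_generator sX B M \<omega> T D A" "continuous_semigroup \<tau> T"
      "quasi_equicontinuous sX \<tau> \<alpha> T" by blast
    interpret generator_on_pair sX sY B \<tau> D A M \<alpha> \<omega> T
      using op T by (intro generator_on_pair.intro generator_on_pair_axioms.intro)
    \<comment> \<open>The means were formed at an arbitrary point beyond both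
      \<open>\<alpha>\<close> and \<open>\<omega>\<close>; one such point is fixed here.\<close>
    have "sequentially_densely_defined \<tau> D"
      by (rule densely_defined[of "max \<alpha> \<omega> + 1"]) auto
    then show ?R
      using resolvent_set_weak_right_of_omega onorm_resolvent_power resolvent_set_right_of_alpha
        equicontinuous_resolvents by blast
  next
    assume ?R
    then interpret resolvent_bounds sX sY B \<tau> D A M \<alpha> \<omega>
      using op assms(6) by (intro resolvent_bounds.intro resolvent_bounds_axioms.intro) auto
    show ?L using T_generator T_continuous T_quasi_equicontinuous by blast
  }
qed

end
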